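(* Let $n$ be a positive integer such that $(\mathbb{Z}/n\mathbb{Z})^{*}$ is cyclic. Let $f$ be a divisor of $\phi(n)$ which is relatively prime to $\phi(n)/f$, and let $K_f$ denote the subfield of $\mathbb{Q}(\zeta_n)$ with $[K_f:\mathbb{Q}]=f$. If $f\in\mathbf{R}_{\mathbb{Q}(\zeta_n)/\mathbb{Q}}$, then for every prime $q$ not dividing $\phi(n)/f$ the $q$-part of the class group of $K_f$ is trivial.
   Context: Here $\zeta_n$ is a primitive $n$-th root of unity and $\phi$ is Euler's totient function. For a Galois extension of number fields $L/K$, the residue degree of a prime ideal $\wp$ of $L$ above a prime $\mathfrak{p}$ of $K$ is $[\mathcal{O}_L/\wp:\mathcal{O}_K/\mathfrak{p}]$, and $$\mathbf{R}_{L/K}=\{f\in\mathbb{N}: \text{the class group of } L \text{ is generated by the classes of prime ideals of } L \text{ that are unramified over } K \text{ and have residue degree } f \text{ for } L/K\}.$$ *)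

theory Defs
  imports
    "HOL-Algebra.Algebra"
    "HOL-Algebra.Algebraic_Closure_Type"
    "HOL-Number_Theory.Totient"
    Complex_Main
begin

text \<open>
  Number fields are subfields of the complex numbers of finite degree over \<open>\<rat>\<close>, given by
  their carrier sets. All algebra is the carrier-based algebra of HOL-Algebra, in the ring below.
\<close>

abbreviation complex_ring :: "complex ring" (\<open>\<C>\<close>)
  where "\<C> \<equiv> ring_of_type_algebra"

definition primitive_root_of_unity :: "nat \<Rightarrow> complex \<Rightarrow> bool" where
  "primitive_root_of_unity n \<zeta> \<longleftrightarrow> n > 0 \<and> \<zeta> ^ n = 1 \<and> (\<forall>m. 0 < m \<and> m < n \<longrightarrow> \<zeta> ^ m \<noteq> 1)"

definition adjoin_rat :: "complex \<Rightarrow> complex set" where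
  "adjoin_rat \<zeta> = generate_field \<C> (\<rat> \<union> {\<zeta>})"

definition field_degree :: "complex set \<Rightarrow> complex set \<Rightarrow> nat" where
  "field_degree L K = ring.dim \<C> K L"

definition integers_set :: "complex set \<Rightarrow> complex set" where
  "integers_set L = {x \<in> L. algebraic_int x}"

definition ring_of_integers :: "complex set \<Rightarrow> complex ring" (\<open>\<O>\<close>) where
  "\<O> L = \<C>\<lparr>carrier := integers_set L\<rparr>"


subsection \<open>The ideal class group\<close>

text \<open>Nonzero fractional ideals; \<open>ideal_prod\<close> only forms finite sums of products, so that
  over \<open>\<C>\<close> it is the product of fractional ideals.\<close>

definition fractional_ideal :: "complex set \<Rightarrow> complex set \<Rightarrow> bool" where
  "fractional_ideal L I \<longleftrightarrow>
     I \<subseteq> L \<and> additive_subgroup I \<C> \<and> I \<noteq> {0} \<and>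
     (\<forall>a \<in> integers_set L. \<forall>x \<in> I. a * x \<in> I) \<and>
     (\<exists>d \<in> integers_set L. d \<noteq> 0 \<and> (\<forall>x \<in> I. d * x \<in> integers_set L))"

definition fractional_ideal_group :: "complex set \<Rightarrow> complex set monoid" where
  "fractional_ideal_group L =
     \<lparr>carrier = {I. fractional_ideal L I}, monoid.mult = ideal_prod \<C>, one = integers_set L\<rparr>"

definition principal_fractional_ideals :: "complex set \<Rightarrow> complex set set" where
  "principal_fractional_ideals L = {(\<lambda>a. a * x) ` integers_set L | x. x \<in> L \<and> x \<noteq> 0}"

definition class_group :: "complex set \<Rightarrow> complex set set monoid" where
  "class_group L = fractional_ideal_group L Mod principal_fractional_ideals L"

definition ideal_class :: "complex set \<Rightarrow> complex set \<Rightarrow> complex set set" where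
  "ideal_class L I = principal_fractional_ideals L #>\<^bsub>fractional_ideal_group L\<^esub> I"

text \<open>The \<open>q\<close>-part of an abelian group is its \<open>q\<close>-primary component.\<close>

definition q_part :: "nat \<Rightarrow> ('a, 'b) monoid_scheme \<Rightarrow> 'a set" where
  "q_part q G = {c \<in> carrier G. \<exists>k::nat. c [^]\<^bsub>G\<^esub> (q ^ k) = \<one>\<^bsub>G\<^esub>}"


subsection \<open>Prime ideals in extensions of number fields\<close>

text \<open>For an extension \<open>L/K\<close> and a prime \<open>P\<close> of \<open>L\<close>, the prime of \<open>K\<close> below \<open>P\<close> is
  \<open>P \<inter> integers_set K\<close>, and its residue field is identified with the image of
  \<open>integers_set K\<close> in the residue field of \<open>P\<close>.\<close>

definition prime_of :: "complex set \<Rightarrow> complex set \<Rightarrow> bool" where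
  "prime_of L P \<longleftrightarrow> primeideal P (\<O> L) \<and> P \<noteq> {0}"

definition residue_degree :: "complex set \<Rightarrow> complex set \<Rightarrow> complex set \<Rightarrow> nat" where
  "residue_degree L K P =
     ring.dim (\<O> L Quot P) ((\<lambda>a. P +>\<^bsub>\<O> L\<^esub> a) ` integers_set K) (carrier (\<O> L Quot P))"

text \<open>The exponent of \<open>P\<close> in the ideal of \<open>L\<close> generated by the prime below \<open>P\<close>; powers and
  divisibility are those of the multiplicative monoid of ideals. Residue field extensions are
  separable here, so being unramified only involves this exponent.\<close>

definition ramification_index :: "complex set \<Rightarrow> complex set \<Rightarrow> complex set \<Rightarrow> nat" where
  "ramification_index L K P =
     (GREATEST e::nat. (P [^]\<^bsub>ideals_set (\<O> L)\<^esub> e) divides\<^bsub>ideals_set (\<O> L)\<^esub>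
        (Idl\<^bsub>\<O> L\<^esub> (P \<inter> integers_set K)))"

definition unramified :: "complex set \<Rightarrow> complex set \<Rightarrow> complex set \<Rightarrow> bool" where
  "unramified L K P \<longleftrightarrow> ramification_index L K P = 1"

definition R_set :: "complex set \<Rightarrow> complex set \<Rightarrow> nat set" where
  "R_set L K = {f. generate (class_group L)
       {ideal_class L P | P. prime_of L P \<and> unramified L K P \<and> residue_degree L K P = f}
     = carrier (class_group L)}"

end

theory Submission
  imports Defs "Jordan_Normal_Form.Char_Poly"
begin

text \<open>
  Let \<open>L = \<rat>(\<zeta>)\<close> with Galois group \<open>G\<close>, and let \<open>H\<close> be the group of \<open>L\<close> over \<open>K\<close>. An unramified
  prime \<open>P\<close> of residue degree \<open>f\<close> has a decomposition group of order divisible by \<open>f\<close>, and \<open>|H|\<close> is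
  prime to \<open>f\<close> with \<open>|G| = f |H|\<close>, so \<open>H\<close> permutes the conjugates of \<open>P\<close> transitively. Their
  product is the rational prime below \<open>P\<close>; hence the norm \<open>\<Prod>h\<in>H. h P\<close> is principal. If such primes
  generate the class group of \<open>L\<close>, all norms over \<open>H\<close> are principal; applied to an ideal \<open>I\<close> of \<open>K\<close>
  this makes \<open>I ^ |H|\<close> principal in \<open>L\<close>, and after a second norm \<open>I ^ (|H| ^ 2)\<close> principal in \<open>K\<close>.
  Since \<open>q\<close> does not divide \<open>|H|\<close>, no class of \<open>K\<close> has order a positive power of \<open>q\<close>.

  Neither the invertibility of all fractional ideals nor the irreducibility of cyclotomic polynomials
  is needed: the ideals that occur are visibly invertible, being generated by divisors of
  principal ideals, and it suffices that \<open>|G|\<close> divides \<open>\<phi>(n)\<close>.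
\<close>


section \<open>Sums and products of algebraic integers\<close>

text \<open>All finiteness comes from one source: more elements of L than its degree satisfy an
  integer relation, and dividing by the gcd keeps it nontrivial modulo p
  (\<open>int_dependence_mod\<close>). Applied to powers of an element, to lifts of residue classes
  and to elements of successive powers of P, it yields inverses modulo P, a finite residue field,
  and a bound on the exponents over which \<open>ramification_index\<close> takes its maximum. The
  obstacle is that fractional ideals are at hand only as a commutative monoid. Quotients are
  therefore taken of monoids, and an inverse is always carried along as an explicit ideal.
  Transitivity of H is a count: with D the decomposition group, the order of HD is divisible by f
  and by |H|, hence by |G|. That f divides |D| is read off a Frobenius element g, since g^|D| = 1
  forces p^f - 1 to divide p^|D| - 1. The second norm has to come because a generator x of I^|H|
  over L may lie outside K, whereas its norm over H is fixed by H.\<close>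

definition int_span :: "complex set \<Rightarrow> complex set" where
  "int_span V = {\<Sum>v\<in>V. of_int (c v) * v | c :: complex \<Rightarrow> int. True}"

text \<open>Finiteness matters here: over an infinite set the defining sum is 0 by
  convention.\<close>

lemma int_span_base:
  assumes "finite V" "v \<in> V" shows "v \<in> int_span V"
proof -
  have "v = (\<Sum>w\<in>V. of_int (if w = v then 1 else 0) * w)"
    using assms by (simp add: if_distrib[of "\<lambda>x. of_int x * _"] cong: if_cong)
  then show ?thesis unfolding int_span_def mem_Collect_eq by (intro exI conjI) auto
qed

lemma int_span_add:
  assumes "x \<in> int_span V" "y \<in> int_span V" shows "x + y \<in> int_span V"
proof -
  obtain c d where "x = (\<Sum>v\<in>V. of_int (c v) * v)" "y = (\<Sum>v\<in>V. of_int (d v) * v)"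
    using assms unfolding int_span_def by blast
  then have "x + y = (\<Sum>v\<in>V. of_int (c v + d v) * v)"
    by (simp add: sum.distrib algebra_simps)
  then show ?thesis unfolding int_span_def by (auto intro!: exI[of _ "\<lambda>v. c v + d v"])
qed

lemma int_span_scale:
  assumes "x \<in> int_span V" shows "of_int k * x \<in> int_span V"
proof -
  obtain c where "x = (\<Sum>v\<in>V. of_int (c v) * v)"
    using assms unfolding int_span_def by blast
  then have "of_int k * x = (\<Sum>v\<in>V. of_int (k * c v) * v)"
    by (simp add: sum_distrib_left algebra_simps)
  then show ?thesis unfolding int_span_def by (auto intro!: exI[of _ "\<lambda>v. k * c v"])
qed

lemma int_span_0: "0 \<in> int_span V"
  unfolding int_span_def by (auto intro!: exI[of _ "\<lambda>v. 0"])

lemma int_span_sum: "(\<And>i. i \<in> I \<Longrightarrow> f i \<in> int_span V) \<Longrightarrow> sum f I \<in> int_span V"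
  by (induction I rule: infinite_finite_induct) (auto intro: int_span_0 int_span_add)

lemma int_span_mult_closed:
  assumes "\<And>v. v \<in> V \<Longrightarrow> z * v \<in> int_span V" "x \<in> int_span V"
  shows "z * x \<in> int_span V"
proof -
  obtain c where "x = (\<Sum>v\<in>V. of_int (c v) * v)"
    using assms unfolding int_span_def by blast
  then have "z * x = (\<Sum>v\<in>V. of_int (c v) * (z * v))"
    by (simp add: sum_distrib_left algebra_simps)
  then show ?thesis using assms(1) by (auto intro!: int_span_sum int_span_scale)
qed

text \<open>Multiplication by \<open>z\<close> is given by an integer matrix on generators of the module, and \<open>z\<close> is
  an eigenvalue of that matrix.\<close>

lemma algebraic_int_if_stable_int_span:
  assumes "finite V" "w \<in> V" "w \<noteq> 0"
    and stable: "\<And>v. v \<in> V \<Longrightarrow> z * v \<in> int_span V"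
  shows "algebraic_int z"
proof -
  define n where "n = card V"
  obtain e where e: "bij_betw e {0..<n} V"
    using ex_bij_betw_nat_finite[OF assms(1)] n_def by blast
  have "\<forall>v\<in>V. \<exists>c :: complex \<Rightarrow> int. z * v = (\<Sum>u\<in>V. of_int (c u) * u)"
    using stable unfolding int_span_def by blast
  then obtain c :: "complex \<Rightarrow> complex \<Rightarrow> int"
    where c: "\<And>v. v \<in> V \<Longrightarrow> z * v = (\<Sum>u\<in>V. of_int (c v u) * u)" by metis
  define B where "B = mat n n (\<lambda>(i,j). c (e i) (e j))"
  define A where "A = map_mat (of_int :: int \<Rightarrow> complex) B"
  \<comment> \<open>The eigenvector is the list of the generators themselves; \<open>w\<close> makes
    it nonzero.\<close>
  define x where "x = vec n e"
  have B: "B \<in> carrier_mat n n" and A: "A \<in> carrier_mat n n"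
    by (auto simp: A_def B_def)
  obtain i where i: "i < n" "e i = w"
    using e assms(2) unfolding bij_betw_def by (metis atLeastLessThan_iff imageE)
  then have "x $ i \<noteq> 0\<^sub>v n $ i" using assms(3) by (simp add: x_def)
  then have "x \<noteq> 0\<^sub>v n" by metis
  moreover have "A *\<^sub>v x = z \<cdot>\<^sub>v x"
  proof (rule eq_vecI)
    fix i assume "i < dim_vec (z \<cdot>\<^sub>v x)"
    then have i: "i < n" by (simp add: x_def)
    then have ei: "e i \<in> V" using e by (auto simp: bij_betw_def)
    have "(A *\<^sub>v x) $ i = (\<Sum>j = 0..<n. of_int (c (e i) (e j)) * e j)"
      using i by (simp add: A_def B_def x_def scalar_prod_def)
    also have "\<dots> = (\<Sum>u\<in>V. of_int (c (e i) u) * u)"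
      using sum.reindex_bij_betw[OF e, of "\<lambda>u. of_int (c (e i) u) * u"] by simp
    finally show "(A *\<^sub>v x) $ i = (z \<cdot>\<^sub>v x) $ i" using c[OF ei] i by (simp add: x_def)
  qed (use A in \<open>auto simp: x_def\<close>)
  ultimately have "eigenvector A x z" using A by (auto simp: eigenvector_def x_def)
  then have "poly (char_poly A) z = 0"
    using eigenvalue_root_char_poly[OF A] by (auto simp: eigenvalue_def)
  moreover have "char_poly A = map_poly of_int (char_poly B)"
    unfolding A_def by (rule of_int_hom.char_poly_hom[OF B])
  moreover have "lead_coeff (char_poly B) = 1" using degree_monic_char_poly[OF B] by auto
  ultimately show ?thesis using algebraic_int_altdef_ipoly by metis
qed

text \<open>A monic integer equation is solved for its leading term. Being monic excludes degree 0,
  and \<open>a > 0\<close> puts 1 among the powers of x below a.\<close>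

lemma algebraic_int_power_reduce:
  assumes "algebraic_int (x :: complex)"
  obtains a and c :: "nat \<Rightarrow> int" where "x ^ a = (\<Sum>i<a. of_int (c i) * x ^ i)" "a > 0"
proof -
  obtain p :: "int poly" where p: "poly (map_poly of_int p) x = 0" "lead_coeff p = 1"
    using assms algebraic_int_altdef_ipoly by blast
  have deg: "degree p > 0"
  proof (rule ccontr)
    assume "\<not> degree p > 0"
    then obtain k where "p = [:k:]" by (metis degree_eq_zeroE gr_zeroI)
    with p show False by (simp add: map_poly_pCons)
  qed
  have "0 = (\<Sum>i\<le>degree p. of_int (coeff p i) * x ^ i)"
    using p(1) by (simp add: poly_altdef degree_map_poly coeff_map_poly)
  also have "\<dots> = x ^ degree p + (\<Sum>i<degree p. of_int (coeff p i) * x ^ i)"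
    using p(2) by (simp flip: lessThan_Suc_atMost)
  finally have "x ^ degree p = (\<Sum>i<degree p. of_int (- coeff p i) * x ^ i)"
    by (simp add: sum_negf algebra_simps eq_neg_iff_add_eq_0)
  then show ?thesis using that[of "degree p" "\<lambda>i. - coeff p i"] deg by simp
qed

text \<open>The monomials x^i y^j with i < a and j < b span a finitely generated module.
  Multiplication by x or y either stays among them or hits the exponent a or b, where the monic
  equation reduces it.\<close>

lemma
  assumes "algebraic_int (x :: complex)" "algebraic_int y"
  shows algebraic_int_plus: "algebraic_int (x + y)"
    and algebraic_int_times: "algebraic_int (x * y)"
proof -
  obtain a and c :: "nat \<Rightarrow> int" where a: "x ^ a = (\<Sum>i<a. of_int (c i) * x ^ i)" "a > 0"
    by (rule algebraic_int_power_reduce[OF assms(1)])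
  obtain b and d :: "nat \<Rightarrow> int" where b: "y ^ b = (\<Sum>i<b. of_int (d i) * y ^ i)" "b > 0"
    by (rule algebraic_int_power_reduce[OF assms(2)])
  define V where "V = (\<lambda>(i,j). x ^ i * y ^ j) ` ({..<a} \<times> {..<b})"
  have fin: "finite V" by (auto simp: V_def)
  have V: "x ^ i * y ^ j \<in> int_span V" if "i < a" "j < b" for i j
    using that fin by (intro int_span_base) (auto simp: V_def)
  have one: "1 \<in> V" unfolding V_def using a(2) b(2) by (auto intro!: image_eqI[of _ _ "(0,0)"])
  have x: "x * v \<in> int_span V" if "v \<in> V" for v
  proof -
    obtain i j where ij: "i < a" "j < b" "v = x ^ i * y ^ j" using \<open>v \<in> V\<close> by (auto simp: V_def)
    show ?thesis
    proof (cases "Suc i < a")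
      case True
      then show ?thesis using V[of "Suc i" j] ij by (simp add: mult_ac)
    next
      case False
      then have "Suc i = a" using ij by simp
      then have "x * v = x ^ a * y ^ j" using ij by (metis power_Suc mult.assoc)
      also have "\<dots> = (\<Sum>k<a. of_int (c k) * (x ^ k * y ^ j))"
        by (simp add: a(1) sum_distrib_left mult_ac)
      also have "\<dots> \<in> int_span V" using V ij by (auto intro!: int_span_sum int_span_scale)
      finally show ?thesis .
    qed
  qed
  have y: "y * v \<in> int_span V" if "v \<in> V" for v
  proof -
    obtain i j where ij: "i < a" "j < b" "v = x ^ i * y ^ j" using \<open>v \<in> V\<close> by (auto simp: V_def)
    show ?thesis
    proof (cases "Suc j < b")
      case True
      then show ?thesis using V[of i "Suc j"] ij by (simp add: mult_ac)
    next
      case False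
      then have "Suc j = b" using ij by simp
      then have "y * v = y ^ b * x ^ i" using ij by (metis power_Suc mult.assoc mult.commute)
      also have "\<dots> = (\<Sum>k<b. of_int (d k) * (x ^ i * y ^ k))"
        by (simp add: b(1) sum_distrib_left mult_ac)
      also have "\<dots> \<in> int_span V" using V ij by (auto intro!: int_span_sum int_span_scale)
      finally show ?thesis .
    qed
  qed
  show "algebraic_int (x + y)"
    by (rule algebraic_int_if_stable_int_span[OF fin one])
       (auto simp: distrib_right intro!: int_span_add x y)
  \<comment> \<open>The product y v is only an element of the span, not a generator, so stability
    under x is first extended to the whole span.\<close>
  show "algebraic_int (x * y)"
    using int_span_mult_closed[OF x] y
    by (intro algebraic_int_if_stable_int_span[OF fin one]) (auto simp: mult.assoc)
qed


section \<open>Fractional ideals and the class group\<close>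

text \<open>Made for fractional ideals modulo principal ones: the ambient structure is only a
  monoid, but each element of H has its inverse in H. This suffices for cosets to behave as in a
  group quotient.\<close>

locale comm_monoid_quotient = comm_monoid G for G (structure) +
  fixes H
  assumes H_carrier: "H \<subseteq> carrier G" and H_one: "\<one> \<in> H"
    and H_mult: "\<And>x y. x \<in> H \<Longrightarrow> y \<in> H \<Longrightarrow> x \<otimes> y \<in> H"
    and H_inverse: "\<And>x. x \<in> H \<Longrightarrow> \<exists>y\<in>H. x \<otimes> y = \<one>"
begin

lemma coset_eqI:
  assumes "a \<in> carrier G" "h \<in> H" shows "H #> (h \<otimes> a) = H #> a"
proof -
  obtain k where k: "k \<in> H" "h \<otimes> k = \<one>" using H_inverse assms(2) by blast
  have hk: "h \<in> carrier G" "k \<in> carrier G" using assms k H_carrier by auto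
  have "y \<otimes> a \<in> H #> (h \<otimes> a)" if "y \<in> H" for y
  proof -
    have y: "y \<in> carrier G" using that H_carrier by auto
    have "(y \<otimes> k) \<otimes> (h \<otimes> a) = y \<otimes> (h \<otimes> k) \<otimes> a"
      using y hk assms(1) by (simp add: m_ac)
    then have "(y \<otimes> k) \<otimes> (h \<otimes> a) = y \<otimes> a" using k y by simp
    then show ?thesis using H_mult[OF that k(1)] by (force simp: r_coset_def)
  qed
  moreover have "y \<otimes> (h \<otimes> a) \<in> H #> a" if "y \<in> H" for y
    using H_mult[OF that assms(2)] that H_carrier hk assms(1)
    by (auto simp: r_coset_def m_assoc[symmetric] subsetD)
  ultimately show ?thesis unfolding r_coset_def by blast
qed

lemma coset_self: "a \<in> carrier G \<Longrightarrow> a \<in> H #> a"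
  using H_one by (force simp: r_coset_def)

lemma coset_eq_iff:
  assumes "a \<in> carrier G" "b \<in> carrier G"
  shows "H #> a = H #> b \<longleftrightarrow> (\<exists>h\<in>H. a = h \<otimes> b)"
  using coset_self[OF assms(1)] coset_eqI[OF assms(2)] by (auto simp: r_coset_def)

lemma coset_mult:
  assumes "a \<in> carrier G" "b \<in> carrier G"
  shows "(H #> a) <#> (H #> b) = H #> (a \<otimes> b)"
proof
  show "(H #> a) <#> (H #> b) \<subseteq> H #> (a \<otimes> b)"
  proof
    fix z assume "z \<in> (H #> a) <#> (H #> b)"
    then obtain x y where xy: "x \<in> H" "y \<in> H" "z = (x \<otimes> a) \<otimes> (y \<otimes> b)"
      by (auto simp: r_coset_def set_mult_def)
    then have "z = (x \<otimes> y) \<otimes> (a \<otimes> b)"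
      using assms H_carrier by (simp add: m_ac subsetD)
    then show "z \<in> H #> (a \<otimes> b)" using H_mult[OF xy(1,2)] by (auto simp: r_coset_def)
  qed
  show "H #> (a \<otimes> b) \<subseteq> (H #> a) <#> (H #> b)"
  proof
    fix z assume "z \<in> H #> (a \<otimes> b)"
    then obtain x where x: "x \<in> H" "z = x \<otimes> (a \<otimes> b)" by (auto simp: r_coset_def)
    then have "z = (x \<otimes> a) \<otimes> b" using assms H_carrier by (simp add: m_assoc subsetD)
    moreover have "x \<otimes> a \<in> H #> a" using x(1) by (auto simp: r_coset_def)
    ultimately show "z \<in> (H #> a) <#> (H #> b)"
      using coset_self[OF assms(2)] by (auto simp: set_mult_def)
  qed
qed

lemma carrier_Mod: "carrier (G Mod H) = {H #> a | a. a \<in> carrier G}"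
  by (auto simp: FactGroup_def RCOSETS_def)

lemma one_Mod: "\<one>\<^bsub>G Mod H\<^esub> = H #> \<one>"
  using H_carrier by (force simp: FactGroup_def r_coset_def)

lemma mult_Mod:
  "a \<in> carrier G \<Longrightarrow> b \<in> carrier G \<Longrightarrow> (H #> a) \<otimes>\<^bsub>G Mod H\<^esub> (H #> b) = H #> (a \<otimes> b)"
  by (simp add: FactGroup_def coset_mult)

lemma comm_monoid_Mod: "comm_monoid (G Mod H)"
  by (rule comm_monoidI)
     (auto simp: carrier_Mod one_Mod mult_Mod m_ac simp del: mult_FactGroup one_FactGroup)

lemma pow_Mod: "a \<in> carrier G \<Longrightarrow> (H #> a) [^]\<^bsub>G Mod H\<^esub> (k::nat) = H #> (a [^] k)"
proof (induction k)
  interpret Q: comm_monoid "G Mod H" by (rule comm_monoid_Mod)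
  case 0
  show ?case using one_Mod by (simp del: one_FactGroup)
next
  interpret Q: comm_monoid "G Mod H" by (rule comm_monoid_Mod)
  case (Suc k)
  then show ?case by (simp add: mult_Mod del: mult_FactGroup)
qed

text \<open>T is the set of representatives with some good property. Besides products,
  \<open>generate\<close> adjoins \<open>inv\<close> of the generators; in a commutative monoid this
  is determined once an inverse exhibits itself, and \<open>T_inverse\<close> exhibits one with a
  representative in T.\<close>

lemma generate_Mod_representative:
  assumes T: "T \<subseteq> carrier G" "\<one> \<in> T" "Ps \<subseteq> T"
    and T_mult: "\<And>x y. x \<in> T \<Longrightarrow> y \<in> T \<Longrightarrow> x \<otimes> y \<in> T"
    and T_inverse: "\<And>x. x \<in> T \<Longrightarrow> \<exists>y\<in>T. x \<otimes> y = \<one>"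
    and c: "c \<in> generate (G Mod H) {H #> P | P. P \<in> Ps}"
  shows "\<exists>a\<in>T. c = H #> a"
  using c
proof (induction rule: generate.induct)
  case one
  then show ?case using T one_Mod by blast
next
  case (incl h)
  then show ?case using T by blast
next
  case (inv h)
  then obtain a where a: "a \<in> T" "h = H #> a" using T by blast
  then obtain b where b: "b \<in> T" "a \<otimes> b = \<one>" using T_inverse by blast
  have ab: "a \<in> carrier G" "b \<in> carrier G" using a b T by auto
  interpret Q: comm_monoid "G Mod H" by (rule comm_monoid_Mod)
  have "inv\<^bsub>G Mod H\<^esub> (H #> a) = H #> b"
    by (rule Q.comm_inv_char) (use ab b in \<open>auto simp: carrier_Mod mult_Mod one_Mod simp del: mult_FactGroup one_FactGroup\<close>)
  then show ?case using a b by blast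
next
  case (eng h1 h2)
  then obtain a b where ab: "a \<in> T" "h1 = H #> a" "b \<in> T" "h2 = H #> b" by blast
  then have "h1 \<otimes>\<^bsub>G Mod H\<^esub> h2 = H #> (a \<otimes> b)" using mult_Mod T by blast
  then show ?case using ab T_mult by blast
qed

end

text \<open>Bezout in the form u x = v y + 1 keeps all exponents natural, as suits a monoid. For u =
  0 the gcd condition says v = 1.\<close>

lemma (in comm_monoid) coprime_pow_eq_one:
  fixes u v :: nat
  assumes a: "a \<in> carrier G" and "a [^] u = \<one>" "a [^] v = \<one>" "gcd u v = 1"
  shows "a = \<one>"
proof (cases "u = 0")
  case True
  then show ?thesis using assms by simp
next
  case False
  then obtain x y where "u * x = v * y + gcd u v" using bezout_nat by blast
  then have xy: "u * x = v * y + 1" using assms by simp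
  have "\<one> = a [^] (u * x)" using assms by (simp add: nat_pow_pow[symmetric])
  also have "\<dots> = a [^] (v * y) \<otimes> a" unfolding xy using a by simp
  also have "\<dots> = a" using assms by (simp add: nat_pow_pow[symmetric])
  finally show ?thesis by simp
qed


section \<open>Products of sets of complex numbers\<close>

lemma complex_ring_simps [simp]:
  "carrier \<C> = UNIV" "x \<otimes>\<^bsub>\<C>\<^esub> y = x * y" "x \<oplus>\<^bsub>\<C>\<^esub> y = x + y" "\<one>\<^bsub>\<C>\<^esub> = 1" "\<zero>\<^bsub>\<C>\<^esub> = 0"
  by (simp_all add: ring_of_type_algebra_def)

interpretation CC: cring \<C>
  by (rule cring_from_type_algebra)

lemma complex_ring_a_inv [simp]: "\<ominus>\<^bsub>\<C>\<^esub> x = - x"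
  by (rule CC.minus_equality) auto

lemma complex_ring_m_inv [simp]: "x \<noteq> 0 \<Longrightarrow> inv\<^bsub>\<C>\<^esub> x = inverse x"
  by (rule CC.comm_inv_char) auto

lemma complex_ring_pow [simp]: "x [^]\<^bsub>\<C>\<^esub> (n::nat) = x ^ n"
  by (induction n) (auto simp: mult.commute)

abbreviation cprod :: "complex set \<Rightarrow> complex set \<Rightarrow> complex set" (infixl \<open>\<odot>\<close> 75)
  where "I \<odot> J \<equiv> ideal_prod \<C> I J"

lemma cprodI: "x \<in> I \<Longrightarrow> y \<in> J \<Longrightarrow> x * y \<in> I \<odot> J"
  using ideal_prod.prod[of x I y J \<C>] by simp

lemma cprod_add: "x \<in> I \<odot> J \<Longrightarrow> y \<in> I \<odot> J \<Longrightarrow> x + y \<in> I \<odot> J"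
  using ideal_prod.sum[of x \<C> I J y] by simp

lemma cprod_induct [consumes 1, case_names prod add]:
  assumes "x \<in> I \<odot> J" "\<And>i j. i \<in> I \<Longrightarrow> j \<in> J \<Longrightarrow> P (i * j)"
    "\<And>x y. x \<in> I \<odot> J \<Longrightarrow> y \<in> I \<odot> J \<Longrightarrow> P x \<Longrightarrow> P y \<Longrightarrow> P (x + y)"
  shows "P x"
  using assms(1) by (induction rule: ideal_prod.induct) (use assms(2,3) in auto)

lemma cprod_subsetI:
  assumes "\<And>i j. i \<in> I \<Longrightarrow> j \<in> J \<Longrightarrow> i * j \<in> A" "\<And>x y. x \<in> A \<Longrightarrow> y \<in> A \<Longrightarrow> x + y \<in> A"
  shows "I \<odot> J \<subseteq> A"
proof
  fix x assume "x \<in> I \<odot> J" then show "x \<in> A" by (induction rule: cprod_induct) (use assms in auto)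
qed

lemma cprod_commute: "I \<odot> J = J \<odot> I"
proof -
  have "I \<odot> J \<subseteq> J \<odot> I" for I J
    by (rule cprod_subsetI) (metis cprodI mult.commute, rule cprod_add)
  then show ?thesis by blast
qed

lemma cprod_assoc: "(I \<odot> J) \<odot> K = I \<odot> (J \<odot> K)"
proof -
  have *: "(I \<odot> J) \<odot> K \<subseteq> I \<odot> (J \<odot> K)" for I J K
  proof (rule cprod_subsetI)
    fix u k assume "u \<in> I \<odot> J" and k: "k \<in> K"
    then show "u * k \<in> I \<odot> (J \<odot> K)"
      by (induction rule: cprod_induct)
         (auto simp: mult.assoc distrib_right intro: cprodI cprod_add k)
  qed (rule cprod_add)
  \<comment> \<open>The reverse inclusion is the first one for K, J, I, read through
    commutativity.\<close>
  have "I \<odot> (J \<odot> K) = (K \<odot> J) \<odot> I" by (metis cprod_commute)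
  also have "\<dots> \<subseteq> K \<odot> (J \<odot> I)" by (rule *)
  also have "\<dots> = (I \<odot> J) \<odot> K" by (metis cprod_commute)
  finally show ?thesis using * by blast
qed

lemma cprod_mono: "I \<subseteq> I' \<Longrightarrow> J \<subseteq> J' \<Longrightarrow> I \<odot> J \<subseteq> I' \<odot> J'"
  by (rule cprod_subsetI) (auto intro: cprodI cprod_add)

text \<open>All conditions on h are relative to L because a Galois action \<open>s g\<close> is
  constrained only there.\<close>

lemma cprod_image:
  assumes "\<And>x y. x \<in> L \<Longrightarrow> y \<in> L \<Longrightarrow> h (x + y) = h x + h y"
    "\<And>x y. x \<in> L \<Longrightarrow> y \<in> L \<Longrightarrow> h (x * y) = h x * h y"
    "\<And>x y. x \<in> L \<Longrightarrow> y \<in> L \<Longrightarrow> x + y \<in> L" "\<And>x y. x \<in> L \<Longrightarrow> y \<in> L \<Longrightarrow> x * y \<in> L"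
    "I \<subseteq> L" "J \<subseteq> L"
  shows "h ` (I \<odot> J) = h ` I \<odot> h ` J"
proof
  have IJ: "I \<odot> J \<subseteq> L" 
    using assms(4)[OF subsetD[OF assms(5)] subsetD[OF assms(6)]] assms(3) by (rule cprod_subsetI)
  have "h x \<in> h ` I \<odot> h ` J" if "x \<in> I \<odot> J" for x
    using that
  proof (induction rule: cprod_induct)
    case (prod i j)
    then have "h (i * j) = h i * h j"
      using assms(2)[OF subsetD[OF assms(5)] subsetD[OF assms(6)]] by auto
    then show ?case using prod by (simp add: cprodI)
  next
    case (add x y)
    then have "h (x + y) = h x + h y" using assms(1)[OF subsetD[OF IJ] subsetD[OF IJ]] by simp
    then show ?case using add by (simp add: cprod_add)
  qed
  then show "h ` (I \<odot> J) \<subseteq> h ` I \<odot> h ` J" by blast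
  show "h ` I \<odot> h ` J \<subseteq> h ` (I \<odot> J)"
  proof (rule cprod_subsetI)
    fix a b assume "a \<in> h ` I" "b \<in> h ` J"
    then obtain i j where "i \<in> I" "j \<in> J" "a = h i" "b = h j" by blast
    moreover from this have "a * b = h (i * j)"
      using assms(2)[OF subsetD[OF assms(5)] subsetD[OF assms(6)]] by auto
    ultimately show "a * b \<in> h ` (I \<odot> J)" by (auto intro: cprodI)
  next
    fix a b assume "a \<in> h ` (I \<odot> J)" "b \<in> h ` (I \<odot> J)"
    then obtain x y where "x \<in> I \<odot> J" "y \<in> I \<odot> J" "a = h x" "b = h y" by blast
    moreover from this have "a + b = h (x + y)" using assms(1)[OF subsetD[OF IJ] subsetD[OF IJ]] by simp
    ultimately show "a + b \<in> h ` (I \<odot> J)" by (auto intro: cprod_add)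
  qed
qed


text \<open>Multiplying an integer equation of x of degree n by d^(n-1), where d is its leading
  coefficient, makes it monic in y = d x. The powers of y below n then span a module stable under
  y.\<close>

lemma algebraic_imp_int_multiple:
  assumes "algebraic (x :: complex)"
  obtains d :: int where "d \<noteq> 0" "algebraic_int (of_int d * x)"
proof -
  obtain p :: "int poly" where p: "p \<noteq> 0" "poly (map_poly of_int p) x = 0"
    using assms by (rule algebraicE')
  define d where "d = lead_coeff p"
  define n where "n = degree p"
  define y where "y = of_int d * x"
  have d: "d \<noteq> 0" using p by (simp add: d_def)
  have n: "n > 0"
  proof (rule ccontr)
    assume "\<not> n > 0"
    then obtain k where "p = [:k:]" unfolding n_def by (metis degree_eq_zeroE gr_zeroI)
    with p show False by (simp add: map_poly_pCons)
  qed
  have "0 = (\<Sum>i\<le>n. of_int (coeff p i) * x ^ i)"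
    using p(2) by (simp add: poly_altdef degree_map_poly coeff_map_poly n_def)
  also have "\<dots> = of_int d * x ^ n + (\<Sum>i<n. of_int (coeff p i) * x ^ i)"
    by (simp add: d_def n_def flip: lessThan_Suc_atMost)
  finally have dx: "of_int d * x ^ n = (\<Sum>i<n. of_int (- coeff p i) * x ^ i)"
    by (simp add: sum_negf algebra_simps eq_neg_iff_add_eq_0)
  have "y ^ n = of_int d ^ (n - 1) * (of_int d * x ^ n)"
    using n by (cases n) (simp_all add: y_def power_mult_distrib mult_ac)
  also have "\<dots> = (\<Sum>i<n. of_int (- coeff p i * d ^ (n - 1 - i)) * y ^ i)"
    unfolding dx sum_distrib_left
  proof (rule sum.cong)
    fix i assume "i \<in> {..<n}"
    then have "n - 1 = (n - 1 - i) + i" by auto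
    then have "(of_int d :: complex) ^ (n - 1) = of_int d ^ (n - 1 - i) * of_int d ^ i"
      by (metis power_add)
    then show "of_int d ^ (n - 1) * (of_int (- coeff p i) * x ^ i) =
        of_int (- coeff p i * d ^ (n - 1 - i)) * y ^ i"
      by (simp add: y_def power_mult_distrib mult_ac)
  qed simp
  finally have yn: "y ^ n = (\<Sum>i<n. of_int (- coeff p i * d ^ (n - 1 - i)) * y ^ i)" .
  define V where "V = (\<lambda>i. y ^ i) ` {..<n}"
  have fin: "finite V" and V: "\<And>i. i < n \<Longrightarrow> y ^ i \<in> int_span V"
    by (auto simp: V_def intro: int_span_base)
  have "1 \<in> V" using n by (auto simp: V_def intro!: image_eqI[of _ _ 0])
  moreover have "y * v \<in> int_span V" if "v \<in> V" for v
  proof -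
    obtain i where i: "i < n" "v = y ^ i" using \<open>v \<in> V\<close> by (auto simp: V_def)
    show ?thesis
    proof (cases "Suc i < n")
      case True
      then show ?thesis using V[of "Suc i"] i by simp
    next
      case False
      then have "Suc i = n" using i by simp
      then have "y * v = y ^ n" using i by (metis power_Suc)
      then show ?thesis unfolding yn by (auto intro!: int_span_sum int_span_scale V simp del: of_int_mult of_int_minus mult_minus_left)
    qed
  qed
  ultimately have "algebraic_int y"
    by (intro algebraic_int_if_stable_int_span[OF fin, of 1]) auto
  then show ?thesis using that d y_def by blast
qed

section \<open>Subfields of the complex numbers and common denominators\<close>

lemma subfield_Rats: "subfield \<rat> \<C>"
proof (rule field.subfieldI'[OF field_from_type_algebra])
  show "subring \<rat> \<C>" by (rule CC.subringI) auto
next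
  fix k :: complex assume "k \<in> \<rat> - {\<zero>\<^bsub>\<C>\<^esub>}"
  then show "inv\<^bsub>\<C>\<^esub> k \<in> \<rat>" by simp
qed

lemma subfield_closed:
  assumes "subfield F \<C>"
  shows "0 \<in> F" "1 \<in> F" "x \<in> F \<Longrightarrow> y \<in> F \<Longrightarrow> x + y \<in> F" "x \<in> F \<Longrightarrow> y \<in> F \<Longrightarrow> x * y \<in> F"
    "x \<in> F \<Longrightarrow> - x \<in> F" "x \<in> F \<Longrightarrow> y \<in> F \<Longrightarrow> x - y \<in> F" "x \<in> F \<Longrightarrow> inverse x \<in> F"
    "x \<in> F \<Longrightarrow> x ^ k \<in> F"
proof -
  note F = subringE[OF subfieldE(1)[OF assms]]
  show 0: "0 \<in> F" and 1: "1 \<in> F" using F by auto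
  show add: "x + y \<in> F" if "x \<in> F" "y \<in> F" for x y using F(7)[OF that] by simp
  show mult: "x * y \<in> F" if "x \<in> F" "y \<in> F" for x y using F(6)[OF that] by simp
  show minus: "- x \<in> F" if "x \<in> F" for x using F(5)[OF that] by simp
  show "x - y \<in> F" if "x \<in> F" "y \<in> F" for x y using add[OF that(1) minus[OF that(2)]] by simp
  show "inverse x \<in> F" if "x \<in> F" for x
    using CC.subfield_m_inv(1)[OF assms, of x] 0 that by (cases "x = 0") auto
  show "x ^ k \<in> F" if "x \<in> F" for x by (induction k) (use 1 mult[OF that] in auto)
qed

lemma subfield_sum: "subfield F \<C> \<Longrightarrow> (\<And>i. i \<in> A \<Longrightarrow> f i \<in> F) \<Longrightarrow> sum f A \<in> F"
  by (induction A rule: infinite_finite_induct) (auto simp: subfield_closed)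

lemma subfield_Rats_subset: assumes "subfield F \<C>" shows "\<rat> \<subseteq> F"
proof
  fix x :: complex assume "x \<in> \<rat>"
  then obtain a b :: int where x: "x = of_int a * inverse (of_int b)"
    by (auto elim!: Rats_cases' simp: divide_inverse)
  have nat: "of_nat i \<in> F" for i by (induction i) (auto simp: subfield_closed[OF assms])
  have int: "of_int i \<in> F" for i
    by (cases i rule: int_cases2) (auto simp: nat subfield_closed[OF assms])
  show "x \<in> F" unfolding x using int assms by (simp add: subfield_closed)
qed

lemma prime_bezout_int:
  fixes p :: nat and k :: int
  assumes "Factorial_Ring.prime p" "\<not> int p dvd k"
  obtains u v where "u * k + v * int p = 1"
proof -
  have "coprime k (int p)"
    using assms prime_imp_coprime[of "int p" k] by (simp add: coprime_commute)
  then show ?thesis using that by (metis bezout_int coprime_imp_gcd_eq_1)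
qed

lemma combine_eq_sum:
  "length Ks = length Us \<Longrightarrow> CC.combine Ks Us = (\<Sum>i<length Us. Ks ! i * Us ! i)"
proof (induction Us arbitrary: Ks)
  case (Cons u Us)
  then obtain k Ks' where K: "Ks = k # Ks'" "length Ks' = length Us" by (cases Ks) auto
  then show ?case using Cons.IH[of Ks'] by (simp add: sum.lessThan_Suc_shift del: sum.lessThan_Suc)
qed simp

lemma rational_common_denominator:
  assumes "finite A" "\<And>i. i \<in> A \<Longrightarrow> (k i :: complex) \<in> \<rat>"
  obtains d :: int and c :: "'a \<Rightarrow> int" where "d \<noteq> 0" "\<And>i. i \<in> A \<Longrightarrow> of_int d * k i = of_int (c i)"
proof -
  have "\<exists>d :: int. d \<noteq> 0 \<and> (\<forall>i\<in>A. of_int d * k i \<in> \<int>)"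
    using assms
  proof (induction A rule: finite_induct)
    case empty
    then show ?case by (auto intro: exI[of _ 1])
  next
    case (insert a A)
    then obtain d :: int where d: "d \<noteq> 0" "\<And>i. i \<in> A \<Longrightarrow> of_int d * k i \<in> \<int>" by auto
    obtain m b :: int where mb: "b > 0" "k a = of_int m / of_int b"
      using insert.prems[of a] by (auto elim: Rats_cases')
    have "of_int (d * b) * k i \<in> \<int>" if "i \<in> insert a A" for i
    proof (cases "i = a")
      case True
      then show ?thesis using mb by simp
    next
      case False
      then have "of_int b * (of_int d * k i) \<in> \<int>" using that d by auto
      then show ?thesis by (simp add: mult_ac)
    qed
    then show ?case using d(1) mb(1) by (intro exI[of _ "d * b"]) auto
  qed
  then obtain d :: int where d: "d \<noteq> 0" "\<forall>i\<in>A. of_int d * k i \<in> \<int>" by blast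
  then have "\<forall>i\<in>A. \<exists>c :: int. of_int d * k i = of_int c" by (auto simp: Ints_def)
  then show ?thesis using that[OF d(1)] by metis
qed

locale number_field =
  fixes L :: "complex set"
  assumes subfield: "subfield L \<C>" and finite_degree: "CC.finite_dimension \<rat> L"
begin

text \<open>N is the degree of L: the N + 1 elements with indices 0 to N are dependent over \<rat>,
  and a common denominator clears the coefficients. One N serves for all families.\<close>

lemma int_dependence:
  shows "\<exists>N. \<forall>x. (\<forall>i\<le>N. x i \<in> L) \<longrightarrow>
    (\<exists>c :: nat \<Rightarrow> int. (\<Sum>i\<le>N. of_int (c i) * x i) = 0 \<and> (\<exists>i\<le>N. c i \<noteq> 0))"
proof -
  obtain N where N: "CC.dimension N \<rat> L"
    using finite_degree by (auto simp: CC.finite_dimension_def)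
  show ?thesis
  proof (intro exI[of _ N] allI impI)
    fix x :: "nat \<Rightarrow> complex" assume x: "\<forall>i\<le>N. x i \<in> L"
    define xs where "xs = map x [0..<Suc N]"
    have "set xs \<subseteq> L" using x by (auto simp: xs_def simp del: upt_Suc)
    then have "CC.dependent \<rat> xs"
      using CC.independent_length_le_dimension[OF subfield_Rats N, of xs] by (auto simp: xs_def)
    then obtain Ks where Ks: "length Ks = length xs" "CC.combine Ks xs = 0" "set Ks \<subseteq> \<rat>" "set Ks \<noteq> {0}"
      using CC.dependent_imp_non_trivial_combine[OF subfield_Rats, of xs] by auto
    have len: "length xs = Suc N" by (simp add: xs_def)
    obtain d :: int and c :: "nat \<Rightarrow> int"
      where dc: "d \<noteq> 0" "\<And>i. i \<in> {..N} \<Longrightarrow> of_int d * Ks ! i = of_int (c i)"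
      by (rule rational_common_denominator[of "{..N}" "\<lambda>i. Ks ! i"])
         (use Ks(1) len in \<open>auto intro!: subsetD[OF Ks(3)]\<close>)
    have "0 = of_int d * (\<Sum>i\<le>N. Ks ! i * xs ! i)"
      using Ks(2) combine_eq_sum[OF Ks(1)] by (simp add: len lessThan_Suc_atMost)
    also have "\<dots> = (\<Sum>i\<le>N. of_int d * Ks ! i * xs ! i)"
      by (simp add: sum_distrib_left mult.assoc)
    also have "\<dots> = (\<Sum>i\<le>N. of_int (c i) * x i)"
    proof (rule sum.cong)
      fix i assume "i \<in> {..N}"
      then show "of_int d * Ks ! i * xs ! i = of_int (c i) * x i"
        using dc(2)[of i] by (simp add: xs_def nth_append)
    qed simp
    finally have rel: "(\<Sum>i\<le>N. of_int (c i) * x i) = 0" by simp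
    have "\<exists>k\<in>set Ks. k \<noteq> 0" using Ks(1,4) len by (cases Ks) auto
    then obtain i where "i \<le> N" "Ks ! i \<noteq> 0"
      using Ks(1) len by (auto simp: in_set_conv_nth less_Suc_eq_le)
    then have "c i \<noteq> 0" using dc(2)[of i] dc(1) by auto
    then show "\<exists>c :: nat \<Rightarrow> int. (\<Sum>i\<le>N. of_int (c i) * x i) = 0 \<and> (\<exists>i\<le>N. c i \<noteq> 0)"
      using rel \<open>i \<le> N\<close> by blast
  qed
qed

text \<open>Dividing a relation by the gcd of its coefficients makes one of them prime to \<open>p\<close>; \<open>j\<close> is the
  first such index.\<close>

lemma int_dependence_mod:
  assumes "Factorial_Ring.prime (p :: nat)"
  shows "\<exists>N. \<forall>x. (\<forall>i\<le>N. x i \<in> L) \<longrightarrow> (\<exists>(c :: nat \<Rightarrow> int) j. (\<Sum>i\<le>N. of_int (c i) * x i) = 0 \<and>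
    j \<le> N \<and> \<not> int p dvd c j \<and> (\<forall>i<j. int p dvd c i))"
proof -
  obtain N where N: "\<forall>x. (\<forall>i\<le>N. x i \<in> L) \<longrightarrow>
    (\<exists>c :: nat \<Rightarrow> int. (\<Sum>i\<le>N. of_int (c i) * x i) = 0 \<and> (\<exists>i\<le>N. c i \<noteq> 0))"
    using int_dependence by blast
  show ?thesis
  proof (intro exI[of _ N] allI impI)
    fix x :: "nat \<Rightarrow> complex" assume "\<forall>i\<le>N. x i \<in> L"
    then obtain c :: "nat \<Rightarrow> int" where c: "(\<Sum>i\<le>N. of_int (c i) * x i) = 0" "\<exists>i\<le>N. c i \<noteq> 0"
      using N by blast
    define m where "m = Gcd (c ` {..N})"
    define b where "b = (\<lambda>i. c i div m)"
    have m: "m \<noteq> 0" using c(2) by (auto simp: m_def Gcd_0_iff)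
    have dv: "m dvd c i" if "i \<le> N" for i using that by (auto simp: m_def)
    have "of_int m * (\<Sum>i\<le>N. of_int (b i) * x i) = (\<Sum>i\<le>N. of_int (m * (c i div m)) * x i)"
      by (simp add: b_def sum_distrib_left mult_ac)
    also have "\<dots> = 0" using c(1) dv by simp
    finally have rel: "(\<Sum>i\<le>N. of_int (b i) * x i) = 0" using m by simp
    \<comment> \<open>Otherwise p m would divide every \<open>c i\<close>, hence also their gcd
      m.\<close>
    have "\<exists>i\<le>N. \<not> int p dvd b i"
    proof (rule ccontr)
      assume "\<not> ?thesis"
      then have "int p * m dvd c i" if "i \<le> N" for i
        using that dv[OF that] m unfolding b_def by (metis dvd_div_iff_mult mult.commute)
      then have "int p * m dvd m" unfolding m_def by (intro Gcd_greatest) (auto simp: m_def[symmetric])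
      then show False using m assms by simp
    qed
    then obtain i where i: "i \<le> N" "\<not> int p dvd b i" by blast
    define j where "j = (LEAST i. \<not> int p dvd b i)"
    have "\<not> int p dvd b j" unfolding j_def by (rule LeastI[of "\<lambda>i. \<not> int p dvd b i", OF i(2)])
    moreover have "j \<le> i" unfolding j_def by (rule Least_le[of "\<lambda>i. \<not> int p dvd b i", OF i(2)])
    moreover have "int p dvd b l" if "l < j" for l
      using not_less_Least[OF that[unfolded j_def]] by blast
    ultimately show "\<exists>(c :: nat \<Rightarrow> int) j. (\<Sum>i\<le>N. of_int (c i) * x i) = 0 \<and>
        j \<le> N \<and> \<not> int p dvd c j \<and> (\<forall>i<j. int p dvd c i)"
      using rel i(1) by (intro exI[of _ b] exI[of _ j]) auto
  qed
qed

lemma zero_closed [simp, intro]: "0 \<in> L"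
  and one_closed [simp, intro]: "1 \<in> L"
  and uminus_closed [intro]: "x \<in> L \<Longrightarrow> - x \<in> L"
  and add_closed [intro]: "x \<in> L \<Longrightarrow> y \<in> L \<Longrightarrow> x + y \<in> L"
  and mult_closed [intro]: "x \<in> L \<Longrightarrow> y \<in> L \<Longrightarrow> x * y \<in> L"
  and inverse_closed [intro]: "x \<in> L \<Longrightarrow> inverse x \<in> L"
  and power_closed [intro]: "x \<in> L \<Longrightarrow> x ^ k \<in> L"
  by (simp_all add: subfield_closed[OF subfield])

lemma algebraic:
  assumes "x \<in> L" shows "algebraic x"
proof -
  obtain N where N: "\<forall>x. (\<forall>i\<le>N. x i \<in> L) \<longrightarrow>
    (\<exists>c :: nat \<Rightarrow> int. (\<Sum>i\<le>N. of_int (c i) * x i) = 0 \<and> (\<exists>i\<le>N. c i \<noteq> 0))"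
    using int_dependence by blast
  then obtain c :: "nat \<Rightarrow> int" where c: "(\<Sum>i\<le>N. of_int (c i) * x ^ i) = 0" "\<exists>i\<le>N. c i \<noteq> 0"
    using spec[OF N, of "\<lambda>i. x ^ i"] power_closed[OF assms] by blast
  define q :: "complex poly" where "q = (\<Sum>i\<le>N. monom (of_int (c i)) i)"
  have coeff: "coeff q i = (if i \<le> N then of_int (c i) else 0)" for i
    by (simp add: q_def coeff_sum if_distrib cong: if_cong)
  have "q \<noteq> 0" using c(2) coeff by (metis coeff_0 of_int_eq_0_iff)
  moreover have "poly q x = 0" using c(1) by (simp add: q_def poly_sum poly_monom)
  moreover have "\<forall>i. coeff q i \<in> \<int>" by (simp add: coeff)
  ultimately show ?thesis unfolding algebraic_def by blast
qed

lemma sum_closed [intro]: "(\<And>i. i \<in> I \<Longrightarrow> f i \<in> L) \<Longrightarrow> sum f I \<in> L"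
  by (induction I rule: infinite_finite_induct) auto

lemma prod_closed [intro]: "(\<And>i. i \<in> I \<Longrightarrow> f i \<in> L) \<Longrightarrow> prod f I \<in> L"
  by (induction I rule: infinite_finite_induct) auto

lemma of_nat_closed [simp]: "of_nat k \<in> L"
  by (induction k) auto

lemma of_int_closed [simp]: "of_int k \<in> L"
  by (cases k rule: int_cases2) auto

section \<open>Integers and fractional ideals of a number field\<close>

abbreviation OL :: "complex set" where "OL \<equiv> integers_set L"

lemma OL_subset: "OL \<subseteq> L"
  by (auto simp: integers_set_def)

lemma OL_L [intro]: "x \<in> OL \<Longrightarrow> x \<in> L"
  by (auto simp: integers_set_def)

lemma OL_0 [simp, intro]: "0 \<in> OL"
  and OL_1 [simp, intro]: "1 \<in> OL"
  and OL_of_int [simp, intro]: "of_int k \<in> OL"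
  and OL_of_nat [simp, intro]: "of_nat m \<in> OL"
  and OL_uminus [intro]: "x \<in> OL \<Longrightarrow> - x \<in> OL"
  and OL_add [intro]: "x \<in> OL \<Longrightarrow> y \<in> OL \<Longrightarrow> x + y \<in> OL"
  and OL_mult [intro]: "x \<in> OL \<Longrightarrow> y \<in> OL \<Longrightarrow> x * y \<in> OL"
  by (auto simp: integers_set_def intro: algebraic_int_plus algebraic_int_times)

lemma OL_diff [intro]: "x \<in> OL \<Longrightarrow> y \<in> OL \<Longrightarrow> x - y \<in> OL"
  using OL_add[of x "- y"] by auto

lemma OL_power [intro]: "x \<in> OL \<Longrightarrow> x ^ k \<in> OL"
  by (induction k) auto

lemma OL_sum [intro]: "(\<And>i. i \<in> I \<Longrightarrow> f i \<in> OL) \<Longrightarrow> sum f I \<in> OL"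
  by (induction I rule: infinite_finite_induct) auto

lemma OL_prod [intro]: "(\<And>i. i \<in> I \<Longrightarrow> f i \<in> OL) \<Longrightarrow> prod f I \<in> OL"
  by (induction I rule: infinite_finite_induct) auto

abbreviation FI :: "complex set monoid" where "FI \<equiv> fractional_ideal_group L"

definition principal :: "complex \<Rightarrow> complex set" where
  "principal x = (\<lambda>a. a * x) ` OL"

text \<open>Negatives come from multiplication by the integer -1, so being an additive subgroup
  reduces to containing 0 and sums.\<close>

lemma fractional_ideal_iff:
  "fractional_ideal L I \<longleftrightarrow>
     I \<subseteq> L \<and> 0 \<in> I \<and> (\<forall>x\<in>I. \<forall>y\<in>I. x + y \<in> I) \<and> (\<exists>x\<in>I. x \<noteq> 0) \<and> (\<forall>a\<in>OL. \<forall>x\<in>I. a * x \<in> I) \<and>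
     (\<exists>d\<in>OL. d \<noteq> 0 \<and> (\<forall>x\<in>I. d * x \<in> OL))" (is "_ \<longleftrightarrow> ?R")
proof
  assume fi: "fractional_ideal L I"
  then interpret additive_subgroup I \<C> by (simp add: fractional_ideal_def)
  have "0 \<in> I" "\<forall>x\<in>I. \<forall>y\<in>I. x + y \<in> I" using zero_closed a_closed by auto
  then show ?R using fi by (fastforce simp: fractional_ideal_def)
next
  assume R: ?R
  have "- x \<in> I" if "x \<in> I" for x
    using R that OL_uminus[OF OL_1] by (metis mult_minus1)
  then have "subgroup I (add_monoid \<C>)"
    using R by (intro CC.add.subgroupI) auto
  then show "fractional_ideal L I"
    using R by (auto simp: fractional_ideal_def additive_subgroup_def)
qed

lemma carrier_FI: "I \<in> carrier FI \<longleftrightarrow> fractional_ideal L I"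
  by (simp add: fractional_ideal_group_def)

lemma FI_simps [simp]: "I \<otimes>\<^bsub>FI\<^esub> J = I \<odot> J" "\<one>\<^bsub>FI\<^esub> = OL"
  by (simp_all add: fractional_ideal_group_def)

lemma FI_D:
  assumes "I \<in> carrier FI"
  shows "I \<subseteq> L" "0 \<in> I" "x \<in> I \<Longrightarrow> y \<in> I \<Longrightarrow> x + y \<in> I" "a \<in> OL \<Longrightarrow> x \<in> I \<Longrightarrow> a * x \<in> I"
  using assms by (auto simp: carrier_FI fractional_ideal_iff)

lemma FI_nonzero: "I \<in> carrier FI \<Longrightarrow> \<exists>x\<in>I. x \<noteq> 0"
  and FI_denominator: "I \<in> carrier FI \<Longrightarrow> \<exists>d\<in>OL. d \<noteq> 0 \<and> (\<forall>x\<in>I. d * x \<in> OL)"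
  by (simp_all add: carrier_FI fractional_ideal_iff)

lemma FI_I:
  assumes "I \<subseteq> L" "0 \<in> I" "\<And>x y. x \<in> I \<Longrightarrow> y \<in> I \<Longrightarrow> x + y \<in> I" "x \<in> I" "x \<noteq> 0"
    "\<And>a x. a \<in> OL \<Longrightarrow> x \<in> I \<Longrightarrow> a * x \<in> I" "d \<in> OL" "d \<noteq> 0" "\<And>x. x \<in> I \<Longrightarrow> d * x \<in> OL"
  shows "I \<in> carrier FI"
proof -
  have "\<exists>x\<in>I. x \<noteq> 0" using assms(4,5) by auto
  moreover have "\<exists>d\<in>OL. d \<noteq> 0 \<and> (\<forall>x\<in>I. d * x \<in> OL)" using assms(7-9) by auto
  ultimately show ?thesis
    unfolding carrier_FI fractional_ideal_iff by (simp add: assms(1-3,6))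
qed

lemma FI_diff: "I \<in> carrier FI \<Longrightarrow> x \<in> I \<Longrightarrow> y \<in> I \<Longrightarrow> x - y \<in> I"
  using FI_D(3)[of I x "-1 * y"] FI_D(4)[of I "-1" y] OL_uminus[OF OL_1] by simp

lemma FI_sum: "I \<in> carrier FI \<Longrightarrow> (\<And>i. i \<in> A \<Longrightarrow> f i \<in> I) \<Longrightarrow> sum f A \<in> I"
  by (induction A rule: infinite_finite_induct) (auto simp: FI_D)

lemma OL_FI [simp, intro]: "OL \<in> carrier FI"
  unfolding carrier_FI fractional_ideal_iff by (auto intro!: bexI[of _ 1])

lemma cprod_FI [intro]:
  assumes "I \<in> carrier FI" "J \<in> carrier FI" shows "I \<odot> J \<in> carrier FI"
proof -
  note I = FI_D[OF assms(1)] and J = FI_D[OF assms(2)]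
  obtain i j where "i \<in> I" "i \<noteq> 0" "j \<in> J" "j \<noteq> 0"
    using assms FI_nonzero by metis
  then have nz: "i * j \<in> I \<odot> J" "i * j \<noteq> 0" by (auto intro: cprodI)
  have sub: "I \<odot> J \<subseteq> L" using I(1) J(1) by (intro cprod_subsetI mult_closed add_closed) auto
  have z: "0 \<in> I \<odot> J" using cprodI[OF I(2) J(2)] by simp
  have smult: "a * x \<in> I \<odot> J" if "a \<in> OL" "x \<in> I \<odot> J" for a x
    using that(2)
  proof (induction rule: cprod_induct)
    case (prod i j)
    then show ?case using cprodI[of "a * i" I j J] I(4) that(1) by (simp add: mult.assoc)
  qed (auto simp: distrib_left intro: cprod_add)
  obtain d e where de: "d \<in> OL" "d \<noteq> 0" "\<And>x. x \<in> I \<Longrightarrow> d * x \<in> OL"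
      "e \<in> OL" "e \<noteq> 0" "\<And>x. x \<in> J \<Longrightarrow> e * x \<in> OL"
    using FI_denominator[OF assms(1)] FI_denominator[OF assms(2)] by metis
  have "(d * e) * x \<in> OL" if "x \<in> I \<odot> J" for x
    using that
  proof (induction rule: cprod_induct)
    case (prod i j)
    then have "(d * i) * (e * j) \<in> OL" by (intro OL_mult de)
    then show ?case by (simp add: mult_ac)
  qed (auto simp: distrib_left)
  then show ?thesis
    using FI_I[OF sub z cprod_add nz smult OL_mult[OF de(1,4)]] de(2,5) by simp
qed

lemma OL_cprod [simp]:
  assumes "I \<in> carrier FI" shows "OL \<odot> I = I" "I \<odot> OL = I"
proof -
  have "OL \<odot> I \<subseteq> I" by (intro cprod_subsetI FI_D[OF assms])
  moreover have "I \<subseteq> OL \<odot> I" using cprodI[OF OL_1, of _ I] by force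
  ultimately show "OL \<odot> I = I" by blast
  then show "I \<odot> OL = I" by (simp add: cprod_commute)
qed

lemma comm_monoid_FI: "comm_monoid FI"
  by (rule comm_monoidI) (simp_all add: cprod_assoc cprod_FI, rule cprod_commute)

sublocale FI: comm_monoid FI
  by (rule comm_monoid_FI)

lemma principal_self: "x \<in> principal x"
  unfolding principal_def by (auto intro!: image_eqI[of _ _ 1])

lemma principal_subset: "x \<in> L \<Longrightarrow> principal x \<subseteq> L"
  by (auto simp: principal_def)

text \<open>The condition with content is the common denominator: x is algebraic, so a nonzero
  rational integer times x is integral.\<close>

lemma principal_FI [intro]:
  assumes "x \<in> L" "x \<noteq> 0" shows "principal x \<in> carrier FI"
proof -
  obtain d :: int where d: "d \<noteq> 0" "algebraic_int (of_int d * x)"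
    using algebraic_imp_int_multiple[OF algebraic[OF assms(1)]] .
  then have dx: "of_int d * x \<in> OL" using assms by (auto simp: integers_set_def)
  have *: "of_int d * (a * x) \<in> OL" if "a \<in> OL" for a
    using OL_mult[OF that dx] by (simp add: mult_ac)
  have "a * x + b * x \<in> principal x" if "a \<in> OL" "b \<in> OL" for a b
    using that OL_add[OF that] by (auto simp: principal_def distrib_right[symmetric])
  moreover have "a * (b * x) \<in> principal x" if "a \<in> OL" "b \<in> OL" for a b
    using that OL_mult[OF that] by (auto simp: principal_def mult.assoc[symmetric])
  moreover have "0 \<in> principal x" by (auto simp: principal_def intro: image_eqI[of _ _ 0])
  ultimately show ?thesis
    using * assms d principal_self[of x] principal_subset[OF assms(1)]
    by (intro FI_I[of _ x "of_int d"]) (auto simp: principal_def)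
qed

lemma principal_1 [simp]: "principal 1 = OL"
  by (auto simp: principal_def)

lemma principal_cprod:
  assumes "I \<in> carrier FI" shows "principal x \<odot> I = (\<lambda>a. a * x) ` I"
proof
  show "principal x \<odot> I \<subseteq> (\<lambda>a. a * x) ` I"
  proof (rule cprod_subsetI)
    fix u i assume "u \<in> principal x" "i \<in> I"
    then obtain a where "a \<in> OL" "u = a * x" by (auto simp: principal_def)
    then show "u * i \<in> (\<lambda>a. a * x) ` I"
      using FI_D(4)[OF assms _ \<open>i \<in> I\<close>] by (auto simp: mult_ac intro!: image_eqI[of _ _ "a * i"])
  next
    fix u v assume "u \<in> (\<lambda>a. a * x) ` I" "v \<in> (\<lambda>a. a * x) ` I"
    then show "u + v \<in> (\<lambda>a. a * x) ` I"
      using FI_D(3)[OF assms] by (auto simp: distrib_right[symmetric])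
  qed
  show "(\<lambda>a. a * x) ` I \<subseteq> principal x \<odot> I"
    using cprodI[OF principal_self] by (auto simp: mult.commute)
qed

lemma principal_mult: "x \<in> L \<Longrightarrow> x \<noteq> 0 \<Longrightarrow> y \<in> L \<Longrightarrow> y \<noteq> 0 \<Longrightarrow> principal x \<odot> principal y = principal (x * y)"
  using principal_cprod[OF principal_FI, of y x] by (auto simp: principal_def image_image mult_ac)

lemma principal_pow: "x \<in> L \<Longrightarrow> x \<noteq> 0 \<Longrightarrow> principal x [^]\<^bsub>FI\<^esub> (k::nat) = principal (x ^ k)"
  by (induction k) (simp_all add: principal_mult power_closed mult.commute)

lemma principal_fractional_ideals_eq:
  "principal_fractional_ideals L = {principal x | x. x \<in> L \<and> x \<noteq> 0}"
  by (simp add: principal_fractional_ideals_def principal_def)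

text \<open>The ideal generated by \<open>inverse x\<close> inverts the one generated by x, so the
  monoid quotient applies and its cosets are the ideal classes.\<close>

sublocale cl: comm_monoid_quotient FI "principal_fractional_ideals L"
proof (unfold_locales, goal_cases)
  case 1
  then show ?case by (auto simp: principal_fractional_ideals_eq)
next
  case 2
  then show ?case by (auto simp: principal_fractional_ideals_eq intro!: exI[of _ 1])
next
  case (3 x y)
  then show ?case by (auto simp: principal_fractional_ideals_eq principal_mult)
next
  case (4 u)
  then obtain x where x: "x \<in> L" "x \<noteq> 0" "u = principal x"
    by (auto simp: principal_fractional_ideals_eq)
  then have "principal x \<odot> principal (inverse x) = OL"
    by (subst principal_mult) auto
  then show ?case using x
    by (auto simp: principal_fractional_ideals_eq intro!: exI[of _ "inverse x"])
qed

lemma finprod_principal: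
  assumes "finite A" "\<And>i. i \<in> A \<Longrightarrow> f i \<in> L \<and> f i \<noteq> 0"
  shows "finprod FI (\<lambda>i. principal (f i)) A = principal (\<Prod>i\<in>A. f i)"
  using assms
proof (induction A rule: finite_induct)
  case (insert a A)
  then have "finprod FI (\<lambda>i. principal (f i)) (insert a A) =
      principal (f a) \<odot> finprod FI (\<lambda>i. principal (f i)) A"
    by (subst FI.finprod_insert) auto
  also have "\<dots> = principal (f a) \<odot> principal (\<Prod>i\<in>A. f i)" using insert by auto
  also have "\<dots> = principal (\<Prod>i\<in>insert a A. f i)"
    using insert by (subst principal_mult) (auto simp: prod_zero_iff)
  finally show ?case .
qed auto

end


section \<open>Residue fields of primes\<close>

lemma integers_set_Rats: "integers_set \<rat> = \<int>"
  by (auto simp: integers_set_def intro: rational_algebraic_int_is_int int_imp_algebraic_int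
      subsetD[OF Ints_subset_Rats])

lemma ring_of_integers_simps [simp]:
  "carrier (\<O> L) = integers_set L" "x \<otimes>\<^bsub>\<O> L\<^esub> y = x * y" "x \<oplus>\<^bsub>\<O> L\<^esub> y = x + y"
  "\<one>\<^bsub>\<O> L\<^esub> = 1" "\<zero>\<^bsub>\<O> L\<^esub> = 0"
  by (simp_all add: ring_of_integers_def)

declare (in number_field)
  OL_uminus [simp] OL_add [simp] OL_mult [simp] OL_diff [simp] OL_power [simp]

lemma (in number_field) cring_OL: "cring (\<O> L)"
proof -
  have "subring OL \<C>" by (rule CC.subringI) auto
  then have "subcring OL \<C>" by (rule CC.subcringI') 
  then show ?thesis unfolding ring_of_integers_def
    by (rule CC.subcring_iff[THEN iffD1, rotated]) simp
qed

text \<open>With denominator 1, nonzero ideals of the ring of integers are the fractional ideals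
  inside \<open>OL\<close>. Together with \<open>FI_ideal_OL\<close> this moves between the
  ring-theoretic notions and the monoid \<open>FI\<close>.\<close>

lemma (in number_field) ideal_OL_FI:
  assumes "ideal I (\<O> L)" "I \<noteq> {0}" shows "I \<in> carrier FI" "I \<subseteq> OL"
proof -
  interpret ideal I "\<O> L" by fact
  show sub: "I \<subseteq> OL" using a_subset by simp
  have z: "0 \<in> I" using additive_subgroup.zero_closed[OF ideal.axioms(1)[OF assms(1)]] by simp
  then obtain x where x: "x \<in> I" "x \<noteq> 0" using assms(2) by blast
  show "I \<in> carrier FI"
  proof (rule FI_I[of _ x 1])
    show "a + b \<in> I" if "a \<in> I" "b \<in> I" for a b using additive_subgroup.a_closed[OF ideal.axioms(1)[OF assms(1)] that] by simp
    show "a * b \<in> I" if "a \<in> OL" "b \<in> I" for a b using I_l_closed[OF that(2)] that by simp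
  qed (use sub z x in auto)
qed

lemma (in number_field) FI_ideal_OL:
  assumes "I \<in> carrier FI" "I \<subseteq> OL" shows "ideal I (\<O> L)"
proof -
  interpret R: cring "\<O> L" by (rule cring_OL)
  have neg: "\<ominus>\<^bsub>\<O> L\<^esub> a = - a" if "a \<in> OL" for a
    by (rule R.minus_equality) (use that in auto)
  show ?thesis
  proof (rule idealI)
    show "subgroup I (add_monoid (\<O> L))"
    proof (rule R.add.subgroupI)
      show "\<ominus>\<^bsub>\<O> L\<^esub> a \<in> I" if "a \<in> I" for a
        using FI_D(4)[OF assms(1) OL_uminus[OF OL_1] that] that assms(2) neg[of a] by auto
    qed (use FI_D[OF assms(1)] assms(2) in auto)
  next
    fix a x assume ax: "a \<in> I" "x \<in> carrier (\<O> L)"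
    then have "x * a \<in> I" using FI_D(4)[OF assms(1)] by simp
    then show "x \<otimes>\<^bsub>\<O> L\<^esub> a \<in> I" "a \<otimes>\<^bsub>\<O> L\<^esub> x \<in> I" by (simp_all add: mult.commute)
  qed (rule R.ring_axioms)
qed


text \<open>The last assumption says that P meets \<int> exactly in the multiples of p. It also
  makes P nonzero, since p itself lies in P.\<close>

locale prime_ideal_over = number_field +
  fixes P :: "complex set" and p :: nat
  assumes primeideal: "primeideal P (\<O> L)" and prime_p: "Factorial_Ring.prime p"
    and of_int_mem_P: "of_int k \<in> P \<longleftrightarrow> int p dvd k"
begin

lemma of_nat_mem_P: "of_nat k \<in> P \<longleftrightarrow> p dvd k"
  using of_int_mem_P[of "int k"] by simp

lemma P_FI [simp]: "P \<in> carrier FI" and P_subset: "P \<subseteq> OL"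
proof -
  have "of_nat p \<in> P" using of_nat_mem_P by simp
  moreover have "of_nat p \<noteq> (0::complex)" using prime_p by (simp add: prime_gt_0_nat)
  ultimately have "P \<noteq> {0}" by (metis singletonD)
  then show "P \<in> carrier FI" "P \<subseteq> OL"
    using ideal_OL_FI primeideal.axioms(1)[OF primeideal] by auto
qed

lemma one_not_mem_P: "1 \<notin> P"
  using of_nat_mem_P[of 1] prime_p by (metis not_prime_unit of_nat_1)

lemma P_prime: "x \<in> OL \<Longrightarrow> y \<in> OL \<Longrightarrow> x * y \<in> P \<Longrightarrow> x \<in> P \<or> y \<in> P"
  using primeideal.I_prime[OF primeideal, of x y] by simp

lemma P_power: "x \<in> OL \<Longrightarrow> x ^ k \<in> P \<Longrightarrow> x \<in> P"
  by (induction k) (use one_not_mem_P P_prime in auto)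

lemma P_mult: "x \<in> OL \<Longrightarrow> y \<in> P \<Longrightarrow> x * y \<in> P" "y \<in> P \<Longrightarrow> x \<in> OL \<Longrightarrow> y * x \<in> P"
  using FI_D(4)[OF P_FI, of x y] by (auto simp: mult.commute)

text \<open>A relation among the powers of \<open>x\<close> whose coefficients do not all vanish modulo \<open>p\<close> exhibits
  an inverse of \<open>x\<close> modulo \<open>P\<close>.\<close>

lemma inverse_mod_P:
  assumes x: "x \<in> OL" "x \<notin> P"
  obtains y where "y \<in> OL" "x * y - 1 \<in> P"
proof -
  obtain N where N: "\<forall>x. (\<forall>i\<le>N. x i \<in> L) \<longrightarrow> (\<exists>(c :: nat \<Rightarrow> int) j. (\<Sum>i\<le>N. of_int (c i) * x i) = 0 \<and>
    j \<le> N \<and> \<not> int p dvd c j \<and> (\<forall>i<j. int p dvd c i))"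
    using int_dependence_mod[OF prime_p] by blast
  obtain c :: "nat \<Rightarrow> int" and j where c: "(\<Sum>i\<le>N. of_int (c i) * x ^ i) = 0"
    and j: "\<not> int p dvd c j" "j \<le> N" "\<And>i. i < j \<Longrightarrow> int p dvd c i"
    using spec[OF N, of "\<lambda>i. x ^ i"] power_closed[OF OL_L[OF x(1)]] by blast
  \<comment> \<open>y collects the terms above j, divided by x^(j+1). The relation becomes x^j (c_j
    + x y) = - (terms below j), whose right side lies in P because p divides those coefficients;
    then x^j cancels.\<close>
  define y where "y = (\<Sum>i\<in>{Suc j..N}. of_int (c i) * x ^ (i - Suc j))"
  have y: "y \<in> OL" unfolding y_def using x by auto
  have split: "{..N} = {..<j} \<union> {j} \<union> {Suc j..N}" using j(2) by auto
  have "0 = (\<Sum>i<j. of_int (c i) * x ^ i) + of_int (c j) * x ^ j + (\<Sum>i\<in>{Suc j..N}. of_int (c i) * x ^ i)"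
    unfolding c[symmetric] split by (subst sum.union_disjoint, simp, simp, force)+ simp
  also have "(\<Sum>i\<in>{Suc j..N}. of_int (c i) * x ^ i) = x ^ j * (x * y)"
    unfolding y_def sum_distrib_left
  proof (rule sum.cong)
    fix i assume "i \<in> {Suc j..N}"
    then have "x ^ i = x ^ j * (x * x ^ (i - Suc j))"
      by (simp flip: power_Suc power_add)
    then show "of_int (c i) * x ^ i = x ^ j * (x * (of_int (c i) * x ^ (i - Suc j)))" by simp
  qed simp
  finally have "x ^ j * (of_int (c j) + x * y) = - 1 * (\<Sum>i<j. of_int (c i) * x ^ i)"
    by (simp add: algebra_simps eq_neg_iff_add_eq_0)
  moreover have "(\<Sum>i<j. of_int (c i) * x ^ i) \<in> P"
    using j(3) x by (intro FI_sum[OF P_FI] P_mult(2)) (auto simp: of_int_mem_P)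
  ultimately have "x ^ j * (of_int (c j) + x * y) \<in> P"
    using P_mult(1)[OF OL_uminus[OF OL_1]] by simp
  then have cj: "of_int (c j) + x * y \<in> P"
    using P_prime[of "x ^ j" "of_int (c j) + x * y"] P_power[OF x(1)] x y by blast
  \<comment> \<open>u inverts c_j modulo p, so x y = - c_j modulo P turns into the inverse - u y of
    x.\<close>
  obtain u v where uv: "u * c j + v * int p = 1" using prime_bezout_int[OF prime_p j(1)] .
  have "x * (- of_int u * y) - 1 = - of_int u * (of_int (c j) + x * y) - of_int (v * int p)"
    using arg_cong[OF uv, of "of_int :: int \<Rightarrow> complex"] by (simp add: algebra_simps)
  also have "\<dots> \<in> P"
    by (intro FI_diff[OF P_FI] P_mult(1)[OF _ cj]) (auto simp: of_int_mem_P simp del: of_int_mult)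
  finally have "x * (- of_int u * y) - 1 \<in> P" .
  moreover have "- of_int u * y \<in> OL" using y by auto
  ultimately show ?thesis using that by blast
qed


section \<open>The residue field of a prime\<close>

abbreviation residue_ring :: "complex set ring" where "residue_ring \<equiv> \<O> L Quot P"

definition residue :: "complex \<Rightarrow> complex set" where "residue x = P +>\<^bsub>\<O> L\<^esub> x"

lemma carrier_residue_ring: "carrier residue_ring = residue ` OL"
  by (auto simp: FactRing_def A_RCOSETS_def' residue_def)

lemma residue_eq_iff:
  assumes "x \<in> OL" "y \<in> OL" shows "residue x = residue y \<longleftrightarrow> x - y \<in> P"
proof -
  interpret primeideal P "\<O> L" by (rule primeideal)
  have mem: "z \<in> residue y \<longleftrightarrow> (\<exists>u\<in>P. z = u + y)" for z y
    by (auto simp: residue_def a_r_coset_def')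
  have "residue x = residue y \<longleftrightarrow> x \<in> residue y"
    using assms a_rcos_self[of x] a_repr_independence'[of x y] by (auto simp: residue_def)
  also have "\<dots> \<longleftrightarrow> x - y \<in> P" unfolding mem by (metis add_diff_cancel diff_add_cancel)
  finally show ?thesis .
qed

lemma
  assumes "x \<in> OL" "y \<in> OL"
  shows residue_mult: "residue x \<otimes>\<^bsub>residue_ring\<^esub> residue y = residue (x * y)"
    and residue_add: "residue x \<oplus>\<^bsub>residue_ring\<^esub> residue y = residue (x + y)"
proof -
  interpret primeideal P "\<O> L" by (rule primeideal)
  show "residue x \<otimes>\<^bsub>residue_ring\<^esub> residue y = residue (x * y)"
    and "residue x \<oplus>\<^bsub>residue_ring\<^esub> residue y = residue (x + y)"
    using ring_hom_mult[OF rcos_ring_hom, of x y] ring_hom_add[OF rcos_ring_hom, of x y] assms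
    by (simp_all add: residue_def)
qed

lemma residue_one: "\<one>\<^bsub>residue_ring\<^esub> = residue 1"
  by (simp add: FactRing_def residue_def)

lemma residue_zero: "\<zero>\<^bsub>residue_ring\<^esub> = residue 0"
proof -
  interpret primeideal P "\<O> L" by (rule primeideal)
  show ?thesis using a_coset_add_zero[OF a_subset] by (simp add: FactRing_def residue_def)
qed

lemma residue_eq_zero_iff: "x \<in> OL \<Longrightarrow> residue x = \<zero>\<^bsub>residue_ring\<^esub> \<longleftrightarrow> x \<in> P"
  unfolding residue_zero using residue_eq_iff[of x 0] by simp

lemma field_residue_ring: "field residue_ring"
proof -
  interpret primeideal P "\<O> L" by (rule primeideal)
  interpret Q: domain residue_ring by (rule quotient_is_domain)
  show ?thesis
  proof (rule Q.cring_fieldI2)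
    fix a assume a: "a \<in> carrier residue_ring" "a \<noteq> \<zero>\<^bsub>residue_ring\<^esub>"
    then obtain x where x: "x \<in> OL" "a = residue x" by (auto simp: carrier_residue_ring)
    then have "x \<notin> P" using a residue_eq_zero_iff by simp
    then obtain y where "y \<in> OL" "x * y - 1 \<in> P" using inverse_mod_P[OF x(1)] by blast
    then show "\<exists>b\<in>carrier residue_ring. a \<otimes>\<^bsub>residue_ring\<^esub> b = \<one>\<^bsub>residue_ring\<^esub>"
      using x by (auto simp: carrier_residue_ring residue_mult residue_one residue_eq_iff)
  qed simp
qed

sublocale k: field residue_ring
  by (rule field_residue_ring)

lemma residue_pow: "x \<in> OL \<Longrightarrow> residue x [^]\<^bsub>residue_ring\<^esub> (j::nat) = residue (x ^ j)"
proof (induction j)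
  case (Suc j)
  then show ?case by (simp add: residue_mult OL_power mult.commute)
qed (simp add: residue_one)

lemma residue_Ints: "residue ` \<int> = (\<lambda>i. residue (of_nat i)) ` {..<p}" (is "?A = ?B")
proof
  show "?A \<subseteq> ?B"
  proof
    fix a assume "a \<in> ?A"
    then obtain k :: int where k: "a = residue (of_int k)" by (auto simp: Ints_def)
    define i where "i = nat (k mod int p)"
    have i: "i < p" "int i = k mod int p"
      using prime_gt_0_nat[OF prime_p] by (auto simp: i_def nat_less_iff)
    have "int p dvd k - int i" unfolding i by (simp add: minus_mod_eq_mult_div)
    then have "of_int (k - int i) \<in> P" by (simp only: of_int_mem_P)
    then have "residue (of_int k) = residue (of_nat i)" by (subst residue_eq_iff) auto
    then show "a \<in> ?B" using k i by auto
  qed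
qed auto

lemma card_residue_Ints: "card (residue ` \<int>) = p"
proof -
  have "inj_on (\<lambda>i. residue (of_nat i)) {..<p}"
  proof (rule inj_onI)
    fix i j assume ij: "i \<in> {..<p}" "j \<in> {..<p}" "residue (of_nat i) = residue (of_nat j)"
    then have "of_int (int i - int j) \<in> P" by (simp add: residue_eq_iff)
    then have "int p dvd int i - int j" by (simp only: of_int_mem_P)
    moreover have "\<bar>int i - int j\<bar> < int p" using ij by auto
    ultimately have "int i - int j = 0" using dvd_imp_le_int by (metis abs_of_nat linorder_not_le)
    then show "i = j" by simp
  qed
  then show ?thesis unfolding residue_Ints by (simp add: card_image)
qed

text \<open>This prime field is the base field in \<open>residue_degree L \<rat> P\<close>, because
  the integers of \<rat> are \<int>. Inverses come from Bezout with p.\<close>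

lemma subfield_residue_Ints: "subfield (residue ` \<int>) residue_ring"
proof (rule k.subfieldI')
  have neg: "\<ominus>\<^bsub>residue_ring\<^esub> residue x = residue (- x)" if "x \<in> OL" for x
    by (rule k.minus_equality) (use that in \<open>auto simp: residue_add residue_zero carrier_residue_ring\<close>)
  have OLZ: "x \<in> \<int> \<Longrightarrow> x \<in> OL" for x by (auto simp: Ints_def)
  show "subring (residue ` \<int>) residue_ring"
    by (rule k.subringI) (auto simp: carrier_residue_ring residue_one neg residue_add residue_mult OLZ)
next
  have OLZ: "x \<in> \<int> \<Longrightarrow> x \<in> OL" for x by (auto simp: Ints_def)
  fix a assume a: "a \<in> residue ` \<int> - {\<zero>\<^bsub>residue_ring\<^esub>}"
  then obtain m :: int where m: "a = residue (of_int m)" by (auto simp: Ints_def)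
  then have "of_int m \<notin> P" using a residue_eq_zero_iff by auto
  then obtain u v where uv: "u * m + v * int p = 1"
    using prime_bezout_int[OF prime_p] of_int_mem_P by metis
  have "of_int m * of_int u - 1 = - (of_int (v * int p) :: complex)"
    using arg_cong[OF uv, of "of_int :: int \<Rightarrow> complex"] by (simp add: algebra_simps)
  also have "\<dots> = of_int (- (v * int p))" by simp
  also have "\<dots> \<in> P" unfolding of_int_mem_P by simp
  finally have "residue (of_int m) \<otimes>\<^bsub>residue_ring\<^esub> residue (of_int u) = \<one>\<^bsub>residue_ring\<^esub>"
    by (simp add: residue_mult residue_one residue_eq_iff OL_mult)
  then have "inv\<^bsub>residue_ring\<^esub> a = residue (of_int u)"
    unfolding m by (intro k.comm_inv_char) (auto simp: carrier_residue_ring)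
  then show "inv\<^bsub>residue_ring\<^esub> a \<in> residue ` \<int>" by simp
qed

lemma combine_residue:
  "length ks = length xs \<Longrightarrow> set ks \<subseteq> OL \<Longrightarrow> set xs \<subseteq> OL \<Longrightarrow>
    k.combine (map residue ks) (map residue xs) = residue (\<Sum>i<length xs. ks ! i * xs ! i)"
proof (induction xs arbitrary: ks)
  case (Cons x xs)
  then obtain c ks' where K: "ks = c # ks'" "length ks' = length xs" by (cases ks) auto
  have "(\<Sum>i<length xs. ks' ! i * xs ! i) \<in> OL"
    using Cons.prems K by (intro OL_sum OL_mult) auto
  then show ?case using Cons.IH[of ks'] Cons.prems K
    by (simp add: sum.lessThan_Suc_shift residue_mult residue_add OL_mult del: sum.lessThan_Suc)
qed (simp add: residue_zero)

text \<open>Lifts of N + 1 residue classes satisfy an integer relation with a coefficient prime to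
  p, which reduces to a nontrivial relation over the prime field. Hence independent lists have
  bounded length.\<close>

lemma finite_dimension_residue_ring:
  "k.finite_dimension (residue ` \<int>) (carrier residue_ring)"
proof -
  obtain N where N: "\<forall>x. (\<forall>i\<le>N. x i \<in> L) \<longrightarrow> (\<exists>(c :: nat \<Rightarrow> int) j. (\<Sum>i\<le>N. of_int (c i) * x i) = 0 \<and>
    j \<le> N \<and> \<not> int p dvd c j \<and> (\<forall>i<j. int p dvd c i))"
    using int_dependence_mod[OF prime_p] by blast
  define Q where "Q n \<longleftrightarrow> (\<exists>Us. k.independent (residue ` \<int>) Us \<and> length Us = n)" for n
  have not_Q: "\<not> Q (Suc N)"
  proof
    assume "Q (Suc N)"
    then obtain Us where Us: "k.independent (residue ` \<int>) Us" "length Us = Suc N"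
      by (auto simp: Q_def)
    have "set Us \<subseteq> residue ` OL" using k.independent_in_carrier[OF Us(1)] carrier_residue_ring by simp
    then have "Us \<in> map residue ` lists OL" unfolding lists_image[symmetric] by auto
    then obtain xs where xs: "set xs \<subseteq> OL" "Us = map residue xs" by auto
    then have len: "length xs = Suc N" using Us(2) by simp
    have "\<forall>i\<le>N. xs ! i \<in> L" using xs(1) len by (auto intro!: OL_L subsetD[OF xs(1)])
    then obtain c :: "nat \<Rightarrow> int" and j
      where c: "(\<Sum>i\<le>N. of_int (c i) * xs ! i) = 0" "j \<le> N" "\<not> int p dvd c j"
      using N by blast
    define ks where "ks = map (\<lambda>i. of_int (c i) :: complex) [0..<Suc N]"
    have ks: "length ks = length xs" "set ks \<subseteq> OL" by (auto simp: ks_def len simp del: upt_Suc)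
    have "(\<Sum>i<length xs. ks ! i * xs ! i) = (\<Sum>i\<le>N. of_int (c i) * xs ! i)"
      unfolding len lessThan_Suc_atMost
      by (rule sum.cong) (auto simp: ks_def nth_append simp del: upt_Suc)
    then have "k.combine (map residue ks) Us = \<zero>\<^bsub>residue_ring\<^esub>"
      using combine_residue[OF ks(1,2) xs(1)] c(1) xs(2) by (simp add: residue_zero)
    moreover have "set (map residue ks) \<subseteq> residue ` \<int>" by (auto simp: ks_def simp del: upt_Suc)
    ultimately have "set (take (length Us) (map residue ks)) \<subseteq> {\<zero>\<^bsub>residue_ring\<^esub>}"
      using k.independent_imp_trivial_combine[OF subfield_residue_Ints Us(1)] by blast
    then have "residue (of_int (c i)) = \<zero>\<^bsub>residue_ring\<^esub>" if "i \<le> N" for i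
      using that Us(2) by (simp add: ks_def image_subset_iff del: upt_Suc)
    then show False using c(2,3) residue_eq_zero_iff of_int_mem_P by auto
  qed
  have Q0: "Q 0" by (auto simp: Q_def)
  \<comment> \<open>It is enough that n occurs as a length and n + 1 does not: an independent list
    of length n then has no extension, so it spans.\<close>
  obtain n where n: "Q n" "\<not> Q (Suc n)"
    using Q0 not_Q by (metis dec_induct le0 zero_induct)
  then obtain Us where Us: "k.independent (residue ` \<int>) Us" "length Us = n" by (auto simp: Q_def)
  have "u \<in> k.Span (residue ` \<int>) Us" if "u \<in> carrier residue_ring" for u
  proof (rule ccontr)
    assume "u \<notin> k.Span (residue ` \<int>) Us"
    then have "k.independent (residue ` \<int>) (u # Us)" using that Us(1) by (intro k.li_Cons)
    then show False using n(2) Us(2) by (auto simp: Q_def)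
  qed
  then have "k.Span (residue ` \<int>) Us = carrier residue_ring"
    using k.Span_subgroup_props(1)[OF subfield_residue_Ints k.independent_in_carrier[OF Us(1)]] by blast
  then show ?thesis using k.dimension_independent[OF Us(1)] by (auto intro: k.finite_dimensionI)
qed

text \<open>Coordinates in a basis over the prime field: there are p choices for each of
  \<open>residue_degree L \<rat> P\<close> many coordinates.\<close>

lemma card_residue_ring:
  "finite (carrier residue_ring) \<and> card (carrier residue_ring) = p ^ residue_degree L \<rat> P"
proof -
  define F where "F = residue ` \<int>"
  have F: "subfield F residue_ring" unfolding F_def by (rule subfield_residue_Ints)
  have deg: "residue_degree L \<rat> P = k.dim F (carrier residue_ring)"
    by (simp add: residue_degree_def integers_set_Rats F_def residue_def)
  have "k.dimension (residue_degree L \<rat> P) F (carrier residue_ring)"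
    using k.finite_dimensionE[OF F] finite_dimension_residue_ring
    by (simp add: deg F_def over_def)
  then obtain Us where Us: "k.independent F Us" "length Us = residue_degree L \<rat> P"
      "k.Span F Us = carrier residue_ring"
    using k.exists_base[OF F] by blast
  have fin: "finite F" and card: "card F = p"
    unfolding F_def using card_residue_Ints residue_Ints by auto
  define A where "A = {Ks. set Ks \<subseteq> F \<and> length Ks = length Us}"
  have "(\<lambda>Ks. k.combine Ks Us) ` A = carrier residue_ring"
    unfolding Us(3)[symmetric] A_def
      k.Span_eq_combine_set_length_version[OF F k.independent_in_carrier[OF Us(1)]] by blast
  moreover have "inj_on (\<lambda>Ks. k.combine Ks Us) A"
  proof (rule inj_onI)
    fix Ks Ks' assume K: "Ks \<in> A" "Ks' \<in> A" "k.combine Ks Us = k.combine Ks' Us"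
    have "k.combine Ks Us \<in> k.Span F Us"
      using K k.Span_eq_combine_set_length_version[OF F k.independent_in_carrier[OF Us(1)]]
      by (auto simp: A_def)
    from k.unique_decomposition[OF F Us(1) this] K show "Ks = Ks'" by (auto simp: A_def)
  qed
  moreover have "finite A" "card A = p ^ residue_degree L \<rat> P"
    using finite_lists_length_eq[OF fin] card_lists_length_eq[OF fin] Us(2) card
    by (simp_all add: A_def)
  ultimately show ?thesis by (metis card_image finite_imageI)
qed

text \<open>The unit group of the finite residue field is cyclic of order p^f - 1, and a lifts a
  generator. This is how the residue degree becomes visible in congruences between powers of a
  single integer.\<close>

lemma residue_generator:
  obtains a where "a \<in> OL" "a \<notin> P"
    "\<And>j. a ^ j - 1 \<in> P \<longleftrightarrow> p ^ residue_degree L \<rat> P - 1 dvd j"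
proof -
  have fin: "finite (carrier residue_ring)" using card_residue_ring by simp
  define M where "M = Multiplicative_Group.mult_of residue_ring"
  interpret M: group M unfolding M_def by (rule k.field_mult_group)
  obtain g where g: "g \<in> carrier M"
      "carrier M = {g [^]\<^bsub>residue_ring\<^esub> i | i::nat. i \<in> UNIV}"
    using k.finite_field_mult_group_has_gen[OF fin] unfolding M_def by blast
  have finM: "finite (carrier M)" unfolding M_def using fin by (rule k.finite_mult_of)
  have pow: "g [^]\<^bsub>M\<^esub> (i::nat) = g [^]\<^bsub>residue_ring\<^esub> i" for i
    by (simp add: M_def Multiplicative_Group.nat_pow_mult_of)
  have "M.ord g = Coset.order M"
  proof -
    have "carrier M = generate M {g}"
      using M.generate_pow_on_finite_carrier[OF finM g(1)] g(2) by (simp add: pow)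
    then show ?thesis using M.generate_pow_card[OF g(1)] by (simp add: Coset.order_def)
  qed
  also have "\<dots> = p ^ residue_degree L \<rat> P - 1"
    using card_residue_ring fin by (simp add: Coset.order_def M_def)
  finally have ord: "M.ord g = p ^ residue_degree L \<rat> P - 1" .
  have one_M: "\<one>\<^bsub>M\<^esub> = \<one>\<^bsub>residue_ring\<^esub>" by (simp add: M_def)
  obtain a where a: "a \<in> OL" "g = residue a" "a \<notin> P"
    using g(1) residue_eq_zero_iff by (auto simp: M_def carrier_residue_ring)
  have "a ^ j - 1 \<in> P \<longleftrightarrow> p ^ residue_degree L \<rat> P - 1 dvd j" for j
  proof -
    have "a ^ j - 1 \<in> P \<longleftrightarrow> g [^]\<^bsub>M\<^esub> j = \<one>\<^bsub>M\<^esub>"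
      using pow[of j] a(1) unfolding one_M a(2) by (simp add: residue_pow residue_one residue_eq_iff)
    then show ?thesis using M.pow_eq_id[OF g(1)] ord by simp
  qed
  then show ?thesis using that a by blast
qed

end


section \<open>Galois action on ideals\<close>

lemma (in number_field) finprod_FI_memI:
  assumes "finite A" "\<And>i. i \<in> A \<Longrightarrow> I i \<in> carrier FI" "\<And>i. i \<in> A \<Longrightarrow> x i \<in> I i"
  shows "(\<Prod>i\<in>A. x i) \<in> finprod FI I A"
  using assms
proof (induction A rule: finite_induct)
  case (insert a A)
  then have "finprod FI I (insert a A) = I a \<odot> finprod FI I A"
    by (subst FI.finprod_insert) auto
  then show ?case using insert by (auto intro!: cprodI)
qed auto

text \<open>Factors are grouped by their value; F is a variable subset of the image so that the
  induction can add one value at a time. Used for the product of h P over h in H, where each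
  conjugate occurs equally often.\<close>

lemma (in comm_monoid) finprod_const_fibres:
  assumes "finite A" "F \<subseteq> \<phi> ` A" "\<phi> ` A \<subseteq> carrier G"
    and "\<And>c. c \<in> \<phi> ` A \<Longrightarrow> card {a \<in> A. \<phi> a = c} = k"
  shows "finprod G \<phi> {a \<in> A. \<phi> a \<in> F} = finprod G (\<lambda>c. c) F [^] k"
proof -
  have "finite F" using assms finite_surj by blast
  then show ?thesis using assms(2)
  proof (induction F rule: finite_induct)
    case (insert c F)
    have c: "c \<in> carrier G" and F: "F \<subseteq> carrier G" using insert assms by auto
    have split: "{a \<in> A. \<phi> a \<in> insert c F} = {a \<in> A. \<phi> a = c} \<union> {a \<in> A. \<phi> a \<in> F}" by auto
    have "finprod G \<phi> {a \<in> A. \<phi> a \<in> insert c F} =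
        finprod G \<phi> {a \<in> A. \<phi> a = c} \<otimes> finprod G \<phi> {a \<in> A. \<phi> a \<in> F}"
      unfolding split using assms insert by (intro finprod_Un_disjoint) auto
    also have "finprod G \<phi> {a \<in> A. \<phi> a = c} = finprod G (\<lambda>a. c) {a \<in> A. \<phi> a = c}"
      using c by (intro finprod_cong') auto
    also have "\<dots> = c [^] k" using assms(4) insert c by (simp add: finprod_const)
    also have "finprod G \<phi> {a \<in> A. \<phi> a \<in> F} = finprod G (\<lambda>c. c) F [^] k" using insert by simp
    also have "c [^] k \<otimes> finprod G (\<lambda>c. c) F [^] k = (c \<otimes> finprod G (\<lambda>c. c) F) [^] k"
      using c F by (subst nat_pow_distrib) (auto intro!: finprod_closed)
    also have "c \<otimes> finprod G (\<lambda>c. c) F = finprod G (\<lambda>c. c) (insert c F)"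
      using insert c F by (subst finprod_insert) auto
    finally show ?case .
  qed auto
qed

text \<open>Modulo p^f - 1, the number p^d - 1 agrees with p^(d-f) - 1, so d may be lowered by f
  until d < f, where size leaves only d = 0. For f = 0 the divisor is 0, which again forces d =
  0.\<close>

lemma power_minus_one_dvdD:
  fixes p f d :: nat
  assumes "p \<ge> 2" "p ^ f - 1 dvd p ^ d - 1" shows "f dvd d"
proof (cases "f = 0")
  case True
  then have "p ^ d \<le> 1" using assms by simp
  then have "d = 0" using assms(1) one_less_power[of p d] by (cases d) auto
  then show ?thesis by simp
next
  case False
  show ?thesis using assms(2)
  proof (induction d rule: less_induct)
    case (less d)
    show ?case
    proof (cases "d < f")
      case True
      then have "p ^ d < p ^ f" using assms(1) by (intro power_strict_increasing) auto
      moreover have "p ^ d \<ge> 1" using assms(1) by simp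
      ultimately have "p ^ d - 1 < p ^ f - 1" by linarith
      then have "p ^ d - 1 = 0" using less.prems dvd_imp_le by fastforce
      then have "d = 0" using assms(1) one_less_power[of p d] by (cases d) auto
      then show ?thesis by simp
    next
      case nlt: False
      have ge: "p ^ (d - f) \<ge> 1" "p ^ f \<ge> 1" using assms(1) by simp_all
      have "p ^ d = p ^ (d - f) * p ^ f" using nlt by (simp flip: power_add)
      then have "p ^ d - 1 = p ^ (d - f) * (p ^ f - 1) + (p ^ (d - f) - 1)"
        using ge by (simp add: algebra_simps)
      then have "p ^ f - 1 dvd p ^ (d - f) - 1"
        using less.prems by (metis dvd_add_right_iff dvd_triv_right)
      then have "f dvd d - f" using less.IH[of "d - f"] False nlt by auto
      then show ?thesis using nlt by (simp add: dvd_minus_self)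
    qed
  qed
qed


text \<open>The group is abstract and acts through \<open>s\<close>, so that it can later be a group
  of exponents modulo n; \<open>s\<close> is constrained on L only. The last assumption makes \<rat>
  the fixed field. Commutativity is used to make a product of subgroups a subgroup.\<close>

locale galois_extension = number_field L + G: comm_group G
  for L and G :: "('g, 'm) monoid_scheme" (structure) +
  fixes s :: "'g \<Rightarrow> complex \<Rightarrow> complex"
  assumes finite_G: "finite (carrier G)"
    and s_closed [simp, intro]: "g \<in> carrier G \<Longrightarrow> x \<in> L \<Longrightarrow> s g x \<in> L"
    and s_add: "g \<in> carrier G \<Longrightarrow> x \<in> L \<Longrightarrow> y \<in> L \<Longrightarrow> s g (x + y) = s g x + s g y"
    and s_mult: "g \<in> carrier G \<Longrightarrow> x \<in> L \<Longrightarrow> y \<in> L \<Longrightarrow> s g (x * y) = s g x * s g y"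
    and s_id: "x \<in> L \<Longrightarrow> s \<one> x = x"
    and s_comp: "g \<in> carrier G \<Longrightarrow> h \<in> carrier G \<Longrightarrow> x \<in> L \<Longrightarrow> s (g \<otimes> h) x = s g (s h x)"
    and s_fixed: "x \<in> L \<Longrightarrow> (\<And>g. g \<in> carrier G \<Longrightarrow> s g x = x) \<Longrightarrow> x \<in> \<rat>"
begin

section \<open>The Galois action on elements and ideals\<close>

lemma s_inv1: "g \<in> carrier G \<Longrightarrow> x \<in> L \<Longrightarrow> s (inv g) (s g x) = x"
  and s_inv2: "g \<in> carrier G \<Longrightarrow> x \<in> L \<Longrightarrow> s g (s (inv g) x) = x"
  using s_comp[of "inv g" g x] s_comp[of g "inv g" x] by (simp_all add: s_id)

lemma s_0 [simp]: "g \<in> carrier G \<Longrightarrow> s g 0 = 0"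
  using s_add[of g 0 0] by simp

lemma s_eq_0_iff: "g \<in> carrier G \<Longrightarrow> x \<in> L \<Longrightarrow> s g x = 0 \<longleftrightarrow> x = 0"
  using s_inv1[of g x] s_0[of "inv g"] by auto

lemma s_1 [simp]: "g \<in> carrier G \<Longrightarrow> s g 1 = 1"
  using s_mult[of g 1 1] s_eq_0_iff[of g 1] by auto

lemma s_uminus: "g \<in> carrier G \<Longrightarrow> x \<in> L \<Longrightarrow> s g (- x) = - s g x"
  using s_add[of g x "- x"] uminus_closed[of x] by (simp add: eq_neg_iff_add_eq_0 add.commute)

lemma s_diff: "g \<in> carrier G \<Longrightarrow> x \<in> L \<Longrightarrow> y \<in> L \<Longrightarrow> s g (x - y) = s g x - s g y"
  using s_add[of g x "- y"] uminus_closed[of y] by (simp add: s_uminus)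

lemma s_power: "g \<in> carrier G \<Longrightarrow> x \<in> L \<Longrightarrow> s g (x ^ k) = s g x ^ k"
  by (induction k) (simp_all add: s_mult power_closed)

lemma s_of_nat [simp]: "g \<in> carrier G \<Longrightarrow> s g (of_nat k) = of_nat k"
  by (induction k) (simp_all add: s_add)

lemma s_of_int [simp]: "g \<in> carrier G \<Longrightarrow> s g (of_int k) = of_int k"
  by (cases k rule: int_cases2) (simp_all add: s_uminus)

lemma s_sum:
  "g \<in> carrier G \<Longrightarrow> (\<And>i. i \<in> A \<Longrightarrow> f i \<in> L) \<Longrightarrow> s g (\<Sum>i\<in>A. f i) = (\<Sum>i\<in>A. s g (f i))"
  by (induction A rule: infinite_finite_induct) (simp_all add: s_add sum_closed)

lemma s_prod:
  "g \<in> carrier G \<Longrightarrow> (\<And>i. i \<in> A \<Longrightarrow> f i \<in> L) \<Longrightarrow> s g (\<Prod>i\<in>A. f i) = (\<Prod>i\<in>A. s g (f i))"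
  by (induction A rule: infinite_finite_induct) (simp_all add: s_mult prod_closed)

lemma s_OL [simp, intro]:
  assumes "g \<in> carrier G" "x \<in> OL" shows "s g x \<in> OL"
proof -
  have x: "x \<in> L" "algebraic_int x" using assms by (auto simp: integers_set_def)
  then obtain p :: "int poly" where p: "poly (map_poly of_int p) x = 0" "lead_coeff p = 1"
    using algebraic_int_altdef_ipoly by blast
  have "poly (map_poly of_int p) (s g x) = (\<Sum>i\<le>degree p. of_int (coeff p i) * s g x ^ i)"
    by (simp add: poly_altdef degree_map_poly coeff_map_poly)
  also have "\<dots> = (\<Sum>i\<le>degree p. s g (of_int (coeff p i) * x ^ i))"
    using assms x by (intro sum.cong) (simp_all add: s_mult s_power power_closed)
  also have "\<dots> = s g (\<Sum>i\<le>degree p. of_int (coeff p i) * x ^ i)"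
    using assms x by (intro s_sum[symmetric]) (auto intro: mult_closed power_closed)
  also have "(\<Sum>i\<le>degree p. of_int (coeff p i) * x ^ i) = poly (map_poly of_int p) x"
    by (simp add: poly_altdef degree_map_poly coeff_map_poly)
  finally have "poly (map_poly of_int p) (s g x) = 0" using p assms by simp
  then show ?thesis
    using assms x p(2) algebraic_int_altdef_ipoly by (auto simp: integers_set_def)
qed

lemma s_fixed_OL: "x \<in> OL \<Longrightarrow> (\<And>g. g \<in> carrier G \<Longrightarrow> s g x = x) \<Longrightarrow> x \<in> \<int>"
  using s_fixed[of x] rational_algebraic_int_is_int[of x] by (auto simp: integers_set_def)

lemma image_s_mem_iff:
  assumes "g \<in> carrier G" "I \<subseteq> L" "x \<in> L" shows "x \<in> s g ` I \<longleftrightarrow> s (inv g) x \<in> I"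
proof
  assume "x \<in> s g ` I"
  then show "s (inv g) x \<in> I" using assms s_inv1 by auto
next
  assume "s (inv g) x \<in> I"
  then show "x \<in> s g ` I" using s_inv2[OF assms(1,3)] by (metis imageI)
qed

lemma image_s_comp:
  "g \<in> carrier G \<Longrightarrow> h \<in> carrier G \<Longrightarrow> I \<subseteq> L \<Longrightarrow> s (g \<otimes> h) ` I = s g ` (s h ` I)"
  unfolding image_image by (intro image_cong) (auto simp: s_comp)

lemma image_s_id: "I \<subseteq> L \<Longrightarrow> s \<one> ` I = I"
  using s_id by (force simp: image_def subset_iff)

lemma image_s_OL: "g \<in> carrier G \<Longrightarrow> s g ` OL = OL"
  using image_s_mem_iff[of g OL] OL_subset s_OL[of g] s_OL[of "inv g"] by blast

lemma image_s_principal: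
  assumes "g \<in> carrier G" "x \<in> L" shows "s g ` principal x = principal (s g x)"
proof -
  have "s g ` principal x = (\<lambda>a. a * s g x) ` (s g ` OL)"
    unfolding principal_def image_image using assms OL_L by (intro image_cong) (auto simp: s_mult)
  then show ?thesis using image_s_OL[OF assms(1)] by (simp add: principal_def)
qed

lemma image_s_FI [simp, intro]:
  assumes "g \<in> carrier G" "I \<in> carrier FI" shows "s g ` I \<in> carrier FI"
proof -
  note I = FI_D[OF assms(2)]
  obtain x where x: "x \<in> I" "x \<noteq> 0" using FI_nonzero[OF assms(2)] by blast
  obtain d where d: "d \<in> OL" "d \<noteq> 0" "\<And>x. x \<in> I \<Longrightarrow> d * x \<in> OL"
    using FI_denominator[OF assms(2)] by blast
  show ?thesis
  proof (rule FI_I[of _ "s g x" "s g d"])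
    show "s g ` I \<subseteq> L" using I(1) assms(1) by auto
    show "0 \<in> s g ` I" using I(2) s_0[OF assms(1)] by (metis imageI)
    show "a + b \<in> s g ` I" if "a \<in> s g ` I" "b \<in> s g ` I" for a b
    proof -
      obtain a' b' where ab: "a' \<in> I" "a = s g a'" "b' \<in> I" "b = s g b'" using \<open>a \<in> _\<close> \<open>b \<in> _\<close> by blast
      then have "a + b = s g (a' + b')" using I(1) assms(1) by (simp add: s_add subsetD)
      then show ?thesis using I(3) ab by blast
    qed
    show "a * b \<in> s g ` I" if "a \<in> OL" "b \<in> s g ` I" for a b
    proof -
      obtain b' where b: "b' \<in> I" "b = s g b'" using \<open>b \<in> _\<close> by blast
      obtain a' where a: "a' \<in> OL" "a = s g a'" using \<open>a \<in> _\<close> image_s_OL[OF assms(1)] by blast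
      have "a * b = s g (a' * b')" using I(1) assms(1) a b by (simp add: s_mult subsetD OL_L)
      then show ?thesis using I(4) a b by blast
    qed
    show "s g x \<in> s g ` I" "s g x \<noteq> 0" using x I(1) assms(1) by (auto simp: s_eq_0_iff)
    show "s g d \<in> OL" "s g d \<noteq> 0" using d assms(1) by (auto simp: s_eq_0_iff OL_L)
    show "s g d * a \<in> OL" if "a \<in> s g ` I" for a
    proof -
      obtain a' where a: "a' \<in> I" "a = s g a'" using \<open>a \<in> _\<close> by blast
      then have "s g d * a = s g (d * a')" using I(1) assms(1) d by (simp add: s_mult subsetD OL_L)
      then show ?thesis using d(3)[OF a(1)] assms(1) by simp
    qed
  qed
qed

lemma image_s_cprod:
  "g \<in> carrier G \<Longrightarrow> I \<subseteq> L \<Longrightarrow> J \<subseteq> L \<Longrightarrow> s g ` (I \<odot> J) = s g ` I \<odot> s g ` J"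
  by (rule cprod_image[of L]) (auto simp: s_add s_mult)

section \<open>Norms of elements and ideals\<close>

definition norm_over :: "'g set \<Rightarrow> complex \<Rightarrow> complex" where
  "norm_over S x = (\<Prod>g\<in>S. s g x)"

lemma norm_over_closed: "S \<subseteq> carrier G \<Longrightarrow> x \<in> L \<Longrightarrow> norm_over S x \<in> L"
  and norm_over_OL: "S \<subseteq> carrier G \<Longrightarrow> x \<in> OL \<Longrightarrow> norm_over S x \<in> OL"
  unfolding norm_over_def by (intro prod_closed OL_prod; auto)+

lemma norm_over_nonzero: "S \<subseteq> carrier G \<Longrightarrow> x \<in> L \<Longrightarrow> x \<noteq> 0 \<Longrightarrow> norm_over S x \<noteq> 0"
  using finite_subset[OF _ finite_G] by (auto simp: norm_over_def s_eq_0_iff)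

lemma bij_betw_mult_left:
  assumes "subgroup S G" "h \<in> S" shows "bij_betw (\<lambda>g. h \<otimes> g) S S"
proof -
  interpret S: subgroup S G by fact
  show ?thesis
    by (rule bij_betw_byWitness[where f' = "\<lambda>g. inv h \<otimes> g"])
       (use assms(2) in \<open>auto simp: G.m_assoc[symmetric]\<close>)
qed

text \<open>Translation by h permutes the factors. With S the whole group the norm is therefore
  rational; with S = H it falls into K.\<close>

lemma s_norm_over:
  assumes "subgroup S G" "h \<in> S" "x \<in> L" shows "s h (norm_over S x) = norm_over S x"
proof -
  interpret S: subgroup S G by fact
  have "s h (norm_over S x) = (\<Prod>g\<in>S. s h (s g x))"
    unfolding norm_over_def using assms by (intro s_prod) auto
  also have "\<dots> = (\<Prod>g\<in>S. s (h \<otimes> g) x)"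
    using assms by (intro prod.cong) (auto simp: s_comp)
  also have "\<dots> = norm_over S x"
    unfolding norm_over_def by (rule prod.reindex_bij_betw[OF bij_betw_mult_left[OF assms(1,2)]])
  finally show ?thesis .
qed

lemma norm_over_Ints:
  assumes "x \<in> OL" obtains k :: int where "norm_over (carrier G) x = of_int k"
proof -
  have "norm_over (carrier G) x \<in> \<int>"
    using assms G.subgroup_self by (intro s_fixed_OL norm_over_OL s_norm_over) auto
  then show ?thesis using that by (auto simp: Ints_def)
qed

text \<open>The norm is kept as an ideal of L instead of being descended to the fixed field of
  S.\<close>

definition ideal_norm :: "'g set \<Rightarrow> complex set \<Rightarrow> complex set" where
  "ideal_norm S I = finprod FI (\<lambda>g. s g ` I) S"

lemma ideal_norm_FI [simp, intro]:
  "S \<subseteq> carrier G \<Longrightarrow> I \<in> carrier FI \<Longrightarrow> ideal_norm S I \<in> carrier FI"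
  unfolding ideal_norm_def by (rule FI.finprod_closed) auto

lemma ideal_norm_mult:
  assumes "S \<subseteq> carrier G" "I \<in> carrier FI" "J \<in> carrier FI"
  shows "ideal_norm S (I \<odot> J) = ideal_norm S I \<odot> ideal_norm S J"
proof -
  have "ideal_norm S (I \<odot> J) = finprod FI (\<lambda>g. s g ` I \<otimes>\<^bsub>FI\<^esub> s g ` J) S"
    unfolding ideal_norm_def FI_simps using assms FI_D(1)
    by (intro FI.finprod_cong') (auto simp: image_s_cprod subsetD)
  also have "\<dots> = ideal_norm S I \<odot> ideal_norm S J"
    unfolding ideal_norm_def using assms by (subst FI.finprod_multf) auto
  finally show ?thesis .
qed

lemma ideal_norm_principal:
  assumes "S \<subseteq> carrier G" "x \<in> L" "x \<noteq> 0"
  shows "ideal_norm S (principal x) = principal (norm_over S x)"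
proof -
  have fin: "finite S" using assms(1) finite_G finite_subset by blast
  have "ideal_norm S (principal x) = finprod FI (\<lambda>g. principal (s g x)) S"
    unfolding ideal_norm_def using assms
    by (intro FI.finprod_cong') (auto simp: image_s_principal s_eq_0_iff subsetD intro!: principal_FI)
  then show ?thesis
    unfolding norm_over_def using assms fin by (subst (asm) finprod_principal) (auto simp: s_eq_0_iff)
qed

lemma ideal_norm_fixed:
  assumes "S \<subseteq> carrier G" "I \<in> carrier FI" "\<And>g. g \<in> S \<Longrightarrow> s g ` I = I"
  shows "ideal_norm S I = I [^]\<^bsub>FI\<^esub> card S"
proof -
  have "ideal_norm S I = finprod FI (\<lambda>g. I) S"
    unfolding ideal_norm_def using assms by (intro FI.finprod_cong') auto
  then show ?thesis using FI.finprod_const[OF assms(2)] by simp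
qed

end

text \<open>The norm of a nonzero element of P is a nonzero integer in P, so P contains a least
  positive integer p. Division with remainder shows that p generates the integers in P, and
  primality of p is inherited from P.\<close>

lemma (in galois_extension) int_below_prime:
  assumes "primeideal P (\<O> L)" "P \<noteq> {0}"
  obtains p where "prime_ideal_over L P p"
proof -
  interpret primeideal P "\<O> L" by fact
  note P = ideal_OL_FI[OF primeideal.axioms(1)[OF assms(1)] assms(2)]
  note PD = FI_D[OF P(1)]
  have one: "1 \<notin> P" using I_notcarr one_imp_carrier by auto
  obtain x where x: "x \<in> P" "x \<noteq> 0" using FI_nonzero[OF P(1)] by blast
  then have xO: "x \<in> OL" using P(2) by blast
  obtain k :: int where k: "norm_over (carrier G) x = of_int k" using norm_over_Ints[OF xO] .
  \<comment> \<open>Splitting off the factor of the identity shows that the norm is an integral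
    multiple of x.\<close>
  have "norm_over (carrier G) x = s \<one> x * (\<Prod>g\<in>carrier G - {\<one>}. s g x)"
    unfolding norm_over_def using finite_G by (subst prod.remove[of _ \<one>]) auto
  also have "\<dots> = (\<Prod>g\<in>carrier G - {\<one>}. s g x) * x" using xO by (simp add: s_id OL_L)
  also have "\<dots> \<in> P" using xO x by (intro PD(4) OL_prod) auto
  finally have kP: "of_int k \<in> P" using k by simp
  have k0: "k \<noteq> 0" using norm_over_nonzero[of "carrier G" x] x xO k by auto
  define S where "S = {m :: nat. m > 0 \<and> of_nat m \<in> P}"
  have "of_int \<bar>k\<bar> \<in> P"
    using kP PD(4)[of "-1" "of_int k"] by (cases "k \<ge> 0") (auto simp: abs_if)
  then have "nat \<bar>k\<bar> \<in> S" using k0 by (simp add: S_def)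
  define p where "p = (LEAST m. m \<in> S)"
  have p: "p \<in> S" unfolding p_def using \<open>nat \<bar>k\<bar> \<in> S\<close> by (rule LeastI)
  have min: "p \<le> m" if "m \<in> S" for m unfolding p_def using that by (rule Least_le)
  have iff: "of_int m \<in> P \<longleftrightarrow> int p dvd m" for m :: int
  proof
    assume m: "of_int m \<in> P"
    have "of_int (m mod int p) = of_int m - of_int (m div int p) * (of_nat p :: complex)"
      by (metis minus_div_mult_eq_mod of_int_diff of_int_mult of_int_of_nat_eq)
    also have "\<dots> \<in> P" using m p by (intro FI_diff[OF P(1)] PD(4)) (auto simp: S_def)
    finally have *: "of_int (m mod int p) \<in> P" .
    define r where "r = nat (m mod int p)"
    have r: "m mod int p = int r" "r < p" using p by (auto simp: r_def S_def nat_less_iff)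
    then have "r = 0" using * min[of r] by (cases "r = 0") (auto simp: S_def)
    then have "m mod int p = 0" using r by simp
    then show "int p dvd m" by auto
  next
    assume "int p dvd m"
    then obtain j where "m = int p * j" by blast
    then have "of_int m = of_int j * (of_nat p :: complex)" by simp
    then show "of_int m \<in> P" using p PD(4)[of "of_int j"] by (simp add: S_def)
  qed
  have "Factorial_Ring.prime p"
  proof (rule prime_natI)
    show "p \<ge> 2"
    proof (rule ccontr)
      assume "\<not> p \<ge> 2"
      then have "p = 1" using p by (simp add: S_def)
      then show False using p one by (simp add: S_def)
    qed
  next
    fix a b assume "p dvd a * b"
    then have "int p dvd int a * int b" by (metis int_dvd_int_iff of_nat_mult)
    then have "of_int (int a * int b) \<in> P" unfolding iff .
    then have "of_nat a \<in> P \<or> of_nat b \<in> P" using I_prime[of "of_nat a" "of_nat b"] by simp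
    then show "p dvd a \<or> p dvd b" using iff[of "int a"] iff[of "int b"] by auto
  qed
  then have "prime_ideal_over L P p"
    by (unfold_locales) (use assms iff in auto)
  then show ?thesis by (rule that)
qed


section \<open>Conjugate primes and the Frobenius element\<close>

context prime_ideal_over
begin

lemma P_prod:
  assumes "finite A" "\<And>i. i \<in> A \<Longrightarrow> f i \<in> OL" "(\<Prod>i\<in>A. f i) \<in> P"
  shows "\<exists>i\<in>A. f i \<in> P"
  using assms
proof (induction A rule: finite_induct)
  case empty
  then show ?case using one_not_mem_P by simp
next
  case (insert a A)
  then have "f a \<in> P \<or> (\<Prod>i\<in>A. f i) \<in> P" using P_prime[of "f a" "\<Prod>i\<in>A. f i"] OL_prod[of A f] by simp
  then show ?case using insert by auto
qed

lemma power_cong_P: "x \<in> OL \<Longrightarrow> y \<in> OL \<Longrightarrow> x - y \<in> P \<Longrightarrow> x ^ k - y ^ k \<in> P"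
  using residue_pow[of x k] residue_pow[of y k] residue_eq_iff[of x y] residue_eq_iff[of "x ^ k" "y ^ k"]
  by simp

lemma freshman_P:
  assumes "x \<in> OL" "y \<in> OL" shows "(x + y) ^ p - (x ^ p + y ^ p) \<in> P"
proof -
  have p: "p > 0" using prime_p by (rule prime_gt_0_nat)
  have "(x + y) ^ p = (\<Sum>k\<le>p. of_nat (p choose k) * x ^ k * y ^ (p - k))"
    by (rule binomial_ring)
  also have "{..p} = insert 0 (insert p {1..<p})" using p by auto
  also have "(\<Sum>k\<in>\<dots>. of_nat (p choose k) * x ^ k * y ^ (p - k)) =
      y ^ p + (x ^ p + (\<Sum>k\<in>{1..<p}. of_nat (p choose k) * x ^ k * y ^ (p - k)))"
    using p by (subst sum.insert; simp)+
  finally have "(x + y) ^ p - (x ^ p + y ^ p) = (\<Sum>k\<in>{1..<p}. of_nat (p choose k) * x ^ k * y ^ (p - k))"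
    by simp
  also have "\<dots> \<in> P"
  proof (intro FI_sum[OF P_FI] P_mult(2))
    fix k assume "k \<in> {1..<p}"
    then show "of_nat (p choose k) \<in> P"
      unfolding of_nat_mem_P using prime_p by (intro dvd_choose_prime) auto
  qed (use assms in auto)
  finally show ?thesis .
qed

text \<open>Fermat's little theorem modulo P: induction over the naturals with
  \<open>freshman_P\<close>, after which any integer is replaced by a natural number in the same
  residue class.\<close>

lemma fermat_P:
  assumes "c \<in> \<int>" shows "c ^ p - c \<in> P"
proof -
  have nat: "of_nat i ^ p - of_nat i \<in> P" for i :: nat
  proof (induction i)
    case 0
    then show ?case using prime_gt_0_nat[OF prime_p] FI_D(2)[OF P_FI] by (simp add: zero_power)
  next
    case (Suc i)
    have "(of_nat (Suc i) ^ p - of_nat (Suc i) :: complex) =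
        ((of_nat i + 1) ^ p - (of_nat i ^ p + 1 ^ p)) + (of_nat i ^ p - of_nat i)"
      by (simp add: add.commute)
    also have "\<dots> \<in> P" by (intro FI_D(3)[OF P_FI] freshman_P Suc) auto
    finally show ?case .
  qed
  have c: "c \<in> OL" using assms by (auto simp: Ints_def)
  have "residue c \<in> residue ` \<int>" using assms by simp
  then obtain i where i: "residue c = residue (of_nat i)" unfolding residue_Ints by blast
  then have "residue (c ^ p) = residue (of_nat i ^ p)" using c residue_pow[of c p] residue_pow[of "of_nat i" p] by simp
  also have "\<dots> = residue c" using nat[of i] i by (simp add: residue_eq_iff)
  finally show ?thesis using c by (simp add: residue_eq_iff)
qed

lemma OL_Ints: "x \<in> \<int> \<Longrightarrow> x \<in> OL"
  by (auto simp: Ints_def)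

lemma poly_OL: "(\<And>i. coeff q i \<in> OL) \<Longrightarrow> x \<in> OL \<Longrightarrow> poly q x \<in> OL"
  unfolding poly_altdef by (intro OL_sum) auto

text \<open>Modulo P the p-th power map is additive and fixes integers, so it commutes with integer
  polynomials. Its use: the p-th power of a root is again a root modulo P.\<close>

lemma poly_frobenius_P:
  assumes "\<forall>i. coeff q i \<in> \<int>" "x \<in> OL"
  shows "poly q (x ^ p) - poly q x ^ p \<in> P"
  using assms(1)
proof (induction q)
  case 0
  then show ?case using prime_gt_0_nat[OF prime_p] FI_D(2)[OF P_FI] by (simp add: zero_power)
next
  case (pCons c q)
  have c: "c \<in> \<int>" and q: "\<forall>i. coeff q i \<in> \<int>"
    using pCons.prems by (metis coeff_pCons_0, metis coeff_pCons_Suc)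
  have OL: "c \<in> OL" "poly q x \<in> OL" "poly q (x ^ p) \<in> OL"
    using c q assms(2) by (simp_all add: poly_OL OL_Ints)
  \<comment> \<open>The three differences are covered by the induction hypothesis, by Fermat for c,
    and by additivity of the p-th power.\<close>
  have "poly (pCons c q) (x ^ p) - poly (pCons c q) x ^ p =
      x ^ p * (poly q (x ^ p) - poly q x ^ p) - (c ^ p - c)
      - ((c + x * poly q x) ^ p - (c ^ p + (x * poly q x) ^ p))"
    by (simp add: algebra_simps power_mult_distrib)
  also have "\<dots> \<in> P"
    using OL assms(2)
    by (intro FI_diff[OF P_FI FI_diff[OF P_FI P_mult(1)[OF _ pCons.IH[OF q]] fermat_P[OF c]] freshman_P]) auto
  finally show ?case .
qed

end


section \<open>Conjugates of a prime and its decomposition group\<close>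

locale galois_prime = galois_extension L G s + prime_ideal_over L P p
  for L and G :: "('g, 'm) monoid_scheme" (structure) and s P p
begin

abbreviation conjugates :: "complex set set" where
  "conjugates \<equiv> (\<lambda>g. s g ` P) ` carrier G"

lemma P_L: "P \<subseteq> L" using P_subset OL_subset by blast

lemma finite_conjugates: "finite conjugates" using finite_G by simp

lemma P_conjugate: "P \<in> conjugates"
  using image_s_id[OF P_L] by (metis G.one_closed image_eqI)

lemma conj_FI [simp]: "Q \<in> conjugates \<Longrightarrow> Q \<in> carrier FI"
  by auto

lemma conj_subset: "Q \<in> conjugates \<Longrightarrow> Q \<subseteq> OL"
  using P_subset by auto

lemma conj_mem_iff: "g \<in> carrier G \<Longrightarrow> x \<in> OL \<Longrightarrow> s g x \<in> P \<longleftrightarrow> x \<in> s (inv g) ` P"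
  using image_s_mem_iff[of "inv g" P x] P_L by (auto simp: OL_L)

lemma of_nat_p_conj: "Q \<in> conjugates \<Longrightarrow> of_nat p \<in> Q"
proof -
  assume "Q \<in> conjugates"
  then obtain g where g: "g \<in> carrier G" "Q = s g ` P" by blast
  have "of_nat p \<in> P" using of_nat_mem_P by simp
  then have "s g (of_nat p) \<in> s g ` P" by blast
  then show ?thesis using g by simp
qed

lemma conj_prime:
  assumes "Q \<in> conjugates" "x \<in> OL" "y \<in> OL" "x * y \<in> Q" shows "x \<in> Q \<or> y \<in> Q"
proof -
  obtain g where g: "g \<in> carrier G" "Q = s g ` P" using assms(1) by blast
  have "s (inv g) x * s (inv g) y \<in> P"
    using assms g image_s_mem_iff[OF g(1) P_L, of "x * y"] by (simp add: s_mult OL_L)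
  then have "s (inv g) x \<in> P \<or> s (inv g) y \<in> P" using assms g by (intro P_prime) auto
  then show ?thesis using assms g image_s_mem_iff[OF g(1) P_L] by (auto simp: OL_L)
qed

lemma conj_one: "Q \<in> conjugates \<Longrightarrow> 1 \<notin> Q"
  using image_s_mem_iff[OF _ P_L, of _ 1] one_not_mem_P by auto

lemma conj_power:
  assumes "Q \<in> conjugates" "x \<in> OL" "x ^ k \<in> Q" shows "x \<in> Q"
  using assms(3)
proof (induction k)
  case 0
  then show ?case using conj_one[OF assms(1)] by simp
next
  case (Suc k)
  then show ?case using conj_prime[OF assms(1,2), of "x ^ k"] assms(2) by auto
qed

lemma conj_prod:
  assumes "Q \<in> conjugates" "finite A" "\<And>i. i \<in> A \<Longrightarrow> f i \<in> OL" "(\<Prod>i\<in>A. f i) \<in> Q"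
  shows "\<exists>i\<in>A. f i \<in> Q"
  using assms(2-)
proof (induction A rule: finite_induct)
  case empty
  then show ?case using conj_one[OF assms(1)] by simp
next
  case (insert a A)
  then have "f a \<in> Q \<or> (\<Prod>i\<in>A. f i) \<in> Q"
    using conj_prime[OF assms(1), of "f a" "\<Prod>i\<in>A. f i"] OL_prod[of A f] by simp
  then show ?case using insert by auto
qed

text \<open>Iterating an inclusion \<open>s h ` I \<subseteq> I\<close> up to the order of \<open>h\<close> turns it into an equality.\<close>

lemma image_s_subset_imp_eq:
  assumes h: "h \<in> carrier G" and I: "I \<subseteq> L" "s h ` I \<subseteq> I" shows "s h ` I = I"
proof -
  have pow: "s (h [^] k) ` I \<subseteq> I" for k :: nat
  proof (induction k)
    case 0
    then show ?case using image_s_id[OF I(1)] by simp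
  next
    case (Suc k)
    have "s (h [^] Suc k) ` I = s (h [^] k) ` (s h ` I)"
      using h I(1) by (simp add: image_s_comp)
    then show ?case using Suc I(2) by blast
  qed
  have "Coset.order G > 0" using finite_G by (simp add: G.order_gt_0_iff_finite)
  then obtain m where m: "Coset.order G = Suc m" by (cases "Coset.order G") auto
  have "h \<otimes> h [^] m = \<one>" using G.pow_order_eq_1[OF h] h by (simp add: m G.m_comm)
  then have "I = s h ` (s (h [^] m) ` I)" using h I(1) image_s_id by (simp flip: image_s_comp)
  then have "I \<subseteq> s h ` I" using pow[of m] by blast
  then show ?thesis using I(2) by blast
qed

text \<open>Translating by \<open>inv h\<close> turns an inclusion of g P in h P into one of k P in
  P with k = \<open>inv h \<otimes> g\<close>, and there the finite order of k forces
  equality.\<close>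

lemma conj_subset_imp_eq:
  assumes "Q \<in> conjugates" "Q' \<in> conjugates" "Q \<subseteq> Q'" shows "Q = Q'"
proof -
  obtain g h where g: "g \<in> carrier G" "Q = s g ` P" and h: "h \<in> carrier G" "Q' = s h ` P"
    using assms by blast
  have "s (inv h \<otimes> g) ` P = s (inv h) ` Q" using g h P_L by (simp add: image_s_comp)
  also have "\<dots> \<subseteq> s (inv h) ` Q'" using assms(3) by blast
  also have "\<dots> = P" using h P_L image_s_id by (simp flip: image_s_comp)
  finally have "s (inv h \<otimes> g) ` P = P" using g h P_L by (intro image_s_subset_imp_eq) auto
  then have "s h ` (s (inv h \<otimes> g) ` P) = Q'" using h by simp
  moreover have "s h ` (s (inv h \<otimes> g) ` P) = s (h \<otimes> (inv h \<otimes> g)) ` P"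
    using g h P_L by (simp add: image_s_comp)
  moreover have "h \<otimes> (inv h \<otimes> g) = g" using g h by (simp add: G.m_assoc[symmetric])
  ultimately show ?thesis using g by simp
qed

text \<open>Distinct conjugates do not contain each other, so each Q' other than Q has an element
  outside Q. The product of these elements lies in every such Q' and, Q being prime, outside
  Q.\<close>

lemma conj_separate:
  assumes "Q \<in> conjugates"
  obtains v where "v \<in> OL" "v \<notin> Q" "\<And>Q'. Q' \<in> conjugates \<Longrightarrow> Q' \<noteq> Q \<Longrightarrow> v \<in> Q'"
proof -
  have ex: "\<exists>w. w \<in> Q' \<and> w \<notin> Q" if "Q' \<in> conjugates - {Q}" for Q'
  proof -
    have "\<not> Q' \<subseteq> Q" using conj_subset_imp_eq[OF _ assms, of Q'] that by (metis DiffE singletonI)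
    then show ?thesis by (meson subsetI)
  qed
  define w where "w Q' = (SOME w. w \<in> Q' \<and> w \<notin> Q)" for Q'
  have w: "w Q' \<in> Q' \<and> w Q' \<notin> Q" if "Q' \<in> conjugates - {Q}" for Q'
    unfolding w_def by (rule someI_ex[OF ex[OF that]])
  define v where "v = (\<Prod>Q'\<in>conjugates - {Q}. w Q')"
  have wO: "w Q' \<in> OL" if "Q' \<in> conjugates - {Q}" for Q' using w[OF that] that conj_subset[of Q'] by blast
  have fin: "finite (conjugates - {Q})" using finite_conjugates by simp
  have "v \<in> OL" unfolding v_def using wO by (rule OL_prod)
  moreover have "v \<notin> Q"
    using conj_prod[OF assms fin, of w, OF wO] w unfolding v_def by metis
  moreover have "v \<in> Q'" if "Q' \<in> conjugates" "Q' \<noteq> Q" for Q'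
  proof -
    have Q': "Q' \<in> conjugates - {Q}" using that by blast
    have "v = (\<Prod>R\<in>conjugates - {Q} - {Q'}. w R) * w Q'"
      unfolding v_def using prod.remove[OF fin Q', of w] by (simp add: mult.commute)
    also have "\<dots> \<in> Q'"
      using w[OF Q'] wO that by (intro FI_D(4)[OF conj_FI] OL_prod) auto
    finally show ?thesis .
  qed
  ultimately show ?thesis using that by blast
qed

definition decomposition_group :: "'g set" where
  "decomposition_group = {g \<in> carrier G. s g ` P = P}"

lemma subgroup_decomposition_group: "subgroup decomposition_group G"
proof (rule G.subgroupI)
  show "inv g \<in> decomposition_group" if "g \<in> decomposition_group" for g
  proof -
    have g: "g \<in> carrier G" "s g ` P = P" using that by (auto simp: decomposition_group_def)
    have "s (inv g) ` P = s (inv g) ` (s g ` P)" using g by simp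
    also have "\<dots> = P" using g(1) P_L image_s_id by (simp flip: image_s_comp)
    finally show ?thesis using g by (simp add: decomposition_group_def)
  qed
qed (use image_s_id[OF P_L] P_L in \<open>auto simp: decomposition_group_def image_s_comp\<close>)

lemma decomposition_group_mem_iff:
  assumes "g \<in> decomposition_group" "x \<in> OL" shows "s g x \<in> P \<longleftrightarrow> x \<in> P"
proof -
  have g: "g \<in> carrier G" "inv g \<in> decomposition_group"
    using assms subgroup.m_inv_closed[OF subgroup_decomposition_group]
    by (auto simp: decomposition_group_def)
  then show ?thesis using conj_mem_iff[OF g(1) assms(2)] by (simp add: decomposition_group_def)
qed

end

section \<open>Characteristic polynomials with respect to the Galois group\<close>

context galois_extension
begin

lemma map_poly_s_mult:
  assumes "g \<in> carrier G" "\<And>i. coeff q i \<in> L" "\<And>i. coeff r i \<in> L"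
  shows "map_poly (s g) (q * r) = map_poly (s g) q * map_poly (s g) r"
proof (rule poly_eqI)
  fix n
  have "coeff (map_poly (s g) (q * r)) n = s g (\<Sum>i\<le>n. coeff q i * coeff r (n - i))"
    using assms(1) by (simp add: coeff_map_poly coeff_mult)
  also have "\<dots> = (\<Sum>i\<le>n. s g (coeff q i) * s g (coeff r (n - i)))"
    using assms by (simp add: s_sum s_mult mult_closed)
  finally show "coeff (map_poly (s g) (q * r)) n = coeff (map_poly (s g) q * map_poly (s g) r) n"
    using assms(1) by (simp add: coeff_map_poly coeff_mult)
qed

lemma coeff_mult_OL:
  "(\<And>i. coeff q i \<in> OL) \<Longrightarrow> (\<And>i. coeff r i \<in> OL) \<Longrightarrow> coeff (q * r) n \<in> OL"
  unfolding coeff_mult by (intro OL_sum) auto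

lemma coeff_linear_OL: "x \<in> OL \<Longrightarrow> coeff [:- x, 1:] i \<in> OL"
  by (auto simp: coeff_pCons split: nat.splits)

lemma coeff_prod_OL:
  "(\<And>j i. j \<in> A \<Longrightarrow> coeff (q j) i \<in> OL) \<Longrightarrow> coeff (\<Prod>j\<in>A. q j) i \<in> OL"
proof (induction A arbitrary: i rule: infinite_finite_induct)
  case (insert a A)
  then show ?case by (simp add: coeff_mult_OL)
qed auto

lemma map_poly_s_prod:
  assumes "g \<in> carrier G" "\<And>j i. j \<in> A \<Longrightarrow> coeff (q j) i \<in> OL"
  shows "map_poly (s g) (\<Prod>j\<in>A. q j) = (\<Prod>j\<in>A. map_poly (s g) (q j))"
  using assms(2)
proof (induction A rule: infinite_finite_induct)
  case (insert a A)
  then show ?case using coeff_prod_OL[of A q]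
    by (simp add: map_poly_s_mult[OF assms(1)] OL_L)
qed (simp_all add: map_poly_1 assms(1))

definition char_polynomial :: "complex \<Rightarrow> complex poly" where
  "char_polynomial x = (\<Prod>g\<in>carrier G. [:- s g x, 1:])"

text \<open>Translation by h permutes the linear factors, so the coefficients are integral elements
  fixed by the whole group.\<close>

lemma coeff_char_polynomial_Ints:
  assumes "x \<in> OL" shows "coeff (char_polynomial x) i \<in> \<int>"
proof (rule s_fixed_OL)
  show "coeff (char_polynomial x) i \<in> OL"
    unfolding char_polynomial_def using assms by (intro coeff_prod_OL coeff_linear_OL) auto
next
  fix h assume h: "h \<in> carrier G"
  have "map_poly (s h) (char_polynomial x) = (\<Prod>g\<in>carrier G. map_poly (s h) [:- s g x, 1:])"
    unfolding char_polynomial_def using assms h by (intro map_poly_s_prod coeff_linear_OL) auto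
  also have "\<dots> = (\<Prod>g\<in>carrier G. [:- s (h \<otimes> g) x, 1:])"
    using assms h by (intro prod.cong) (auto simp: map_poly_pCons s_uminus s_comp OL_L)
  also have "\<dots> = char_polynomial x"
    unfolding char_polynomial_def
    by (rule prod.reindex_bij_betw[OF bij_betw_mult_left[OF G.subgroup_self h],
          of "\<lambda>g. [:- s g x, 1:]"])
  finally show "s h (coeff (char_polynomial x) i) = coeff (char_polynomial x) i"
    using h by (metis coeff_map_poly s_0)
qed

lemma poly_char_polynomial: "poly (char_polynomial x) y = (\<Prod>g\<in>carrier G. y - s g x)"
  by (simp add: char_polynomial_def poly_prod)

end

section \<open>The Frobenius element\<close>

context galois_prime
begin

text \<open>Choose \<open>a\<close> in all conjugates of \<open>P\<close> but \<open>P\<close> itself, and generating the multiplicative group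
  of the residue field. Since \<open>a ^ p\<close> is a root modulo \<open>P\<close> of the characteristic polynomial of
  \<open>a\<close>, it is congruent to some conjugate \<open>s g a\<close>, and \<open>g\<close> then is a Frobenius element of the
  decomposition group.\<close>

lemma residue_degree_dvd_card_decomposition_group:
  "residue_degree L \<rat> P dvd card decomposition_group"
proof -
  define f where "f = residue_degree L \<rat> P"
  interpret D: subgroup decomposition_group G by (rule subgroup_decomposition_group)
  obtain b where b: "b \<in> OL" "b \<notin> P" "\<And>j. b ^ j - 1 \<in> P \<longleftrightarrow> p ^ f - 1 dvd j"
    using residue_generator unfolding f_def by blast
  obtain v where v: "v \<in> OL" "v \<notin> P" "\<And>Q'. Q' \<in> conjugates \<Longrightarrow> Q' \<noteq> P \<Longrightarrow> v \<in> Q'"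
    using conj_separate[OF P_conjugate] by blast
  obtain y where y: "y \<in> OL" "v * y - 1 \<in> P" using inverse_mod_P[OF v(1,2)] .
  \<comment> \<open>Since v y = 1 modulo P, a agrees with the generator b modulo P; the factor v
    puts a into all other conjugates.\<close>
  define a where "a = b * y * v"
  have aO: "a \<in> OL" using b v y by (simp add: a_def)
  have "a - b = b * (v * y - 1)" by (simp add: a_def algebra_simps)
  also have "\<dots> \<in> P" using b y by (intro P_mult(1))
  finally have ab: "a - b \<in> P" .
  have a_pow: "a ^ j - 1 \<in> P \<longleftrightarrow> p ^ f - 1 dvd j" for j
  proof -
    have "a ^ j - b ^ j \<in> P" using power_cong_P[OF aO b(1) ab] .
    then have "residue (a ^ j) = residue (b ^ j)" using aO b by (simp add: residue_eq_iff)
    then show ?thesis using b aO residue_eq_iff[of "a ^ j" 1] residue_eq_iff[of "b ^ j" 1] by simp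
  qed
  have aP: "a \<notin> P"
    using FI_diff[OF P_FI _ ab, of a] b(2) by auto
  have a_conj: "a \<in> Q" if "Q \<in> conjugates" "Q \<noteq> P" for Q
    unfolding a_def using b y v(3)[OF that] by (intro FI_D(4)[OF conj_FI[OF that(1)]]) auto
  have "poly (char_polynomial a) a = 0"
    unfolding poly_char_polynomial using finite_G s_id[of a] aO
    by (auto simp: prod_zero_iff OL_L intro!: bexI[of _ \<one>])
  then have "poly (char_polynomial a) (a ^ p) - 0 ^ p \<in> P"
    using poly_frobenius_P[of "char_polynomial a" a] coeff_char_polynomial_Ints[OF aO] aO by simp
  then have "(\<Prod>g\<in>carrier G. a ^ p - s g a) \<in> P"
    using prime_gt_0_nat[OF prime_p] by (simp add: poly_char_polynomial zero_power)
  then obtain g where g: "g \<in> carrier G" "a ^ p - s g a \<in> P"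
    using P_prod[OF finite_G, of "\<lambda>g. a ^ p - s g a"] aO by auto
  \<comment> \<open>If g moved P, then a would lie in the conjugate of P under \<open>inv g\<close>,
    so g a and with it a^p would lie in P, contrary to a not in P.\<close>
  have gD: "g \<in> decomposition_group"
  proof (rule ccontr)
    assume gD: "g \<notin> decomposition_group"
    have "inv g \<notin> decomposition_group"
    proof
      assume "inv g \<in> decomposition_group"
      then have "inv (inv g) \<in> decomposition_group" by (rule D.m_inv_closed)
      then show False using g(1) gD by simp
    qed
    then have "s (inv g) ` P \<noteq> P"
      using G.inv_closed[OF g(1)] unfolding decomposition_group_def by blast
    moreover have "s (inv g) ` P \<in> conjugates" using g(1) by (intro imageI G.inv_closed)
    ultimately have "a \<in> s (inv g) ` P" by (intro a_conj)
    then have "s g a \<in> P" using conj_mem_iff[OF g(1) aO] by blast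
    from FI_D(3)[OF P_FI g(2) this] have "a ^ p \<in> P" by simp
    then show False using aP aO P_power by blast
  qed
  \<comment> \<open>Because g preserves P, it can be applied to the congruence for j, which turns
    a^(p^j) into (g a)^(p^j) and then into a^(p^(j+1)).\<close>
  have frob: "s (g [^] j) a - a ^ (p ^ j) \<in> P" for j :: nat
  proof (induction j)
    case 0
    then show ?case using aO FI_D(2)[OF P_FI] by (simp add: s_id OL_L)
  next
    case (Suc j)
    have "s (g [^] Suc j) a = s g (s (g [^] j) a)"
      using g(1) aO by (simp add: G.m_comm s_comp OL_L)
    moreover have "s g (s (g [^] j) a - a ^ (p ^ j)) \<in> P"
      using decomposition_group_mem_iff[OF gD] Suc g(1) aO by simp
    ultimately have 1: "s (g [^] Suc j) a - s g a ^ (p ^ j) \<in> P"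
      using g(1) aO by (simp add: s_diff s_power OL_L power_closed)
    have 2: "(a ^ p) ^ (p ^ j) - s g a ^ (p ^ j) \<in> P"
      using g aO by (intro power_cong_P) auto
    have "s (g [^] Suc j) a - a ^ (p ^ Suc j) =
        (s (g [^] Suc j) a - s g a ^ (p ^ j)) - ((a ^ p) ^ (p ^ j) - s g a ^ (p ^ j))"
      by (simp add: power_mult)
    also have "\<dots> \<in> P" using FI_diff[OF P_FI 1 2] .
    finally show ?case .
  qed
  define d where "d = card decomposition_group"
  have "finite decomposition_group" using finite_G D.subset finite_subset by blast
  then have d0: "d > 0" unfolding d_def using D.one_closed by (metis card_gt_0_iff empty_iff)
  have "g [^] d = \<one>"
  proof -
    interpret DG: group "G\<lparr>carrier := decomposition_group\<rparr>"
      by (rule D.subgroup_is_group[OF G.group_axioms])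
    have "g [^]\<^bsub>G\<lparr>carrier := decomposition_group\<rparr>\<^esub> d = \<one>"
      using DG.pow_order_eq_1[of g] gD by (simp add: Coset.order_def d_def)
    then show ?thesis by (simp add: G.nat_pow_consistent[symmetric])
  qed
  \<comment> \<open>The power of g is now the identity; cancelling a leaves a^(p^d - 1) = 1 modulo
    P, and a has order p^f - 1 there.\<close>
  then have "a - a ^ (p ^ d) \<in> P" using frob[of d] aO by (simp add: s_id OL_L)
  moreover have "p ^ d > 0" using prime_gt_0_nat[OF prime_p] by simp
  then have "a ^ (p ^ d) = a * a ^ (p ^ d - 1)" by (metis power_minus_mult mult.commute)
  ultimately have "a * (1 - a ^ (p ^ d - 1)) \<in> P" by (simp add: algebra_simps)
  then have "1 - a ^ (p ^ d - 1) \<in> P" using P_prime[of a] aP aO by auto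
  then have "a ^ (p ^ d - 1) - 1 \<in> P" using P_mult(1)[of "-1" "1 - a ^ (p ^ d - 1)"] by auto
  then have "p ^ f - 1 dvd p ^ d - 1" unfolding a_pow .
  then have "f dvd d" by (rule power_minus_one_dvdD[OF prime_ge_2_nat[OF prime_p]])
  then show ?thesis by (simp add: f_def d_def)
qed

end


section \<open>Factorization of unramified primes\<close>

text \<open>Ramification index 1 unpacked: J is a cofactor of P in the ideal generated by p, and the
  last assumption says that P^2 does not divide that ideal.\<close>

locale unramified_prime = galois_prime +
  fixes J :: "complex set"
  assumes J_FI [simp]: "J \<in> carrier FI"
    and P_J: "P \<odot> J = principal (of_nat p)"
    and not_square: "B \<in> carrier FI \<Longrightarrow> B \<subseteq> OL \<Longrightarrow> P \<odot> (P \<odot> B) \<noteq> principal (of_nat p)"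
begin

lemma p_nonzero: "(of_nat p :: complex) \<noteq> 0"
  using prime_gt_0_nat[OF prime_p] by simp

lemma image_s_principal_p: "g \<in> carrier G \<Longrightarrow> s g ` principal (of_nat p) = principal (of_nat p)"
  by (simp add: image_s_principal)

text \<open>The Galois action fixes the ideal (p), so each conjugate divides it as well; the
  conjugate cofactor divided by p is the inverse.\<close>

lemma conj_inverse:
  assumes "Q \<in> conjugates" obtains Q' where "Q' \<in> carrier FI" "Q \<odot> Q' = OL"
proof -
  obtain g where g: "g \<in> carrier G" "Q = s g ` P" using assms by blast
  have "Q \<odot> s g ` J = s g ` (P \<odot> J)"
    using g P_L FI_D(1)[OF J_FI] by (simp add: image_s_cprod)
  also have "\<dots> = principal (of_nat p)" using g by (simp add: P_J image_s_principal_p)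
  finally have "Q \<odot> (s g ` J \<odot> principal (inverse (of_nat p))) =
      principal (of_nat p) \<odot> principal (inverse (of_nat p))"
    by (simp flip: cprod_assoc)
  also have "\<dots> = OL" using p_nonzero by (subst principal_mult) (auto intro: inverse_closed)
  finally show ?thesis
    using g p_nonzero by (intro that[of "s g ` J \<odot> principal (inverse (of_nat p))"])
      (auto intro!: cprod_FI principal_FI inverse_closed)
qed

text \<open>To contain is to divide, because Q is invertible: the cofactor is the inverse of Q times
  A, and A inside Q makes it integral.\<close>

lemma conj_divides:
  assumes "Q \<in> conjugates" "A \<in> carrier FI" "A \<subseteq> Q"
  obtains B where "B \<in> carrier FI" "B \<subseteq> OL" "Q \<odot> B = A"
proof -
  obtain Q' where Q': "Q' \<in> carrier FI" "Q \<odot> Q' = OL" using conj_inverse[OF assms(1)] .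
  show ?thesis
  proof (rule that)
    show "Q' \<odot> A \<in> carrier FI" using Q' assms by auto
    show "Q' \<odot> A \<subseteq> OL"
      using cprod_mono[of Q' Q' A Q] assms(3) Q'(2) by (simp add: cprod_commute)
    show "Q \<odot> (Q' \<odot> A) = A" using Q' assms(2) by (simp flip: cprod_assoc)
  qed
qed

lemma conj_not_square:
  assumes "Q \<in> conjugates" "B \<in> carrier FI" "B \<subseteq> OL"
  shows "Q \<odot> (Q \<odot> B) \<noteq> principal (of_nat p)"
proof
  assume eq: "Q \<odot> (Q \<odot> B) = principal (of_nat p)"
  obtain g where g: "g \<in> carrier G" "Q = s g ` P" using assms(1) by blast
  have ig: "inv g \<in> carrier G" using g by simp
  have Q: "Q \<subseteq> L" "Q \<odot> B \<subseteq> L" "B \<subseteq> L"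
    by (rule FI_D(1)[OF conj_FI[OF assms(1)]], rule FI_D(1)[OF cprod_FI[OF conj_FI[OF assms(1)] assms(2)]],
        rule FI_D(1)[OF assms(2)])
  have QP: "s (inv g) ` Q = P" using g P_L image_s_id by (simp flip: image_s_comp)
  have "principal (of_nat p) = s (inv g) ` (Q \<odot> (Q \<odot> B))"
    unfolding eq using ig by (simp add: image_s_principal_p)
  also have "\<dots> = P \<odot> (P \<odot> s (inv g) ` B)"
    using Q ig by (simp add: image_s_cprod QP)
  finally show False
    using not_square[of "s (inv g) ` B"] assms(2,3) ig by auto
qed

text \<open>Conjugates are split off one at a time. With v outside Q but in all of F, v^|F| lies in
  the product over F; multiplied by an element b of the cofactor B it lies in (p), hence in Q, so b
  lies in Q. Thus Q divides B.\<close>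

lemma prod_conjugates_divides:
  assumes "F \<subseteq> conjugates"
  shows "\<exists>B\<in>carrier FI. B \<subseteq> OL \<and> finprod FI (\<lambda>Q. Q) F \<odot> B = principal (of_nat p)"
proof -
  have "finite F" using assms finite_conjugates finite_subset by blast
  then show ?thesis using assms
  proof (induction F rule: finite_induct)
    case empty
    have "principal (of_nat p) \<in> carrier FI" using p_nonzero by (intro principal_FI) auto
    moreover have "principal (of_nat p) \<subseteq> OL" by (auto simp: principal_def)
    ultimately show ?case by auto
  next
    case (insert Q F)
    then obtain B where B: "B \<in> carrier FI" "B \<subseteq> OL" "finprod FI (\<lambda>Q. Q) F \<odot> B = principal (of_nat p)"
      by blast
    have Q: "Q \<in> conjugates" and F: "F \<subseteq> conjugates" using insert.prems by auto
    have FF: "finprod FI (\<lambda>Q. Q) F \<in> carrier FI" using F by (intro FI.finprod_closed) auto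
    obtain v where v: "v \<in> OL" "v \<notin> Q" "\<And>Q'. Q' \<in> conjugates \<Longrightarrow> Q' \<noteq> Q \<Longrightarrow> v \<in> Q'"
      using conj_separate[OF Q] by blast
    have "(\<Prod>Q'\<in>F. v) \<in> finprod FI (\<lambda>Q. Q) F"
      using insert.hyps F v(3) by (intro finprod_FI_memI) auto
    then have vF: "v ^ card F \<in> finprod FI (\<lambda>Q. Q) F" by simp
    have "B \<subseteq> Q"
    proof
      fix b assume b: "b \<in> B"
      then have "v ^ card F * b \<in> principal (of_nat p)" using cprodI[OF vF b] B(3) by simp
      then obtain a where a: "a \<in> OL" "v ^ card F * b = a * of_nat p" by (auto simp: principal_def)
      then have "v ^ card F * b \<in> Q" using FI_D(4)[OF conj_FI[OF Q] a(1) of_nat_p_conj[OF Q]] by simp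
      then show "b \<in> Q" using conj_prime[OF Q, of "v ^ card F" b] conj_power[OF Q v(1)] v b B(2) by blast
    qed
    then obtain C where C: "C \<in> carrier FI" "C \<subseteq> OL" "Q \<odot> C = B" using conj_divides[OF Q B(1)] by blast
    have "finprod FI (\<lambda>Q. Q) (insert Q F) \<odot> C = (Q \<odot> finprod FI (\<lambda>Q. Q) F) \<odot> C"
      using insert.hyps Q F by (subst FI.finprod_insert) auto
    also have "\<dots> = finprod FI (\<lambda>Q. Q) F \<odot> (Q \<odot> C)"
      using cprod_assoc cprod_commute by metis
    also have "\<dots> = principal (of_nat p)" using B(3) C(3) by simp
    finally show ?case using C by blast
  qed
qed

lemma finprod_conjugates_subset:
  assumes "F \<subseteq> conjugates" shows "finprod FI (\<lambda>Q. Q) F \<subseteq> OL"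
proof -
  have "finite F" using assms finite_conjugates finite_subset by blast
  then show ?thesis using assms
  proof (induction F rule: finite_induct)
    case (insert R F)
    then have "finprod FI (\<lambda>Q. Q) (insert R F) = R \<odot> finprod FI (\<lambda>Q. Q) F"
      by (subst FI.finprod_insert) auto
    also have "\<dots> \<subseteq> OL \<odot> OL" using insert conj_subset by (intro cprod_mono) auto
    finally show ?case by simp
  qed auto
qed

text \<open>The cofactor of the product of the conjugates is contained in none of them; an element of it
  outside all of them has norm prime to \<open>p\<close>.\<close>

lemma prod_conjugates: "finprod FI (\<lambda>Q. Q) conjugates = principal (of_nat p)"
proof -
  define A where "A = finprod FI (\<lambda>Q. Q) conjugates"
  have A: "A \<in> carrier FI" unfolding A_def by (intro FI.finprod_closed) auto
  obtain B where B: "B \<in> carrier FI" "B \<subseteq> OL" "A \<odot> B = principal (of_nat p)"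
    using prod_conjugates_divides[OF order_refl] unfolding A_def by blast
  \<comment> \<open>If Q contained B, it would divide both the product of the conjugates and its
    cofactor, so Q^2 would divide (p).\<close>
  have nsub: "\<not> B \<subseteq> Q" if Q: "Q \<in> conjugates" for Q
  proof
    assume "B \<subseteq> Q"
    then obtain C where C: "C \<in> carrier FI" "C \<subseteq> OL" "Q \<odot> C = B" using conj_divides[OF Q B(1)] by blast
    define A' where "A' = finprod FI (\<lambda>Q. Q) (conjugates - {Q})"
    have A': "A' \<in> carrier FI" unfolding A'_def by (intro FI.finprod_closed) auto
    have "finprod FI (\<lambda>Q. Q) (insert Q (conjugates - {Q})) = Q \<odot> A'"
      unfolding A'_def using finite_conjugates Q by (subst FI.finprod_insert) auto
    then have AQ: "A = Q \<odot> A'" using Q by (simp add: A_def insert_absorb)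
    have A'_subset: "A' \<subseteq> OL"
      unfolding A'_def by (rule finprod_conjugates_subset) blast
    have "Q \<odot> (Q \<odot> (A' \<odot> C)) = A \<odot> B"
      unfolding AQ C(3)[symmetric] using cprod_assoc cprod_commute by metis
    moreover have "A' \<odot> C \<subseteq> OL" using cprod_mono[OF A'_subset C(2)] by simp
    ultimately show False using conj_not_square[OF Q cprod_FI[OF A' C(1)]] B(3) by simp
  qed
  \<comment> \<open>Avoidance of all conjugates at once: one element of B for each Q, lying outside
    Q and inside every other conjugate.\<close>
  have ex: "\<exists>x. x \<in> B \<and> x \<notin> Q \<and> (\<forall>Q'\<in>conjugates. Q' \<noteq> Q \<longrightarrow> x \<in> Q')" if Q: "Q \<in> conjugates" for Q
  proof -
    obtain v where v: "v \<in> OL" "v \<notin> Q" "\<And>Q'. Q' \<in> conjugates \<Longrightarrow> Q' \<noteq> Q \<Longrightarrow> v \<in> Q'"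
      using conj_separate[OF Q] by blast
    obtain b where b: "b \<in> B" "b \<notin> Q" using nsub[OF Q] by blast
    have 1: "v * b \<in> B" using FI_D(4)[OF B(1) v(1) b(1)] .
    have 2: "v * b \<notin> Q" using conj_prime[OF Q v(1), of b] v b B(2) by blast
    have 3: "v * b \<in> Q'" if "Q' \<in> conjugates" "Q' \<noteq> Q" for Q'
      using FI_D(4)[OF conj_FI[OF that(1)] subsetD[OF B(2) b(1)] v(3)[OF that]] by (metis mult.commute)
    show ?thesis by (intro exI[of _ "v * b"] conjI ballI impI 1 2 3)
  qed
  from bchoice[OF ballI[OF ex]]
  obtain y where "\<forall>Q\<in>conjugates. y Q \<in> B \<and> y Q \<notin> Q \<and> (\<forall>Q'\<in>conjugates. Q' \<noteq> Q \<longrightarrow> y Q \<in> Q')"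
    by (rule exE)
  note * = bspec[OF this]
  have y: "y Q \<in> B" "y Q \<notin> Q" if "Q \<in> conjugates" for Q
    using *[OF that] by simp_all
  have y3: "y Q \<in> Q'" if "Q \<in> conjugates" "Q' \<in> conjugates" "Q' \<noteq> Q" for Q Q'
    by (rule mp[OF bspec[OF conjunct2[OF conjunct2[OF *[OF that(1)]]] that(2)] that(3)])
  \<comment> \<open>Modulo each Q exactly one summand survives, so x lies in no conjugate.\<close>
  define x where "x = (\<Sum>Q\<in>conjugates. y Q)"
  have xB: "x \<in> B" unfolding x_def using y(1) by (intro FI_sum[OF B(1)])
  then have xO: "x \<in> OL" using B(2) by blast
  have xQ: "x \<notin> Q" if Q: "Q \<in> conjugates" for Q
  proof
    assume "x \<in> Q"
    have "x = y Q + (\<Sum>R\<in>conjugates - {Q}. y R)"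
      unfolding x_def using finite_conjugates Q by (rule sum.remove)
    moreover have "(\<Sum>R\<in>conjugates - {Q}. y R) \<in> Q"
      using Q by (intro FI_sum[OF conj_FI[OF Q]] y3) auto
    ultimately have "y Q \<in> Q" using FI_diff[OF conj_FI[OF Q] \<open>x \<in> Q\<close>] by (metis add_diff_cancel_right')
    then show False using y(2)[OF Q] by simp
  qed
  obtain k :: int where k: "norm_over (carrier G) x = of_int k" using norm_over_Ints[OF xO] .
  have "s g x \<notin> P" if "g \<in> carrier G" for g
    using conj_mem_iff[OF that xO] xQ[of "s (inv g) ` P"] that by auto
  then have "norm_over (carrier G) x \<notin> P"
    unfolding norm_over_def using P_prod[OF finite_G, of "\<lambda>g. s g x"] xO by auto
  then have nk: "\<not> int p dvd k" unfolding k of_int_mem_P .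
  have "norm_over (carrier G) x = s \<one> x * (\<Prod>g\<in>carrier G - {\<one>}. s g x)"
    unfolding norm_over_def using finite_G by (subst prod.remove[of _ \<one>]) auto
  also have "\<dots> = (\<Prod>g\<in>carrier G - {\<one>}. s g x) * x" using xO by (simp add: s_id OL_L)
  also have "\<dots> \<in> B" using xO xB by (intro FI_D(4)[OF B(1)] OL_prod) auto
  finally have kB: "of_int k \<in> B" using k by simp
  have "A \<subseteq> OL" unfolding A_def by (rule finprod_conjugates_subset) simp
  then have "A \<odot> B \<subseteq> B" using cprod_mono[of A OL B B] B(1) by simp
  then have pB: "of_nat p \<in> B" using B(3) principal_self by blast
  \<comment> \<open>B contains p and also the norm k of x, which is prime to p; Bezout puts 1 into
    B.\<close>
  obtain u w where uw: "u * k + w * int p = 1" using prime_bezout_int[OF prime_p nk] .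
  have "of_int u * of_int k + of_int w * of_nat p \<in> B"
    by (intro FI_D(3)[OF B(1)] FI_D(4)[OF B(1)] kB pB) auto
  moreover have "of_int u * of_int k + of_int w * of_nat p = (1 :: complex)"
    using arg_cong[OF uw, of "of_int :: int \<Rightarrow> complex"] by simp
  ultimately have "1 \<in> B" by simp
  then have "a \<in> B" if "a \<in> OL" for a using FI_D(4)[OF B(1) that \<open>1 \<in> B\<close>] by simp
  then have "B = OL" using B(2) by blast
  then show ?thesis using B(3) A by (simp add: A_def)
qed

text \<open>The subgroup HD has order divisible by |H| and by f, hence is all of G, so each
  conjugate has the form h P with h in H. It has this form for exactly |H \<inter> D| elements h,
  and this number is the exponent k.\<close>

lemma ideal_norm_principal_if_coprime:
  assumes H: "subgroup H G" and card: "card (carrier G) = residue_degree L \<rat> P * card H"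
    and coprime: "coprime (residue_degree L \<rat> P) (card H)"
  obtains k :: nat where "ideal_norm H P = principal (of_nat p ^ k)"
proof -
  interpret H: subgroup H G by fact
  interpret D: subgroup decomposition_group G by (rule subgroup_decomposition_group)
  define U where "U = H <#> decomposition_group"
  have U: "subgroup U G" unfolding U_def by (rule G.mult_subgroups[OF H subgroup_decomposition_group])
  have sub: "H \<subseteq> U" "decomposition_group \<subseteq> U"
  proof -
    have mem: "h \<otimes> d \<in> U" if "h \<in> H" "d \<in> decomposition_group" for h d
      using that unfolding U_def set_mult_def by blast
    show "H \<subseteq> U" using mem[OF _ D.one_closed] by (simp add: subset_iff)
    show "decomposition_group \<subseteq> U" using mem[OF H.one_closed] by (simp add: subset_iff)
  qed
  have lagrange: "card V dvd card U" if "subgroup V G" "V \<subseteq> U" for V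
  proof -
    interpret GU: group "G\<lparr>carrier := U\<rparr>" by (rule subgroup.subgroup_is_group[OF U G.group_axioms])
    have "subgroup V (G\<lparr>carrier := U\<rparr>)" using G.subgroup_incl[OF that(1) U that(2)] .
    from GU.lagrange[OF this] have "card (rcosets\<^bsub>G\<lparr>carrier := U\<rparr>\<^esub> V) * card V = card U"
      by (simp add: Coset.order_def)
    then show ?thesis by (metis dvd_triv_right)
  qed
  have "residue_degree L \<rat> P dvd card U"
    using residue_degree_dvd_card_decomposition_group lagrange[OF subgroup_decomposition_group sub(2)]
    by (rule dvd_trans)
  then have "card (carrier G) dvd card U"
    unfolding card using lagrange[OF H sub(1)] coprime by (intro divides_mult)
  moreover have UG: "U \<subseteq> carrier G" using U by (rule subgroup.subset)
  moreover have "card U > 0"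
    using finite_subset[OF UG finite_G] subgroup.one_closed[OF U] by (metis card_gt_0_iff empty_iff)
  ultimately have "U = carrier G"
    using finite_G by (metis card_seteq dvd_imp_le)
  have orbit: "conjugates = (\<lambda>h. s h ` P) ` H"
  proof
    show "(\<lambda>h. s h ` P) ` H \<subseteq> conjugates" using H.subset by auto
    show "conjugates \<subseteq> (\<lambda>h. s h ` P) ` H"
    proof
      fix Q assume "Q \<in> conjugates"
      then obtain g where "g \<in> U" "Q = s g ` P" using \<open>U = carrier G\<close> by blast
      then obtain h d where hd: "h \<in> H" "d \<in> decomposition_group" "Q = s (h \<otimes> d) ` P"
        unfolding U_def set_mult_def by blast
      have "Q = s h ` (s d ` P)"
        unfolding hd(3) by (rule image_s_comp[OF H.mem_carrier[OF hd(1)] D.mem_carrier[OF hd(2)] P_L])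
      also have "s d ` P = P" using hd(2) unfolding decomposition_group_def by blast
      finally show "Q \<in> (\<lambda>h. s h ` P) ` H" using hd(1) by blast
    qed
  qed
  \<comment> \<open>The elements of H sending P to a given conjugate form a left coset of H \<inter>
    D.\<close>
  have fibre: "card {h \<in> H. s h ` P = Q} = card (H \<inter> decomposition_group)"
    if "Q \<in> (\<lambda>h. s h ` P) ` H" for Q
  proof -
    obtain h0 where h0: "h0 \<in> H" "Q = s h0 ` P" using \<open>Q \<in> _\<close> by blast
    have "bij_betw (\<lambda>k. h0 \<otimes> k) (H \<inter> decomposition_group) {h \<in> H. s h ` P = Q}"
    proof (rule bij_betw_byWitness[where f' = "\<lambda>h. inv h0 \<otimes> h"])
      show "\<forall>k\<in>H \<inter> decomposition_group. inv h0 \<otimes> (h0 \<otimes> k) = k"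
        using h0 by (auto simp: G.m_assoc[symmetric])
      show "\<forall>h\<in>{h \<in> H. s h ` P = Q}. h0 \<otimes> (inv h0 \<otimes> h) = h"
        using h0 by (auto simp: G.m_assoc[symmetric])
      show "(\<lambda>k. h0 \<otimes> k) ` (H \<inter> decomposition_group) \<subseteq> {h \<in> H. s h ` P = Q}"
      proof (rule image_subsetI)
        fix k assume k: "k \<in> H \<inter> decomposition_group"
        then have "s (h0 \<otimes> k) ` P = s h0 ` (s k ` P)"
          using h0(1) by (intro image_s_comp[OF _ _ P_L]) auto
        also have "s k ` P = P" using k unfolding decomposition_group_def by blast
        finally show "h0 \<otimes> k \<in> {h \<in> H. s h ` P = Q}" using h0 k H.m_closed by auto
      qed
      show "(\<lambda>h. inv h0 \<otimes> h) ` {h \<in> H. s h ` P = Q} \<subseteq> H \<inter> decomposition_group"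
      proof
        fix k assume "k \<in> (\<lambda>h. inv h0 \<otimes> h) ` {h \<in> H. s h ` P = Q}"
        then obtain h where h: "h \<in> H" "s h ` P = Q" "k = inv h0 \<otimes> h" by blast
        have "s k ` P = s (inv h0) ` (s h ` P)"
          unfolding h(3) using h(1) h0(1) by (intro image_s_comp[OF _ _ P_L]) auto
        also have "\<dots> = s (inv h0 \<otimes> h0) ` P"
          unfolding h(2) h0(2) using h0(1) by (intro image_s_comp[OF _ _ P_L, symmetric]) auto
        also have "\<dots> = P" using h0(1) image_s_id[OF P_L] by simp
        finally have "s k ` P = P" .
        moreover have "k \<in> H" unfolding h(3) using h(1) h0(1) by auto
        ultimately show "k \<in> H \<inter> decomposition_group"
          unfolding decomposition_group_def using H.mem_carrier by blast
      qed
    qed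
    then show ?thesis by (simp add: bij_betw_same_card)
  qed
  have "finite H" using H.subset finite_G finite_subset by blast
  then have "finprod FI (\<lambda>h. s h ` P) {h \<in> H. s h ` P \<in> conjugates} =
      finprod FI (\<lambda>c. c) conjugates [^]\<^bsub>FI\<^esub> card (H \<inter> decomposition_group)"
    using H.subset fibre by (intro FI.finprod_const_fibres) (auto simp: orbit)
  moreover have "{h \<in> H. s h ` P \<in> conjugates} = H" using H.subset by auto
  ultimately have "ideal_norm H P = principal (of_nat p) [^]\<^bsub>FI\<^esub> card (H \<inter> decomposition_group)"
    by (simp add: ideal_norm_def prod_conjugates)
  also have "\<dots> = principal (of_nat p ^ card (H \<inter> decomposition_group))"
    using p_nonzero by (intro principal_pow) auto
  finally show ?thesis by (rule that)
qed

end


section \<open>Ramification index and divisibility by powers of a prime\<close>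

lemma ideal_prod_ring_of_integers: "ideal_prod (\<O> L) I J = I \<odot> J"
proof
  show "ideal_prod (\<O> L) I J \<subseteq> I \<odot> J"
  proof
    fix x assume "x \<in> ideal_prod (\<O> L) I J" then show "x \<in> I \<odot> J"
      by (induction rule: ideal_prod.induct) (auto intro: cprodI cprod_add)
  qed
  show "I \<odot> J \<subseteq> ideal_prod (\<O> L) I J"
  proof
    fix x assume "x \<in> I \<odot> J" then show "x \<in> ideal_prod (\<O> L) I J"
      by (induction rule: cprod_induct)
        (use ideal_prod.prod[of _ I _ J "\<O> L"] ideal_prod.sum[of _ "\<O> L" I J] in auto)
  qed
qed

lemma (in number_field) ideals_set_pow:
  "I [^]\<^bsub>ideals_set (\<O> L)\<^esub> (e :: nat) = I [^]\<^bsub>FI\<^esub> e"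
  by (induction e) (simp_all add: nat_pow_def ideals_set_def ideal_prod_ring_of_integers)

context prime_ideal_over
begin

lemma principal_p: "principal (of_nat p) \<in> carrier FI" "principal (of_nat p) \<subseteq> OL"
proof -
  show "principal (of_nat p) \<in> carrier FI"
    using prime_gt_0_nat[OF prime_p] by (intro principal_FI) auto
  show "principal (of_nat p) \<subseteq> OL" by (auto simp: principal_def)
qed

lemma Idl_below: "Idl\<^bsub>\<O> L\<^esub> (P \<inter> integers_set \<rat>) = principal (of_nat p)"
proof
  have "P \<inter> \<int> \<subseteq> principal (of_nat p)"
  proof
    fix x assume "x \<in> P \<inter> \<int>"
    then obtain k :: int where k: "x = of_int k" "int p dvd k" by (auto simp: Ints_def of_int_mem_P)
    then obtain j where "k = int p * j" by blast
    then have "x = of_int j * of_nat p" using k by simp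
    then show "x \<in> principal (of_nat p)" by (auto simp: principal_def)
  qed
  then show "Idl\<^bsub>\<O> L\<^esub> (P \<inter> integers_set \<rat>) \<subseteq> principal (of_nat p)"
    unfolding genideal_def integers_set_Rats using FI_ideal_OL[OF principal_p] by blast
  show "principal (of_nat p) \<subseteq> Idl\<^bsub>\<O> L\<^esub> (P \<inter> integers_set \<rat>)"
    unfolding genideal_def integers_set_Rats
  proof (rule Inter_greatest, clarify)
    fix I x assume I: "ideal I (\<O> L)" "P \<inter> \<int> \<subseteq> I" and "x \<in> principal (of_nat p)"
    then obtain a where a: "a \<in> OL" "x = a * of_nat p" by (auto simp: principal_def)
    have "of_nat p \<in> I" using I(2) of_nat_mem_P[of p] by auto
    then show "x \<in> I" using ideal.I_l_closed[OF I(1), of "of_nat p" a] a by simp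
  qed
qed

text \<open>Translates the divisibility in \<open>ramification_index\<close> into the monoid
  \<open>FI\<close>. The cofactor ranges over all ideals of the ring of integers; the zero ideal is
  excluded because p is nonzero.\<close>

lemma divides_iff:
  "(P [^]\<^bsub>ideals_set (\<O> L)\<^esub> (e :: nat)) divides\<^bsub>ideals_set (\<O> L)\<^esub> (Idl\<^bsub>\<O> L\<^esub> (P \<inter> integers_set \<rat>)) \<longleftrightarrow>
    (\<exists>B\<in>carrier FI. B \<subseteq> OL \<and> principal (of_nat p) = P [^]\<^bsub>FI\<^esub> e \<odot> B)" (is "?l \<longleftrightarrow> ?r")
proof -
  have "?l \<longleftrightarrow> (\<exists>B. ideal B (\<O> L) \<and> principal (of_nat p) = P [^]\<^bsub>FI\<^esub> e \<odot> B)"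
    unfolding Idl_below ideals_set_pow factor_def
    by (auto simp: ideals_set_def ideal_prod_ring_of_integers)
  also have "\<dots> \<longleftrightarrow> ?r"
  proof
    assume "\<exists>B. ideal B (\<O> L) \<and> principal (of_nat p) = P [^]\<^bsub>FI\<^esub> e \<odot> B"
    then obtain B where B: "ideal B (\<O> L)" "principal (of_nat p) = P [^]\<^bsub>FI\<^esub> e \<odot> B" by blast
    have "B \<noteq> {0}"
    proof
      assume "B = {0}"
      then have "P [^]\<^bsub>FI\<^esub> e \<odot> B \<subseteq> {0}" by (intro cprod_subsetI) auto
      then have "(of_nat p :: complex) = 0" using B(2) principal_self[of "of_nat p"] by auto
      then show False using prime_gt_0_nat[OF prime_p] by simp
    qed
    then show ?r using B ideal_OL_FI[OF B(1)] by blast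
  next
    assume ?r
    then show "\<exists>B. ideal B (\<O> L) \<and> principal (of_nat p) = P [^]\<^bsub>FI\<^esub> e \<odot> B"
      using FI_ideal_OL by blast
  qed
  finally show ?thesis .
qed

text \<open>If \<open>P ^ e\<close> divides \<open>p\<close>, elements of \<open>P ^ i\<close> outside \<open>P ^ (i + 1)\<close>, for \<open>i < e\<close>, satisfy no
  integral relation with a coefficient prime to \<open>p\<close>.\<close>

lemma ramification_bounded:
  "\<exists>b. \<forall>e::nat. (\<exists>B\<in>carrier FI. B \<subseteq> OL \<and> principal (of_nat p) = P [^]\<^bsub>FI\<^esub> e \<odot> B) \<longrightarrow> e \<le> b"
proof -
  obtain N where N: "\<forall>x. (\<forall>i\<le>N. x i \<in> L) \<longrightarrow> (\<exists>(c :: nat \<Rightarrow> int) j. (\<Sum>i\<le>N. of_int (c i) * x i) = 0 \<and>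
    j \<le> N \<and> \<not> int p dvd c j \<and> (\<forall>i<j. int p dvd c i))"
    using int_dependence_mod[OF prime_p] by blast
  have bound: "e \<le> N" if "B \<in> carrier FI" "B \<subseteq> OL" "principal (of_nat p) = P [^]\<^bsub>FI\<^esub> e \<odot> B" for e :: nat and B
  proof (rule ccontr)
    assume "\<not> e \<le> N"
    define W where "W i = P [^]\<^bsub>FI\<^esub> (i :: nat)" for i
    have W_FI: "W i \<in> carrier FI" for i by (simp add: W_def FI.nat_pow_closed)
    have W_Suc: "W (Suc i) = W i \<odot> P" for i by (simp add: W_def)
    have W_step: "W (Suc i) \<subseteq> W i" for i
      using cprod_mono[OF order_refl[of "W i"] P_subset] W_FI by (simp add: W_Suc)
    have W_mono: "W j \<subseteq> W i" if "i \<le> j" for i j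
      using lift_Suc_antimono_le[of W, OF W_step that] .
    have W_OL: "W i \<subseteq> OL" for i using W_mono[of 0 i] by (simp add: W_def)
    have "P [^]\<^bsub>FI\<^esub> e \<odot> B \<subseteq> W e"
      using cprod_mono[OF order_refl[of "W e"] that(2)] W_FI by (simp add: W_def)
    then have "of_nat p \<in> W e" using that(3) principal_self by blast
    then have p_W: "of_nat p \<in> W i" if "i \<le> e" for i using W_mono[OF that] by blast
    \<comment> \<open>Here e is positive, so P divides (p) and is invertible; hence its powers
      decrease strictly and elements of W i outside W (i + 1) exist.\<close>
    have "P \<in> Units FI"
    proof -
      obtain m where m: "e = Suc m" using \<open>\<not> e \<le> N\<close> by (cases e) auto
      have p0: "(of_nat p :: complex) \<noteq> 0" using prime_gt_0_nat[OF prime_p] by simp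
      define C where "C = W m \<odot> (B \<odot> principal (inverse (of_nat p)))"
      have ip: "principal (inverse (of_nat p)) \<in> carrier FI" using p0 by (intro principal_FI inverse_closed) auto
      have C: "C \<in> carrier FI" unfolding C_def using that W_FI ip by auto
      have "P \<odot> C = (W e \<odot> B) \<odot> principal (inverse (of_nat p))"
        unfolding C_def m W_Suc using cprod_assoc cprod_commute by metis
      also have "\<dots> = principal (of_nat p) \<odot> principal (inverse (of_nat p))"
        using that(3) by (simp add: W_def)
      also have "\<dots> = OL" using p0 by (subst principal_mult) (auto intro: inverse_closed)
      finally show ?thesis using C by (auto simp: Units_def cprod_commute)
    qed
    have "W (Suc i) \<noteq> W i" for i
    proof
      assume "W (Suc i) = W i"
      then have "W i \<odot> P = W i \<odot> OL" using W_FI by (simp add: W_Suc)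
      moreover have "W i \<in> Units FI" unfolding W_def using \<open>P \<in> Units FI\<close> by (rule FI.Units_pow_closed)
      ultimately have "P = OL" using FI.Units_l_cancel[of "W i" P OL] by simp
      then show False using one_not_mem_P OL_1 by simp
    qed
    then have "\<exists>x. x \<in> W i \<and> x \<notin> W (Suc i)" for i using W_step[of i] by blast
    then obtain x where x: "\<And>i. x i \<in> W i" "\<And>i. x i \<notin> W (Suc i)" by metis
    have "\<forall>i\<le>N. x i \<in> L" using x(1) W_OL OL_L by blast
    then obtain c :: "nat \<Rightarrow> int" and j where c: "(\<Sum>i\<le>N. of_int (c i) * x i) = 0"
      and j: "\<not> int p dvd c j" "j \<le> N" "\<And>i. i < j \<Longrightarrow> int p dvd c i"
      using N by blast
    \<comment> \<open>j \<le> N < e gives j + 1 \<le> e. In the relation, terms below j have a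
      coefficient divisible by p and terms above j lie in W (j + 1) already, so the term at j must
      lie there too.\<close>
    have pj: "of_nat p \<in> W (Suc j)" using j(2) \<open>\<not> e \<le> N\<close> by (intro p_W) auto
    have "(\<Sum>i\<in>{..N} - {j}. of_int (c i) * x i) \<in> W (Suc j)"
    proof (rule FI_sum[OF W_FI])
      fix i assume i: "i \<in> {..N} - {j}"
      show "of_int (c i) * x i \<in> W (Suc j)"
      proof (cases "i < j")
        case True
        then obtain m where "c i = int p * m" using j(3) by blast
        then have "of_int (c i) * x i = (of_int m * x i) * of_nat p" by simp
        also have "\<dots> \<in> W (Suc j)" using x(1)[of i] W_OL[of i] pj by (intro FI_D(4)[OF W_FI]) auto
        finally show ?thesis .
      next
        case False
        then have "x i \<in> W (Suc j)" using i x(1)[of i] W_mono[of "Suc j" i] by auto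
        then show ?thesis by (intro FI_D(4)[OF W_FI]) auto
      qed
    qed
    moreover have "of_int (c j) * x j = 0 - (\<Sum>i\<in>{..N} - {j}. of_int (c i) * x i)"
      using c j(2) sum.remove[of "{..N}" j "\<lambda>i. of_int (c i) * x i"] by (simp add: eq_neg_iff_add_eq_0)
    ultimately have cx: "of_int (c j) * x j \<in> W (Suc j)"
      using FI_diff[OF W_FI FI_D(2)[OF W_FI]] by simp
    \<comment> \<open>Both c_j x_j and p lie in W (j + 1), and c_j is prime to p, so x_j itself
      would lie there.\<close>
    obtain u w where uw: "u * c j + w * int p = 1" using prime_bezout_int[OF prime_p j(1)] .
    have "x j = of_int (u * c j + w * int p) * x j" by (simp add: uw)
    also have "\<dots> = of_int u * (of_int (c j) * x j) + (of_int w * x j) * of_nat p"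
      by (simp add: algebra_simps)
    also have "\<dots> \<in> W (Suc j)"
      using x(1)[of j] W_OL[of j]
      by (intro FI_D(3)[OF W_FI FI_D(4)[OF W_FI _ cx] FI_D(4)[OF W_FI _ pj]]) auto
    finally show False using x(2) by blast
  qed
  show ?thesis
  proof (rule exI[of _ N], intro allI impI)
    fix e :: nat assume "\<exists>B\<in>carrier FI. B \<subseteq> OL \<and> principal (of_nat p) = P [^]\<^bsub>FI\<^esub> e \<odot> B"
    then obtain B where "B \<in> carrier FI" "B \<subseteq> OL" "principal (of_nat p) = P [^]\<^bsub>FI\<^esub> e \<odot> B"
      by (elim bexE conjE)
    then show "e \<le> N" by (rule bound)
  qed
qed

text \<open>\<open>GREATEST\<close> is informative only for a bounded, satisfiable predicate;
  \<open>ramification_bounded\<close> and the exponent 0 provide this. That 1 is attained gives J,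
  and that 2 exceeds the maximum excludes P^2.\<close>

lemma unramified_factor:
  assumes "unramified L \<rat> P"
  obtains J where "J \<in> carrier FI" "P \<odot> J = principal (of_nat p)"
    "\<And>B. B \<in> carrier FI \<Longrightarrow> B \<subseteq> OL \<Longrightarrow> P \<odot> (P \<odot> B) \<noteq> principal (of_nat p)"
proof -
  define E where "E e \<longleftrightarrow> (\<exists>B\<in>carrier FI. B \<subseteq> OL \<and> principal (of_nat p) = P [^]\<^bsub>FI\<^esub> e \<odot> B)" for e :: nat
  have G: "Greatest E = 1"
    using assms unfolding unramified_def ramification_index_def divides_iff E_def[symmetric] .
  obtain b where b: "\<And>e. E e \<Longrightarrow> e \<le> b" using ramification_bounded unfolding E_def by blast
  have "E 0" unfolding E_def using principal_p by auto
  then have "E 1" using GreatestI_nat[of E 0 b] b G by simp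
  then obtain J where J: "J \<in> carrier FI" "J \<subseteq> OL" "principal (of_nat p) = P \<odot> J"
    by (auto simp: E_def)
  show ?thesis
  proof (rule that[OF J(1) J(3)[symmetric]])
    fix B assume B: "B \<in> carrier FI" "B \<subseteq> OL"
    show "P \<odot> (P \<odot> B) \<noteq> principal (of_nat p)"
    proof
      assume "P \<odot> (P \<odot> B) = principal (of_nat p)"
      then have "E 2" using B unfolding E_def by (auto simp: numeral_2_eq_2 cprod_assoc)
      then have "2 \<le> Greatest E" using b by (intro Greatest_le_nat) auto
      then show False using G by simp
    qed
  qed
qed

end


section \<open>Cyclotomic fields and their subfields\<close>

lemma field_CC: "field \<C>"
  by (rule field_from_type_algebra)

lemma domain_CC: "domain \<C>"
  using field_CC by (rule field.axioms(1))

text \<open>Polynomials over F are taken as complex polynomials, so that degree, roots and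
  divisibility are those of \<open>complex poly\<close>.\<close>

definition coeffs_in :: "complex set \<Rightarrow> complex poly set" where
  "coeffs_in F = {q. \<forall>i. coeff q i \<in> F}"

lemma coeffs_in_closed:
  assumes "subfield F \<C>"
  shows "q \<in> coeffs_in F \<Longrightarrow> r \<in> coeffs_in F \<Longrightarrow> q + r \<in> coeffs_in F"
    "q \<in> coeffs_in F \<Longrightarrow> r \<in> coeffs_in F \<Longrightarrow> q - r \<in> coeffs_in F"
    "q \<in> coeffs_in F \<Longrightarrow> r \<in> coeffs_in F \<Longrightarrow> q * r \<in> coeffs_in F"
    "c \<in> F \<Longrightarrow> q \<in> coeffs_in F \<Longrightarrow> pCons c q \<in> coeffs_in F"
    "0 \<in> coeffs_in F" "c \<in> F \<Longrightarrow> Polynomial.monom c k \<in> coeffs_in F"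
    "c \<in> F \<Longrightarrow> q \<in> coeffs_in F \<Longrightarrow> Polynomial.smult c q \<in> coeffs_in F"
  using subfield_closed[OF assms]
  by (auto simp: coeffs_in_def coeff_mult coeff_pCons split: nat.splits intro!: subfield_sum[OF assms])

lemma coeffs_in_const: "subfield F \<C> \<Longrightarrow> c \<in> F \<Longrightarrow> [:c:] \<in> coeffs_in F"
  by (simp add: coeffs_in_closed)

lemma coeffs_in_pcompose_monom:
  assumes "subfield F \<C>" "q \<in> coeffs_in F" shows "pcompose q (Polynomial.monom 1 b) \<in> coeffs_in F"
  using assms(2)
proof (induction q)
  case (pCons c q)
  have co: "coeff (pCons c q) i \<in> F" for i using pCons.prems by (simp add: coeffs_in_def)
  have c: "c \<in> F" using co[of 0] by simp
  have "q \<in> coeffs_in F" unfolding coeffs_in_def using co[of "Suc i" for i] by simp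
  then have "pcompose q (Polynomial.monom 1 b) \<in> coeffs_in F" by (rule pCons.IH)
  then show ?case unfolding pcompose_pCons
    by (intro coeffs_in_closed(1,3,6)[OF assms(1)] coeffs_in_const[OF assms(1) c] subfield_closed(2)[OF assms(1)])
qed (simp add: coeffs_in_closed[OF assms(1)])

lemma coeffs_in_mono: "F \<subseteq> F' \<Longrightarrow> coeffs_in F \<subseteq> coeffs_in F'"
  by (auto simp: coeffs_in_def)


lemma poly_Poly_eq_sum: "poly (Poly xs) x = (\<Sum>i<length xs. xs ! i * x ^ i)"
  for x :: "'a :: comm_semiring_1"
  by (induction xs)
     (simp_all add: sum.lessThan_Suc_shift sum_distrib_left mult_ac del: sum.lessThan_Suc)

section \<open>Powers of a primitive root of unity\<close>

locale root_of_unity =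
  fixes n :: nat and \<zeta> :: complex
  assumes primitive: "primitive_root_of_unity n \<zeta>"
begin

lemma n_pos: "n > 0" and zeta_pow_n: "\<zeta> ^ n = 1"
  and zeta_pow_neq_1: "0 < k \<Longrightarrow> k < n \<Longrightarrow> \<zeta> ^ k \<noteq> 1"
  using primitive by (auto simp: primitive_root_of_unity_def)

lemma zeta_nonzero: "\<zeta> \<noteq> 0"
  using zeta_pow_n n_pos by (auto simp: zero_power)

lemma zeta_pow_mod: "\<zeta> ^ (k mod n) = \<zeta> ^ k"
proof -
  have "\<zeta> ^ k = \<zeta> ^ (n * (k div n) + k mod n)" by simp
  also have "\<dots> = \<zeta> ^ (k mod n)" by (simp only: power_add power_mult zeta_pow_n) simp
  finally show ?thesis by simp
qed

lemma zeta_pow_eq_1_iff: "\<zeta> ^ k = 1 \<longleftrightarrow> n dvd k"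
  using zeta_pow_mod[of k] zeta_pow_neq_1[of "k mod n"] n_pos
  by (metis dvd_eq_mod_eq_0 gr0I mod_less_divisor power_0)

lemma inj_on_zeta_pow: "inj_on (\<lambda>a. \<zeta> ^ a) {..<n}"
proof -
  have "a = b" if "a \<le> b" "b < n" "\<zeta> ^ a = \<zeta> ^ b" for a b
  proof -
    have "\<zeta> ^ a * \<zeta> ^ (b - a) = \<zeta> ^ b" using that(1) by (simp flip: power_add)
    then have "\<zeta> ^ a * \<zeta> ^ (b - a) = \<zeta> ^ a * 1" using that(3) by simp
    then have "\<zeta> ^ (b - a) = 1" using zeta_nonzero by simp
    then have "n dvd b - a" by (simp add: zeta_pow_eq_1_iff)
    then show ?thesis using that by (auto dest: dvd_imp_le)
  qed
  then show ?thesis by (intro inj_onI) (metis lessThan_iff nat_le_linear)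
qed

definition unity_poly :: "complex poly" where "unity_poly = Polynomial.monom 1 n - 1"

lemma poly_unity_poly [simp]: "poly unity_poly z = z ^ n - 1"
  by (simp add: unity_poly_def poly_monom)

lemma degree_unity_poly: "degree unity_poly = n" and lead_coeff_unity_poly: "lead_coeff unity_poly = 1"
proof -
  have c: "coeff unity_poly n = 1" using n_pos by (simp add: unity_poly_def)
  have "coeff unity_poly i = 0" if "i > n" for i using that by (simp add: unity_poly_def)
  then have "degree unity_poly \<le> n" by (intro degree_le) auto
  then show d: "degree unity_poly = n" using c le_degree[of unity_poly n] by simp
  show "lead_coeff unity_poly = 1" using c d by simp
qed

lemma unity_poly_nonzero: "unity_poly \<noteq> 0"
  using lead_coeff_unity_poly by auto

text \<open>The n distinct powers of \<zeta> already exhaust the roots that a polynomial of degree n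
  can have.\<close>

lemma unity_roots: "{z. z ^ n = 1} = (\<lambda>a. \<zeta> ^ a) ` {..<n}"
proof (rule card_subset_eq[symmetric])
  have fin: "finite {z. poly unity_poly z = 0}" by (rule poly_roots_finite[OF unity_poly_nonzero])
  then show "finite {z :: complex. z ^ n = 1}" by simp
  show sub: "(\<lambda>a. \<zeta> ^ a) ` {..<n} \<subseteq> {z. z ^ n = 1}"
    by (auto simp: power_mult[symmetric] mult.commute[of _ n]) (simp add: power_mult zeta_pow_n)
  have c: "card ((\<lambda>a. \<zeta> ^ a) ` {..<n}) = n" using card_image[OF inj_on_zeta_pow] by simp
  have "card {z :: complex. z ^ n = 1} \<le> n"
    using card_poly_roots_bound[OF unity_poly_nonzero] by (simp add: degree_unity_poly)
  moreover have "card ((\<lambda>a. \<zeta> ^ a) ` {..<n}) \<le> card {z :: complex. z ^ n = 1}"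
    using fin by (intro card_mono sub) simp
  ultimately show "card ((\<lambda>a. \<zeta> ^ a) ` {..<n}) = card {z :: complex. z ^ n = 1}"
    using c by simp
qed

abbreviation L :: "complex set" where "L \<equiv> adjoin_rat \<zeta>"

lemma subfield_L: "subfield L \<C>" and zeta_L: "\<zeta> \<in> L"
  unfolding adjoin_rat_def
  by (auto intro!: field.generate_field_is_subfield[OF field_CC] generate_field.incl)

lemma zeta_pow_L: "\<zeta> ^ a \<in> L"
  using subfield_closed(8)[OF subfield_L zeta_L] .

lemma poly_L: assumes "q \<in> coeffs_in L" "z \<in> L" shows "poly q z \<in> L"
  unfolding poly_altdef using assms
  by (intro subfield_sum[OF subfield_L] subfield_closed[OF subfield_L]) (auto simp: coeffs_in_def)

end


section \<open>The minimal polynomial of \<zeta> over an intermediate field\<close>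

locale intermediate_field = root_of_unity +
  fixes F :: "complex set"
  assumes subfield_F: "subfield F \<C>" and F_subset: "F \<subseteq> L"
begin

lemma Rats_F: "\<rat> \<subseteq> F"
  by (rule subfield_Rats_subset[OF subfield_F])

text \<open>Transcendence means that evaluation at \<zeta> is injective on F[X]. Coefficient lists
  start at the top, so \<open>1 # replicate n 0\<close> is X^n, which takes the same value at
  \<zeta> as the constant 1.\<close>

lemma algebraic_zeta: "(CC.algebraic over F) \<zeta>"
proof -
  note F = subfield_closed[OF subfield_F]
  have ev0: "CC.eval (replicate k 0) \<zeta> = 0" for k by (induction k) auto
  have "CC.eval [1] \<zeta> = CC.eval (1 # replicate n 0) \<zeta>" by (simp add: ev0 zeta_pow_n)
  moreover have "[1] \<in> carrier (F [X]\<^bsub>\<C>\<^esub>)" "1 # replicate n 0 \<in> carrier (F [X]\<^bsub>\<C>\<^esub>)"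
    using F by (auto simp: univ_poly_def polynomial_def)
  moreover have "[1] \<noteq> (1 :: complex) # replicate n 0" using n_pos by (cases n) auto
  ultimately have "\<not> CC.transcendental F \<zeta>"
    unfolding CC.transcendental_def by (meson inj_onD)
  then show ?thesis by (simp add: over_def)
qed

text \<open>Replaces the generated field by the inductive \<open>simple_extension\<close>, whose
  elements are polynomial values at \<zeta> in Horner form.\<close>

lemma L_eq: "L = CC.simple_extension F \<zeta>"
proof
  have E: "subfield (CC.simple_extension F \<zeta>) \<C>"
    using domain.simple_extension_is_subfield[OF domain_CC subfield_F] algebraic_zeta by simp
  have "F \<subseteq> CC.simple_extension F \<zeta>" "\<zeta> \<in> CC.simple_extension F \<zeta>"
    by (rule CC.simple_extension_incl) (auto intro!: CC.simple_extension_mem subfieldE(1)[OF subfield_F])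
  then show "L \<subseteq> CC.simple_extension F \<zeta>"
    unfolding adjoin_rat_def using Rats_F
    by (intro field.generate_field_min_subfield1[OF field_CC _ E]) auto
  show "CC.simple_extension F \<zeta> \<subseteq> L"
    by (rule CC.simple_extension_subring_incl[OF subfieldE(1)[OF subfield_L] F_subset zeta_L])
qed

definition minimal_poly :: "complex poly \<Rightarrow> bool" where
  "minimal_poly m \<longleftrightarrow> m \<in> coeffs_in F \<and> lead_coeff m = 1 \<and> poly m \<zeta> = 0 \<and>
     (\<forall>q \<in> coeffs_in F. q \<noteq> 0 \<longrightarrow> poly q \<zeta> = 0 \<longrightarrow> degree m \<le> degree q)"

definition m :: "complex poly" where "m = (SOME m. minimal_poly m)"

lemma unity_poly_coeffs_in: "unity_poly \<in> coeffs_in F"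
  using subfield_closed[OF subfield_F] coeffs_in_const[OF subfield_F, of 1]
  by (auto simp: unity_poly_def one_pCons intro!: coeffs_in_closed[OF subfield_F])

text \<open>X^n - 1 shows that some nonzero polynomial over F kills \<zeta>; one of least degree is
  divided by its leading coefficient.\<close>

lemma minimal_poly_m: "minimal_poly m"
proof -
  define S where "S = {q \<in> coeffs_in F. q \<noteq> 0 \<and> poly q \<zeta> = 0}"
  have "unity_poly \<in> S"
    using unity_poly_coeffs_in unity_poly_nonzero zeta_pow_n by (simp add: S_def)
  then obtain q where q: "q \<in> S" "\<And>r. r \<in> S \<Longrightarrow> degree q \<le> degree r"
    using arg_min_natI[of "\<lambda>q. q \<in> S" _ degree] arg_min_nat_le[of "\<lambda>q. q \<in> S" _ degree] by metis
  have q0: "q \<noteq> 0" "q \<in> coeffs_in F" "poly q \<zeta> = 0" using q(1) by (auto simp: S_def)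
  have lc: "lead_coeff q \<in> F" using q0(2) by (auto simp: coeffs_in_def)
  have "minimal_poly (Polynomial.smult (inverse (lead_coeff q)) q)"
    unfolding minimal_poly_def using q0 q(2) lc subfield_closed(7)[OF subfield_F lc]
    by (auto simp: S_def intro!: coeffs_in_closed(7)[OF subfield_F])
  then show ?thesis unfolding m_def by (rule someI)
qed

lemma m_coeffs: "m \<in> coeffs_in F" and m_monic: "lead_coeff m = 1" and m_zeta: "poly m \<zeta> = 0"
  and m_minimal: "q \<in> coeffs_in F \<Longrightarrow> poly q \<zeta> = 0 \<Longrightarrow> degree q < degree m \<Longrightarrow> q = 0"
proof -
  note M = minimal_poly_m[unfolded minimal_poly_def]
  show "m \<in> coeffs_in F" "lead_coeff m = 1" "poly m \<zeta> = 0" using M by simp_all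
  show "q = 0" if "q \<in> coeffs_in F" "poly q \<zeta> = 0" "degree q < degree m"
    using M that by (meson linorder_not_le)
qed

lemma m_nonzero: "m \<noteq> 0" using m_monic by auto

lemma degree_m_pos: "degree m > 0"
proof (rule ccontr)
  assume "\<not> degree m > 0"
  then obtain c where c: "m = [:c:]" by (metis degree_eq_zeroE gr_zeroI)
  then show False using m_monic m_zeta by simp
qed

text \<open>One step of long division by m; since m is monic, the quotient term takes the leading
  coefficient of q and stays over F.\<close>

lemma reduce_degree:
  assumes "q \<in> coeffs_in F" "degree q \<ge> degree m"
  obtains c where "c \<in> coeffs_in F" "degree (q - c * m) < degree q \<or> q - c * m = 0"
proof -
  define c where "c = Polynomial.monom (lead_coeff q) (degree q - degree m)"
  have c: "c \<in> coeffs_in F"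
    unfolding c_def using assms by (intro coeffs_in_closed(6)[OF subfield_F]) (auto simp: coeffs_in_def)
  show ?thesis
  proof (cases "q = 0")
    case True
    then show ?thesis using that[of 0] coeffs_in_closed(5)[OF subfield_F] by simp
  next
    case False
    have dc: "degree c = degree q - degree m" using False by (simp add: c_def degree_monom_eq)
    have c0: "c \<noteq> 0" using False by (simp add: c_def)
    have deg: "degree (c * m) = degree q" using c0 m_nonzero dc assms by (simp add: degree_mult_eq)
    have "lead_coeff c = lead_coeff q" unfolding dc by (simp add: c_def)
    then have "lead_coeff (c * m) = lead_coeff q" unfolding lead_coeff_mult m_monic by simp
    then have co: "coeff (q - c * m) (degree q) = 0" using deg by simp
    have "degree (q - c * m) \<le> degree q" using deg by (intro degree_diff_le) auto
    then have "degree (q - c * m) < degree q \<or> q - c * m = 0"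
      using co by (metis le_neq_implies_less leading_coeff_0_iff)
    then show ?thesis using that c by blast
  qed
qed

lemma m_dvd:
  assumes "q \<in> coeffs_in F" "poly q \<zeta> = 0" shows "m dvd q"
  using assms
proof (induction "degree q" arbitrary: q rule: less_induct)
  case less
  show ?case
  proof (cases "degree q < degree m")
    case True
    then show ?thesis using m_minimal[OF less.prems] by simp
  next
    case False
    then obtain c where c: "c \<in> coeffs_in F" "degree (q - c * m) < degree q \<or> q - c * m = 0"
      using reduce_degree[OF less.prems(1)] by (metis linorder_not_le)
    have "q - c * m \<in> coeffs_in F" "poly (q - c * m) \<zeta> = 0"
      using less.prems c m_coeffs m_zeta by (auto intro!: coeffs_in_closed[OF subfield_F])
    then have "m dvd q - c * m" using c(2) less.hyps by (metis dvd_0_right)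
    then show ?thesis by (metis diff_add_cancel dvd_add dvd_triv_right)
  qed
qed

text \<open>Induction along Horner's scheme: each step raises the degree by at most one, so a single
  reduction by m restores the bound.\<close>

lemma L_poly:
  assumes "x \<in> L"
  obtains q where "q \<in> coeffs_in F" "degree q < degree m" "poly q \<zeta> = x"
proof -
  have "\<exists>q\<in>coeffs_in F. degree q < degree m \<and> poly q \<zeta> = x"
    using assms unfolding L_eq
  proof (induction rule: CC.simple_extension.induct)
    case zero
    then show ?case using degree_m_pos coeffs_in_closed(5)[OF subfield_F] by (auto intro!: bexI[of _ 0])
  next
    case (lin k1 k2)
    then obtain q where q: "q \<in> coeffs_in F" "degree q < degree m" "poly q \<zeta> = k1" by blast
    define r where "r = pCons k2 q"
    have r: "r \<in> coeffs_in F" "poly r \<zeta> = k1 * \<zeta> + k2" "degree r \<le> degree m"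
      using q lin by (auto simp: r_def mult.commute coeffs_in_closed[OF subfield_F])
    show ?case
    proof (cases "degree r < degree m")
      case True
      then show ?thesis using r by auto
    next
      case False
      then have dr: "degree r = degree m" using r(3) by simp
      then obtain c where c: "c \<in> coeffs_in F" "degree (r - c * m) < degree r \<or> r - c * m = 0"
        using reduce_degree[OF r(1)] by (metis order_refl)
      have "r - c * m \<in> coeffs_in F" "poly (r - c * m) \<zeta> = k1 * \<zeta> + k2"
        using r c m_coeffs m_zeta by (auto intro!: coeffs_in_closed[OF subfield_F])
      moreover have "degree (r - c * m) < degree m" using c(2) dr degree_m_pos by auto
      ultimately show ?thesis by auto
    qed
  qed
  then show ?thesis using that by blast
qed

lemma m_root_unity: assumes "poly m z = 0" shows "z ^ n = 1"
proof -
  have "m dvd unity_poly" using zeta_pow_n by (intro m_dvd unity_poly_coeffs_in) simp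
  then show ?thesis using assms by (metis dvd_def eq_iff_diff_eq_0 mult_zero_left poly_mult poly_unity_poly)
qed

text \<open>Separability: m divides X^n - 1, which has n distinct roots. The cofactor accounts for
  at most its degree of them, so m has as many as its own degree.\<close>

lemma card_roots_m: "card {z. poly m z = 0} = degree m"
proof -
  have "m dvd unity_poly" using zeta_pow_n by (intro m_dvd unity_poly_coeffs_in) simp
  then obtain c where c: "unity_poly = m * c" by blast
  then have c0: "c \<noteq> 0" using unity_poly_nonzero by auto
  have "n = card {z. poly unity_poly z = 0}"
    using unity_roots card_image[OF inj_on_zeta_pow] by simp
  also have "{z. poly unity_poly z = 0} = {z. poly m z = 0} \<union> {z. poly c z = 0}" unfolding c by auto
  also have "card \<dots> \<le> card {z. poly m z = 0} + card {z. poly c z = 0}" by (rule card_Un_le)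
  also have "card {z. poly c z = 0} \<le> degree c" by (rule card_poly_roots_bound[OF c0])
  finally have "n \<le> card {z. poly m z = 0} + degree c" by simp
  moreover have "n = degree m + degree c"
    using degree_unity_poly c m_nonzero c0 by (metis degree_mult_eq)
  moreover have "card {z. poly m z = 0} \<le> degree m" by (rule card_poly_roots_bound[OF m_nonzero])
  ultimately show ?thesis by simp
qed

text \<open>Otherwise q - x would have more roots than its degree allows; so q is constant and x is
  its coefficient. This is the descent step behind \<open>fixed_field\<close>.\<close>

lemma const_on_roots:
  assumes "q \<in> coeffs_in F" "degree q < degree m" "\<And>z. poly m z = 0 \<Longrightarrow> poly q z = x"
  shows "x \<in> F"
proof -
  have "q - [:x:] = 0"
  proof (rule ccontr)
    assume nz: "q - [:x:] \<noteq> 0"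
    have "degree m = card {z. poly m z = 0}" by (simp add: card_roots_m)
    also have "\<dots> \<le> card {z. poly (q - [:x:]) z = 0}"
      using assms(3) by (intro card_mono poly_roots_finite[OF nz]) auto
    also have "\<dots> \<le> degree (q - [:x:])" by (rule card_poly_roots_bound[OF nz])
    also have "\<dots> \<le> degree q" by (intro degree_diff_le) auto
    finally show False using assms(2) by simp
  qed
  then have "x = coeff q 0" by simp
  then show ?thesis using assms(1) by (simp add: coeffs_in_def)
qed

text \<open>The powers of \<zeta> below the degree of m are a basis: minimality of m gives
  independence, \<open>L_poly\<close> gives the span.\<close>

lemma dimension_L: "CC.dimension (degree m) F L"
proof -
  define xs where "xs = map (\<lambda>i. \<zeta> ^ i) [0..<degree m]"
  have len: "length xs = degree m" by (simp add: xs_def)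
  have comb: "CC.combine Ks xs = poly (Poly Ks) \<zeta>" if "length Ks = degree m" for Ks
  proof -
    have "CC.combine Ks xs = (\<Sum>i<degree m. Ks ! i * \<zeta> ^ i)"
      using combine_eq_sum[of Ks xs] that len by (simp add: xs_def)
    also have "\<dots> = poly (Poly Ks) \<zeta>"
      using that by (simp add: poly_Poly_eq_sum)
    finally show ?thesis .
  qed
  have PolyF: "Poly Ks \<in> coeffs_in F" if "set Ks \<subseteq> F" for Ks
    using that subfield_closed(1)[OF subfield_F] by (auto simp: coeffs_in_def nth_default_def)
  have "CC.independent F xs"
  proof (rule ccontr)
    assume "CC.dependent F xs"
    then obtain Ks where Ks: "length Ks = length xs" "CC.combine Ks xs = 0" "set Ks \<subseteq> F" "set Ks \<noteq> {0}"
      using CC.dependent_imp_non_trivial_combine[OF subfield_F, of xs] by auto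
    have "degree (Poly Ks) < degree m"
    proof -
      have "coeff (Poly Ks) i = 0" if "i > degree m - 1" for i
        using that Ks(1) len degree_m_pos by (auto simp: nth_default_def)
      then have "degree (Poly Ks) \<le> degree m - 1" by (intro degree_le) auto
      then show ?thesis using degree_m_pos by simp
    qed
    moreover have "poly (Poly Ks) \<zeta> = 0" using comb[of Ks] Ks(1,2) len by simp
    ultimately have P0: "Poly Ks = 0" using m_minimal[OF PolyF[OF Ks(3)]] by blast
    have "Ks ! i = 0" if "i < length Ks" for i
      using arg_cong[OF P0, of "\<lambda>q. coeff q i"] that by (simp add: nth_default_def)
    then have "set Ks \<subseteq> {0}" by (auto simp: in_set_conv_nth)
    then show False using Ks(1,4) len degree_m_pos by (cases Ks) auto
  qed
  moreover have "CC.Span F xs = L"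
  proof -
    have "CC.Span F xs = {CC.combine Ks xs | Ks. length Ks = length xs \<and> set Ks \<subseteq> F}"
      by (rule CC.Span_eq_combine_set_length_version[OF subfield_F]) simp
    also have "\<dots> = L"
    proof (intro equalityI subsetI)
      fix x assume "x \<in> {CC.combine Ks xs | Ks. length Ks = length xs \<and> set Ks \<subseteq> F}"
      then obtain Ks where Ks: "length Ks = degree m" "set Ks \<subseteq> F" "x = CC.combine Ks xs"
        using len by auto
      then show "x \<in> L" using comb[OF Ks(1)] poly_L[OF _ zeta_L] PolyF coeffs_in_mono[OF F_subset] by auto
    next
      fix x assume "x \<in> L"
      then obtain q where q: "q \<in> coeffs_in F" "degree q < degree m" "poly q \<zeta> = x" by (rule L_poly)
      define Ks where "Ks = map (coeff q) [0..<degree m]"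
      have "Poly Ks = q"
        by (rule poly_eqI) (use q(2) in \<open>auto simp: Ks_def nth_default_def coeff_eq_0\<close>)
      then have "x = CC.combine Ks xs" using comb[of Ks] q by (simp add: Ks_def)
      moreover have "length Ks = length xs" "set Ks \<subseteq> F" using q(1) len by (auto simp: Ks_def coeffs_in_def)
      ultimately show "x \<in> {CC.combine Ks xs | Ks. length Ks = length xs \<and> set Ks \<subseteq> F}" by blast
    qed
    finally show ?thesis .
  qed
  ultimately have "CC.dimension (length xs) F L" by (rule CC.dimensionI[OF subfield_F])
  then show ?thesis by (simp add: len)
qed

end

text \<open>Writing the unit as \<open>1 mod n\<close> covers n = 1, where the only residue is
  0.\<close>

definition units_mod :: "nat \<Rightarrow> nat monoid" where
  "units_mod n = \<lparr>carrier = {a. a < n \<and> coprime a n}, monoid.mult = (\<lambda>a b. a * b mod n), one = 1 mod n\<rparr>"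

lemma units_mod_simps [simp]:
  "carrier (units_mod n) = {a. a < n \<and> coprime a n}" "a \<otimes>\<^bsub>units_mod n\<^esub> b = a * b mod n"
  "\<one>\<^bsub>units_mod n\<^esub> = 1 mod n"
  by (simp_all add: units_mod_def)

lemma comm_group_units_mod:
  assumes "n > 0" shows "comm_group (units_mod n)"
proof (rule comm_groupI)
  fix a assume "a \<in> carrier (units_mod n)"
  then have a: "a < n" "coprime a n" by auto
  then obtain x where x: "[a * x = 1] (mod n)" using cong_solve_coprime_nat by (metis One_nat_def)
  have "coprime x n" using x by (metis cong_imp_coprime coprime_1_left coprime_mult_left_iff cong_sym)
  then have "x mod n \<in> carrier (units_mod n)" using assms by simp
  moreover have "(x mod n) * a mod n = 1 mod n"
    using x unfolding cong_def by (metis mod_mult_right_eq mult.commute)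
  ultimately show "\<exists>y\<in>carrier (units_mod n). y \<otimes>\<^bsub>units_mod n\<^esub> a = \<one>\<^bsub>units_mod n\<^esub>" by auto
next
  show "\<one>\<^bsub>units_mod n\<^esub> \<in> carrier (units_mod n)" using assms by simp
qed (use assms in \<open>auto simp: mod_mult_left_eq mod_mult_right_eq mult_ac\<close>)

lemma card_units_mod:
  assumes "n > 0" shows "card (carrier (units_mod n)) = totient n"
proof (cases "n = 1")
  case True
  then have "carrier (units_mod n) = {0}" by auto
  then show ?thesis using True by simp
next
  case False
  then have "carrier (units_mod n) = totatives n"
    using assms by (auto simp: totatives_def intro!: le_neq_implies_less Nat.gr0I)
  then show ?thesis by (simp add: totient_def)
qed

text \<open>Left multiplication by an element of a finite H is injective, hence onto H, and so
  reaches the identity inside H.\<close>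

lemma (in group) finite_subgroupI:
  assumes "finite H" "H \<subseteq> carrier G" "\<one> \<in> H" "\<And>x y. x \<in> H \<Longrightarrow> y \<in> H \<Longrightarrow> x \<otimes> y \<in> H"
  shows "subgroup H G"
proof (rule subgroupI)
  fix a assume a: "a \<in> H"
  then have aG: "a \<in> carrier G" using assms(2) by blast
  have "(\<lambda>x. a \<otimes> x) ` H = H"
  proof (rule endo_inj_surj[OF assms(1)])
    show "inj_on (\<lambda>x. a \<otimes> x) H" using assms(2) aG by (intro inj_onI) (simp add: subset_iff)
  qed (use assms(4) a in auto)
  then obtain b where b: "b \<in> H" "a \<otimes> b = \<one>" using assms(3) by (metis imageE)
  then have "inv a = b" using assms(2) aG by (metis inv_equality inv_comm subsetD)
  then show "inv a \<in> H" using b by simp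
qed (use assms in auto)


section \<open>The Galois group as a group of exponents\<close>

context root_of_unity
begin

sublocale Q: intermediate_field n \<zeta> \<rat>
  by (intro intermediate_field.intro intermediate_field_axioms.intro root_of_unity_axioms
      subfield_Rats subfield_Rats_subset[OF subfield_L])

text \<open>Automorphisms are named by exponents: those a for which \<zeta>^a is a root of the
  minimal polynomial over \<rat>, so that sending \<zeta> to \<zeta>^a is well defined on L.\<close>

definition conj_exponents :: "nat set" where
  "conj_exponents = {a. a < n \<and> poly Q.m (\<zeta> ^ a) = 0}"

definition galois_group :: "nat monoid" where
  "galois_group = (units_mod n)\<lparr>carrier := conj_exponents\<rparr>"

definition act :: "nat \<Rightarrow> complex \<Rightarrow> complex" where
  "act a x = poly (SOME q. q \<in> coeffs_in \<rat> \<and> poly q \<zeta> = x) (\<zeta> ^ a)"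

lemma galois_group_simps [simp]:
  "carrier galois_group = conj_exponents" "a \<otimes>\<^bsub>galois_group\<^esub> b = a * b mod n"
  "\<one>\<^bsub>galois_group\<^esub> = 1 mod n"
  by (simp_all add: galois_group_def)

text \<open>The choice made in \<open>act\<close> is immaterial: two rational polynomials agreeing
  at \<zeta> differ by a multiple of the minimal polynomial, which vanishes at \<zeta>^a as
  well.\<close>

lemma act_poly:
  assumes "a \<in> conj_exponents" "q \<in> coeffs_in \<rat>" shows "act a (poly q \<zeta>) = poly q (\<zeta> ^ a)"
proof -
  define r where "r = (SOME r. r \<in> coeffs_in \<rat> \<and> poly r \<zeta> = poly q \<zeta>)"
  have r: "r \<in> coeffs_in \<rat> \<and> poly r \<zeta> = poly q \<zeta>"
    unfolding r_def by (rule someI[of _ q]) (use assms in simp)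
  have "Q.m dvd r - q"
    using r assms by (intro Q.m_dvd) (auto intro: coeffs_in_closed[OF subfield_Rats])
  then obtain c where "r - q = Q.m * c" by blast
  then have "poly (r - q) (\<zeta> ^ a) = 0" using assms(1) by (simp add: conj_exponents_def)
  then show ?thesis by (simp add: act_def r_def)
qed

lemma act_closed: "a \<in> conj_exponents \<Longrightarrow> x \<in> L \<Longrightarrow> act a x \<in> L"
proof -
  assume a: "a \<in> conj_exponents" and "x \<in> L"
  then obtain q where q: "q \<in> coeffs_in \<rat>" "poly q \<zeta> = x" using Q.L_poly by blast
  then show "act a x \<in> L"
    using act_poly[OF a q(1)] poly_L[OF _ zeta_pow_L] coeffs_in_mono[OF Q.F_subset] by auto
qed

lemma act_add: "a \<in> conj_exponents \<Longrightarrow> x \<in> L \<Longrightarrow> y \<in> L \<Longrightarrow> act a (x + y) = act a x + act a y"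
  and act_mult: "a \<in> conj_exponents \<Longrightarrow> x \<in> L \<Longrightarrow> y \<in> L \<Longrightarrow> act a (x * y) = act a x * act a y"
proof -
  assume a: "a \<in> conj_exponents" and "x \<in> L" "y \<in> L"
  then obtain q r where q: "q \<in> coeffs_in \<rat>" "x = poly q \<zeta>" and r: "r \<in> coeffs_in \<rat>" "y = poly r \<zeta>"
    using Q.L_poly by metis
  note cl = coeffs_in_closed[OF subfield_Rats]
  show "act a (x + y) = act a x + act a y"
    using act_poly[OF a q(1)] act_poly[OF a r(1)] act_poly[OF a cl(1)[OF q(1) r(1)]] q r by simp
  show "act a (x * y) = act a x * act a y"
    using act_poly[OF a q(1)] act_poly[OF a r(1)] act_poly[OF a cl(3)[OF q(1) r(1)]] q r by simp
qed

lemma act_Rats: "a \<in> conj_exponents \<Longrightarrow> x \<in> \<rat> \<Longrightarrow> act a x = x"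
  using act_poly[of a "[:x:]"] coeffs_in_const[OF subfield_Rats] by simp

lemma act_zeta: "a \<in> conj_exponents \<Longrightarrow> act a \<zeta> = \<zeta> ^ a"
  using act_poly[of a "[:0, 1:]"] by (auto simp: coeffs_in_def coeff_pCons split: nat.splits)

lemma act_sum:
  "a \<in> conj_exponents \<Longrightarrow> (\<And>i. i \<in> A \<Longrightarrow> f i \<in> L) \<Longrightarrow> act a (\<Sum>i\<in>A. f i) = (\<Sum>i\<in>A. act a (f i))"
  by (induction A rule: infinite_finite_induct)
     (simp_all add: act_add act_Rats subfield_sum[OF subfield_L])

lemma act_power: "a \<in> conj_exponents \<Longrightarrow> x \<in> L \<Longrightarrow> act a (x ^ k) = act a x ^ k"
  by (induction k) (simp_all add: act_mult act_Rats subfield_closed[OF subfield_L])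

lemma act_nonzero:
  assumes "a \<in> conj_exponents" "x \<in> L" "x \<noteq> 0" shows "act a x \<noteq> 0"
proof
  assume "act a x = 0"
  have "act a (x * inverse x) = act a x * act a (inverse x)"
    using assms subfield_closed[OF subfield_L] by (intro act_mult) auto
  then show False using \<open>act a x = 0\<close> assms act_Rats[of a 1] by simp
qed

text \<open>For g = gcd a n > 1 and k = n / g, the number \<zeta>^k - 1 is nonzero but its image
  (\<zeta>^a)^k - 1 is 0, whereas \<open>act a\<close> preserves being nonzero.\<close>

lemma conj_exponents_coprime:
  assumes "a \<in> conj_exponents" shows "coprime a n"
proof (rule ccontr)
  assume "\<not> coprime a n"
  define g where "g = gcd a n"
  have g: "g dvd a" "g dvd n" "g \<noteq> 1" "g > 0"
    using \<open>\<not> coprime a n\<close> n_pos by (auto simp: g_def coprime_iff_gcd_eq_1)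
  obtain k where k: "n = g * k" using g by blast
  obtain b where b: "a = g * b" using g by blast
  have "(\<zeta> ^ a) ^ k = \<zeta> ^ (n * b)" unfolding k b by (simp flip: power_mult add: mult_ac)
  also have "\<dots> = 1" by (simp add: power_mult zeta_pow_n)
  finally have 1: "(\<zeta> ^ a) ^ k = 1" .
  have "0 < k" "k < n" using k g n_pos by (auto intro: Nat.gr0I)
  then have "\<zeta> ^ k - 1 \<noteq> 0" using zeta_pow_neq_1 by simp
  moreover have "\<zeta> ^ k - 1 \<in> L" by (intro subfield_closed(2,6)[OF subfield_L] zeta_pow_L)
  ultimately have "act a (\<zeta> ^ k - 1) \<noteq> 0" using assms by (intro act_nonzero)
  moreover have "act a (\<zeta> ^ k - 1) = act a (\<zeta> ^ k + (- 1))" by simp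
  also have "\<dots> = (\<zeta> ^ a) ^ k + (- 1)"
    using assms zeta_L subfield_closed[OF subfield_L]
    by (subst act_add) (simp_all add: act_power act_zeta act_Rats)
  ultimately show False using 1 by simp
qed

text \<open>Evaluate q(X^b), again rational: at \<zeta> it gives q(\<zeta>^b), at \<zeta>^a it gives
  q(\<zeta>^(ab)). For q the minimal polynomial this gives closure under products, for general q the
  composition law.\<close>

lemma act_comp:
  assumes "a \<in> conj_exponents" "b \<in> conj_exponents"
  shows "a * b mod n \<in> conj_exponents" "x \<in> L \<Longrightarrow> act (a * b mod n) x = act a (act b x)"
proof -
  have comp: "poly q (\<zeta> ^ (a * b mod n)) = act a (poly q (\<zeta> ^ b))" if "q \<in> coeffs_in \<rat>" for q
  proof -
    define r where "r = pcompose q (Polynomial.monom 1 b)"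
    have r: "r \<in> coeffs_in \<rat>" unfolding r_def by (rule coeffs_in_pcompose_monom[OF subfield_Rats that])
    have "poly q (\<zeta> ^ (a * b mod n)) = poly r (\<zeta> ^ a)"
      by (simp add: r_def poly_pcompose poly_monom zeta_pow_mod power_mult)
    also have "\<dots> = act a (poly r \<zeta>)" using act_poly[OF assms(1) r] by simp
    also have "poly r \<zeta> = poly q (\<zeta> ^ b)" by (simp add: r_def poly_pcompose poly_monom)
    finally show ?thesis .
  qed
  have "poly Q.m (\<zeta> ^ (a * b mod n)) = act a 0"
    using comp[OF Q.m_coeffs] assms(2) by (simp add: conj_exponents_def)
  then show ab: "a * b mod n \<in> conj_exponents"
    using n_pos act_Rats[OF assms(1), of 0] by (simp add: conj_exponents_def)
  assume "x \<in> L"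
  then obtain q where q: "q \<in> coeffs_in \<rat>" "x = poly q \<zeta>" using Q.L_poly by metis
  then show "act (a * b mod n) x = act a (act b x)"
    using comp[OF q(1)] act_poly[OF ab q(1)] act_poly[OF assms(2) q(1)] by simp
qed

lemma zeta_pow_1_mod: "\<zeta> ^ (1 mod n) = \<zeta>"
  using zeta_pow_mod[of 1] by (simp only: power_one_right)

lemma one_conj_exponents: "1 mod n \<in> conj_exponents"
  unfolding conj_exponents_def mem_Collect_eq zeta_pow_1_mod
  by (intro conjI mod_less_divisor n_pos Q.m_zeta)

lemma finite_conj_exponents: "finite conj_exponents"
  by (rule finite_subset[of _ "{..<n}"]) (auto simp: conj_exponents_def)

lemma subgroup_conj_exponents: "subgroup conj_exponents (units_mod n)"
proof -
  interpret U: comm_group "units_mod n" by (rule comm_group_units_mod[OF n_pos])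
  show ?thesis
    using conj_exponents_coprime act_comp(1) one_conj_exponents
    by (intro U.finite_subgroupI finite_conj_exponents) (auto simp: conj_exponents_def)
qed

lemma comm_group_galois_group: "comm_group galois_group"
proof -
  interpret U: comm_group "units_mod n" by (rule comm_group_units_mod[OF n_pos])
  have "group galois_group"
    unfolding galois_group_def by (rule subgroup.subgroup_is_group[OF subgroup_conj_exponents U.group_axioms])
  then show ?thesis by (rule group.group_comm_groupI) (simp add: mult.commute)
qed

lemma card_galois_group_dvd: "card conj_exponents dvd totient n"
proof -
  interpret U: comm_group "units_mod n" by (rule comm_group_units_mod[OF n_pos])
  have "card (rcosets\<^bsub>units_mod n\<^esub> conj_exponents) * card conj_exponents = totient n"
    using U.lagrange[OF subgroup_conj_exponents] card_units_mod[OF n_pos] by (simp add: Coset.order_def)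
  then show ?thesis by (metis dvd_triv_right)
qed

end


section \<open>Galois correspondence for an intermediate field\<close>

context intermediate_field
begin

definition fixing_exponents :: "nat set" where
  "fixing_exponents = {a \<in> conj_exponents. \<forall>x\<in>F. act a x = x}"

lemma act_poly_fixing:
  assumes "a \<in> fixing_exponents" "q \<in> coeffs_in F" shows "act a (poly q \<zeta>) = poly q (\<zeta> ^ a)"
proof -
  have a: "a \<in> conj_exponents" and c: "coeff q i \<in> F" for i
    using assms by (auto simp: fixing_exponents_def coeffs_in_def)
  have "act a (poly q \<zeta>) = (\<Sum>i\<le>degree q. act a (coeff q i * \<zeta> ^ i))"
    unfolding poly_altdef using a c F_subset zeta_pow_L
    by (intro act_sum subfield_closed(4)[OF subfield_L]) auto
  also have "\<dots> = (\<Sum>i\<le>degree q. coeff q i * (\<zeta> ^ a) ^ i)"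
  proof (rule sum.cong)
    fix i
    have "act a (coeff q i * \<zeta> ^ i) = act a (coeff q i) * act a \<zeta> ^ i"
      using a c F_subset zeta_L by (simp add: act_mult act_power subsetD zeta_pow_L)
    then show "act a (coeff q i * \<zeta> ^ i) = coeff q i * (\<zeta> ^ a) ^ i"
      using assms(1) c by (simp add: fixing_exponents_def act_zeta)
  qed simp
  finally show ?thesis by (simp add: poly_altdef)
qed

text \<open>If m vanishes at \<zeta>^a, so does every polynomial over F that kills \<zeta>. Applied
  to the rational minimal polynomial this makes a an automorphism; applied to q - x, where x in F is
  written as q(\<zeta>) with q rational, it shows that x is fixed.\<close>

lemma fixing_exponents_eq: "fixing_exponents = {a. a < n \<and> poly m (\<zeta> ^ a) = 0}"
proof (intro equalityI subsetI)
  fix a assume a: "a \<in> fixing_exponents"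
  then have "poly m (\<zeta> ^ a) = act a 0" using act_poly_fixing[OF a m_coeffs] m_zeta by simp
  also have "\<dots> = 0" using a act_Rats by (auto simp: fixing_exponents_def)
  finally show "a \<in> {a. a < n \<and> poly m (\<zeta> ^ a) = 0}"
    using a by (simp add: fixing_exponents_def conj_exponents_def)
next
  fix a assume a: "a \<in> {a. a < n \<and> poly m (\<zeta> ^ a) = 0}"
  have root: "poly q (\<zeta> ^ a) = 0" if q: "q \<in> coeffs_in F" "poly q \<zeta> = 0" for q
  proof -
    obtain c where "q = m * c" using m_dvd[OF q] by blast
    then show ?thesis using a by simp
  qed
  have ac: "a \<in> conj_exponents"
    using a root[of Q.m] Q.m_zeta Q.m_coeffs coeffs_in_mono[OF Rats_F] by (auto simp: conj_exponents_def)
  have "act a x = x" if x: "x \<in> F" for x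
  proof -
    obtain q where q: "q \<in> coeffs_in \<rat>" "poly q \<zeta> = x" using Q.L_poly x F_subset by blast
    have "poly (q - [:x:]) (\<zeta> ^ a) = 0"
      using q x coeffs_in_mono[OF Rats_F] coeffs_in_const[OF subfield_F x]
      by (intro root coeffs_in_closed(2)[OF subfield_F]) auto
    then show ?thesis using act_poly[OF ac q(1)] q(2) by simp
  qed
  then show "a \<in> fixing_exponents" using ac by (simp add: fixing_exponents_def)
qed

lemma card_fixing_exponents: "card fixing_exponents = degree m"
proof -
  have "bij_betw (\<lambda>a. \<zeta> ^ a) fixing_exponents {z. poly m z = 0}"
  proof (rule bij_betw_imageI)
    show "inj_on (\<lambda>a. \<zeta> ^ a) fixing_exponents"
      by (rule inj_on_subset[OF inj_on_zeta_pow]) (auto simp: fixing_exponents_eq)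
    show "(\<lambda>a. \<zeta> ^ a) ` fixing_exponents = {z. poly m z = 0}"
    proof (intro equalityI subsetI)
      fix z assume z: "z \<in> {z. poly m z = 0}"
      then have "z \<in> (\<lambda>a. \<zeta> ^ a) ` {..<n}" using m_root_unity unity_roots by blast
      then obtain a where "a < n" "z = \<zeta> ^ a" by blast
      then show "z \<in> (\<lambda>a. \<zeta> ^ a) ` fixing_exponents" using z by (auto simp: fixing_exponents_eq)
    qed (auto simp: fixing_exponents_eq)
  qed
  then show ?thesis using card_roots_m by (simp add: bij_betw_same_card)
qed

text \<open>Write x as q(\<zeta>) with q over F of degree below that of m. The values of q at the
  roots of m are the images of x, all equal to x, so q is constant.\<close>

lemma fixed_field:
  assumes "x \<in> L" "\<And>a. a \<in> fixing_exponents \<Longrightarrow> act a x = x" shows "x \<in> F"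
proof -
  obtain q where q: "q \<in> coeffs_in F" "degree q < degree m" "poly q \<zeta> = x" using assms(1) by (rule L_poly)
  show ?thesis
  proof (rule const_on_roots[OF q(1,2)])
    fix z assume z: "poly m z = 0"
    then have "z \<in> (\<lambda>a. \<zeta> ^ a) ` {..<n}" using m_root_unity unity_roots by blast
    then obtain a where "a < n" "z = \<zeta> ^ a" by blast
    then have "a \<in> fixing_exponents" using z by (simp add: fixing_exponents_eq)
    then show "poly q z = x" using act_poly_fixing[OF _ q(1)] q(3) assms(2) \<open>z = \<zeta> ^ a\<close> by metis
  qed
qed

lemma subgroup_fixing_exponents: "subgroup fixing_exponents galois_group"
proof -
  interpret G: comm_group galois_group by (rule comm_group_galois_group)
  show ?thesis
  proof (rule G.finite_subgroupI)
    show "finite fixing_exponents"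
      by (rule finite_subset[OF _ finite_conj_exponents]) (auto simp: fixing_exponents_def)
    show "\<one>\<^bsub>galois_group\<^esub> \<in> fixing_exponents"
      unfolding fixing_exponents_eq mem_Collect_eq galois_group_simps zeta_pow_1_mod
      by (intro conjI mod_less_divisor n_pos m_zeta)
  next
    fix a b assume "a \<in> fixing_exponents" "b \<in> fixing_exponents"
    then show "a \<otimes>\<^bsub>galois_group\<^esub> b \<in> fixing_exponents"
      using F_subset by (auto simp: fixing_exponents_def act_comp subset_iff)
  qed (auto simp: fixing_exponents_def)
qed

end

context root_of_unity
begin

lemma fixing_exponents_Rats: "Q.fixing_exponents = conj_exponents"
  by (auto simp: Q.fixing_exponents_def act_Rats)

lemma galois_extension_L: "galois_extension L galois_group act"
proof -
  interpret G: comm_group galois_group by (rule comm_group_galois_group)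
  show ?thesis
  proof (intro galois_extension.intro galois_extension_axioms.intro number_field.intro
      comm_group_galois_group)
    show "subfield L \<C>" by (rule subfield_L)
    show "CC.finite_dimension \<rat> L" using Q.dimension_L by (rule CC.finite_dimensionI)
    show "act \<one>\<^bsub>galois_group\<^esub> x = x" if x: "x \<in> L" for x
    proof -
      obtain q where q: "q \<in> coeffs_in \<rat>" "poly q \<zeta> = x" using Q.L_poly x by blast
      then show ?thesis using act_poly[OF one_conj_exponents q(1)] 
        unfolding galois_group_simps zeta_pow_1_mod q(2) by simp
    qed
    show "x \<in> \<rat>" if "x \<in> L" "\<And>g. g \<in> carrier galois_group \<Longrightarrow> act g x = x" for x
      using Q.fixed_field[OF that(1)] that(2) by (simp add: fixing_exponents_Rats)
  qed (simp_all add: finite_conj_exponents act_closed act_add act_mult act_comp)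
qed

end

text \<open>The degrees of L over \<rat> and over F are degrees of minimal polynomials, which count
  \<open>conj_exponents\<close> and \<open>fixing_exponents\<close>; the tower formula relates
  them.\<close>

lemma (in intermediate_field) degree_formula:
  "CC.finite_dimension \<rat> F" "card conj_exponents = field_degree F \<rat> * card fixing_exponents"
proof -
  have "subalgebra \<rat> F \<C>"
  proof (intro subalgebra.intro subalgebra_axioms.intro)
    show "subgroup F (add_monoid \<C>)" using subfieldE(1)[OF subfield_F] by (simp add: subring_def)
    show "k \<otimes>\<^bsub>\<C>\<^esub> v \<in> F" if "k \<in> \<rat>" "v \<in> F" for k v
      using subfield_closed(4)[OF subfield_F _ that(2), of k] Rats_F that(1) by auto
  qed
  then show fin: "CC.finite_dimension \<rat> F"
    by (rule CC.subalbegra_incl_imp_finite_dimension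
        [OF subfield_Rats CC.finite_dimensionI[OF Q.dimension_L] _ F_subset])
  have "CC.dimension (field_degree F \<rat>) \<rat> F"
    using CC.finite_dimensionE[OF subfield_Rats fin] by (simp add: field_degree_def over_def)
  from CC.telescopic_base[OF subfield_Rats subfield_F this dimension_L]
  have "field_degree F \<rat> * degree m = degree Q.m"
    using CC.dimension_is_inj[OF subfield_Rats _ Q.dimension_L] by blast
  then show "card conj_exponents = field_degree F \<rat> * card fixing_exponents"
    using card_fixing_exponents Q.card_fixing_exponents by (simp add: fixing_exponents_Rats)
qed


section \<open>Norms of ideals and the class group\<close>

context galois_extension
begin

text \<open>The representatives to which \<open>generate_Mod_representative\<close> is applied.
  Invertibility is included to make the set closed under inverses.\<close>

definition norm_principal :: "'g set \<Rightarrow> complex set set" where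
  "norm_principal H = {I \<in> carrier FI. (\<exists>I'\<in>carrier FI. I \<odot> I' = OL) \<and>
     (\<exists>x\<in>L. x \<noteq> 0 \<and> ideal_norm H I = principal x)}"

lemma ideal_norm_OL: "H \<subseteq> carrier G \<Longrightarrow> ideal_norm H OL = OL"
  using ideal_norm_principal[of H 1] by (simp add: norm_over_def subset_iff)

lemma norm_principal_mult:
  assumes H: "H \<subseteq> carrier G" and I: "I \<in> norm_principal H" and J: "J \<in> norm_principal H"
  shows "I \<odot> J \<in> norm_principal H"
proof -
  obtain I' x where I': "I \<in> carrier FI" "I' \<in> carrier FI" "I \<odot> I' = OL" "x \<in> L" "x \<noteq> 0"
    "ideal_norm H I = principal x" using I unfolding norm_principal_def by blast
  obtain J' y where J': "J \<in> carrier FI" "J' \<in> carrier FI" "J \<odot> J' = OL" "y \<in> L" "y \<noteq> 0"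
    "ideal_norm H J = principal y" using J unfolding norm_principal_def by blast
  have "(I \<odot> J) \<odot> (I' \<odot> J') = (I \<odot> I') \<odot> (J \<odot> J')"
    using cprod_assoc cprod_commute by metis
  then have "(I \<odot> J) \<odot> (I' \<odot> J') = OL" using I' J' by simp
  moreover have "ideal_norm H (I \<odot> J) = principal (x * y)"
    using I' J' H by (simp add: ideal_norm_mult principal_mult)
  moreover have "x * y \<in> L" "x * y \<noteq> 0" using I' J' by auto
  ultimately show ?thesis
    unfolding norm_principal_def using cprod_FI[OF I'(1) J'(1)] cprod_FI[OF I'(2) J'(2)] by blast
qed

lemma norm_principal_inverse:
  assumes H: "H \<subseteq> carrier G" and I: "I \<in> norm_principal H"
  shows "\<exists>J\<in>norm_principal H. I \<odot> J = OL"
proof -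
  obtain I' x where I': "I \<in> carrier FI" "I' \<in> carrier FI" "I \<odot> I' = OL" "x \<in> L" "x \<noteq> 0"
    "ideal_norm H I = principal x" using I unfolding norm_principal_def by blast
  have ix: "inverse x \<in> L" "inverse x \<noteq> 0" using I' by auto
  have eq: "principal x \<odot> ideal_norm H I' = OL"
    using ideal_norm_mult[OF H I'(1,2)] I' ideal_norm_OL[OF H] by simp
  have "principal (inverse x) = principal (inverse x) \<odot> (principal x \<odot> ideal_norm H I')"
    unfolding eq by (rule OL_cprod(2)[OF principal_FI[OF ix], symmetric])
  also have "\<dots> = principal (inverse x * x) \<odot> ideal_norm H I'"
    using ix I'(4,5) by (simp add: principal_mult flip: cprod_assoc)
  also have "\<dots> = ideal_norm H I'" using I'(5) ideal_norm_FI[OF H I'(2)] by simp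
  finally have "ideal_norm H I' = principal (inverse x)" by simp
  moreover have "I' \<odot> I = OL" using I'(3) by (simp add: cprod_commute)
  ultimately have "I' \<in> norm_principal H"
    unfolding norm_principal_def using I'(1,2) ix by blast
  then show ?thesis using I'(3) by blast
qed

lemma principal_norm_principal:
  assumes H: "H \<subseteq> carrier G" and "x \<in> L" "x \<noteq> 0" shows "principal x \<in> norm_principal H"
proof -
  have "principal x \<odot> principal (inverse x) = OL"
    using assms by (subst principal_mult) (auto intro: inverse_closed)
  moreover have "principal (inverse x) \<in> carrier FI" "principal x \<in> carrier FI"
    using assms by (auto intro!: principal_FI inverse_closed)
  moreover have "ideal_norm H (principal x) = principal (norm_over H x)"
    by (rule ideal_norm_principal[OF assms])
  moreover have "norm_over H x \<in> L" "norm_over H x \<noteq> 0"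
    using assms norm_over_closed norm_over_nonzero by auto
  ultimately show ?thesis unfolding norm_principal_def by blast
qed

text \<open>The class of I has a representative J in \<open>norm_principal H\<close>, so I is a
  principal multiple of J and belongs to the same set.\<close>

lemma ideal_norm_principal_if_generated:
  assumes H: "H \<subseteq> carrier G" and Ps: "Ps \<subseteq> norm_principal H"
    and gen: "generate (class_group L) {ideal_class L P | P. P \<in> Ps} = carrier (class_group L)"
    and I: "I \<in> carrier FI"
  obtains x where "x \<in> L" "x \<noteq> 0" "ideal_norm H I = principal x"
proof -
  have "ideal_class L I \<in> carrier (class_group L)"
    unfolding class_group_def ideal_class_def cl.carrier_Mod using I by blast
  then have "ideal_class L I \<in> generate (class_group L) {ideal_class L P | P. P \<in> Ps}"
    unfolding gen .
  then have c: "ideal_class L I \<in> generate (FI Mod principal_fractional_ideals L)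
      {principal_fractional_ideals L #>\<^bsub>FI\<^esub> P | P. P \<in> Ps}"
    unfolding class_group_def ideal_class_def .
  have "\<exists>J\<in>norm_principal H. ideal_class L I = principal_fractional_ideals L #>\<^bsub>FI\<^esub> J"
  proof (rule cl.generate_Mod_representative[OF _ _ Ps _ _ c])
    show "norm_principal H \<subseteq> carrier FI" by (auto simp: norm_principal_def)
    show "\<one>\<^bsub>FI\<^esub> \<in> norm_principal H" using principal_norm_principal[OF H, of 1] by simp
  qed (use norm_principal_mult[OF H] norm_principal_inverse[OF H] in \<open>simp_all\<close>)
  then obtain J where J: "J \<in> norm_principal H"
    "principal_fractional_ideals L #>\<^bsub>FI\<^esub> I = principal_fractional_ideals L #>\<^bsub>FI\<^esub> J"
    unfolding ideal_class_def by blast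
  have "J \<in> carrier FI" using J(1) by (simp add: norm_principal_def)
  then obtain h where "h \<in> principal_fractional_ideals L" "I = h \<odot> J"
    using cl.coset_eq_iff[OF I] J(2) by auto
  then obtain x where "x \<in> L" "x \<noteq> 0" "I = principal x \<odot> J"
    by (auto simp: principal_fractional_ideals_eq)
  then have "I \<in> norm_principal H"
    using norm_principal_mult[OF H principal_norm_principal[OF H] J(1)] by simp
  then show ?thesis using that unfolding norm_principal_def by blast
qed

lemma unramified_prime_norm_principal:
  assumes H: "subgroup H G" and card: "card (carrier G) = f * card H" and "coprime f (card H)"
    and P: "prime_of L P" "unramified L \<rat> P" "residue_degree L \<rat> P = f"
  shows "P \<in> norm_principal H"
proof -
  obtain p where "prime_ideal_over L P p"
    using P(1) int_below_prime unfolding prime_of_def by blast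
  then interpret P: galois_prime L G s P p
    by (intro galois_prime.intro galois_extension_axioms)
  obtain J where J: "J \<in> carrier FI" "P \<odot> J = principal (of_nat p)"
    "\<And>B. B \<in> carrier FI \<Longrightarrow> B \<subseteq> OL \<Longrightarrow> P \<odot> (P \<odot> B) \<noteq> principal (of_nat p)"
    using P.unramified_factor[OF P(2)] by blast
  interpret U: unramified_prime L G s P p J
    by (intro unramified_prime.intro P.galois_prime_axioms unramified_prime_axioms.intro J)
  obtain k where k: "ideal_norm H P = principal (of_nat p ^ k)"
    using U.ideal_norm_principal_if_coprime[OF H] card assms(3) P(3) by metis
  obtain P' where "P' \<in> carrier FI" "P \<odot> P' = OL" using U.conj_inverse[OF P.P_conjugate] .
  moreover have "of_nat p ^ k \<in> L" "(of_nat p ^ k :: complex) \<noteq> 0"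
    using U.p_nonzero by (simp_all add: power_closed)
  ultimately show ?thesis unfolding norm_principal_def using k P.P_FI by blast
qed

end


section \<open>Extension of ideals from K to L and descent\<close>

locale subextension = galois_extension L G s + K: number_field K
  for L and G :: "('g, 'm) monoid_scheme" (structure) and s and K +
  fixes H :: "'g set"
  assumes K_subset: "K \<subseteq> L" and subgroup_H: "subgroup H G"
    and s_K: "h \<in> H \<Longrightarrow> x \<in> K \<Longrightarrow> s h x = x"
    and fixed_K: "x \<in> L \<Longrightarrow> (\<And>h. h \<in> H \<Longrightarrow> s h x = x) \<Longrightarrow> x \<in> K"
begin

lemma H_subset: "H \<subseteq> carrier G"
  using subgroup_H by (rule subgroup.subset)

lemma OK_subset: "K.OL \<subseteq> OL" and OL_Int_K: "OL \<inter> K = K.OL"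
  using K_subset by (auto simp: integers_set_def)

definition ext :: "complex set \<Rightarrow> complex set" where "ext I = I \<odot> OL"

lemma OL_OL: "OL \<odot> OL = OL"
  using OL_cprod(1)[OF OL_FI] .

lemma ext_FI: assumes "I \<in> carrier K.FI" shows "ext I \<in> carrier FI"
proof -
  note I = K.FI_D[OF assms]
  obtain x where x: "x \<in> I" "x \<noteq> 0" using K.FI_nonzero[OF assms] by blast
  obtain d where d: "d \<in> K.OL" "d \<noteq> 0" "\<And>x. x \<in> I \<Longrightarrow> d * x \<in> K.OL"
    using K.FI_denominator[OF assms] by blast
  have dO: "d \<in> OL" using d(1) OK_subset by blast
  show ?thesis
  proof (rule FI_I[of _ x d])
    show "ext I \<subseteq> L"
      unfolding ext_def using I(1) K_subset OL_subset
      by (intro cprod_subsetI mult_closed add_closed) auto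
    show "0 \<in> ext I" unfolding ext_def using cprodI[OF I(2) OL_0] by simp
    show "a + b \<in> ext I" if "a \<in> ext I" "b \<in> ext I" for a b
      using that unfolding ext_def by (rule cprod_add)
    show "x \<in> ext I" unfolding ext_def using cprodI[OF x(1) OL_1] by simp
    show "a * b \<in> ext I" if "a \<in> OL" "b \<in> ext I" for a b
    proof -
      have "b * a \<in> ext I \<odot> OL" using that by (intro cprodI)
      then show ?thesis unfolding ext_def cprod_assoc OL_OL by (simp add: mult.commute)
    qed
    show "d * a \<in> OL" if "a \<in> ext I" for a
      using that unfolding ext_def
    proof (induction rule: cprod_induct)
      case (prod i j)
      then have "(d * i) * j \<in> OL" by (intro OL_mult[OF subsetD[OF OK_subset d(3)]])
      then show ?case by (simp add: mult.assoc)
    qed (auto simp: distrib_left)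
  qed (use x d dO in auto)
qed

lemma ext_mult: "ext (I \<odot> J) = ext I \<odot> ext J"
proof -
  have "ext I \<odot> ext J = (I \<odot> J) \<odot> (OL \<odot> OL)"
    unfolding ext_def using cprod_assoc cprod_commute by metis
  then show ?thesis by (simp add: OL_OL ext_def)
qed

lemma ext_principal:
  assumes "x \<in> K" "x \<noteq> 0" shows "ext (K.principal x) = principal x"
proof -
  have "K.OL \<odot> OL = OL"
  proof
    show "K.OL \<odot> OL \<subseteq> OL" using cprod_mono[OF OK_subset order_refl[of OL]] OL_OL by simp
    show "OL \<subseteq> K.OL \<odot> OL" using cprodI[OF K.OL_1, of _ OL] by force
  qed
  \<comment> \<open>Writing both principal ideals as {x} times the ring of integers reduces the
    claim, by associativity, to O_K O_L = O_L.\<close>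
  moreover have "K.principal x = {x} \<odot> K.OL"
  proof
    have "K.principal x \<odot> K.OL = K.principal x" using K.OL_cprod K.principal_FI[OF assms] by blast
    then show "{x} \<odot> K.OL \<subseteq> K.principal x"
      using cprod_mono[of "{x}" "K.principal x" K.OL K.OL] K.principal_self by simp
    show "K.principal x \<subseteq> {x} \<odot> K.OL"
      unfolding K.principal_def using cprodI[of x "{x}" _ K.OL] by (auto simp: mult.commute)
  qed
  moreover have "principal x = {x} \<odot> OL"
  proof
    have "principal x \<odot> OL = principal x"
      using OL_cprod principal_FI[OF _ assms(2)] K_subset assms(1) by blast
    then show "{x} \<odot> OL \<subseteq> principal x"
      using cprod_mono[of "{x}" "principal x" OL OL] principal_self by simp
    show "principal x \<subseteq> {x} \<odot> OL"
      unfolding principal_def using cprodI[of x "{x}" _ OL] by (auto simp: mult.commute)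
  qed
  ultimately show ?thesis by (simp add: ext_def cprod_assoc)
qed

lemma ext_pow:
  assumes "I \<in> carrier K.FI" shows "ext (I [^]\<^bsub>K.FI\<^esub> (k :: nat)) = ext I [^]\<^bsub>FI\<^esub> k"
proof (induction k)
  case 0
  then show ?case using ext_principal[of 1] by simp
next
  case (Suc k)
  then show ?case by (simp add: ext_mult)
qed

lemma image_s_ext:
  assumes "I \<in> carrier K.FI" "h \<in> H" shows "s h ` ext I = ext I"
proof -
  have h: "h \<in> carrier G" using assms(2) H_subset by blast
  have IK: "I \<subseteq> K" using K.FI_D(1)[OF assms(1)] .
  have "s h ` ext I = s h ` I \<odot> s h ` OL"
    unfolding ext_def using h IK K_subset OL_subset by (intro image_s_cprod) auto
  also have "s h ` I = I"
  proof -
    have "s h ` I = (\<lambda>x. x) ` I" using IK s_K[OF assms(2)] by (intro image_cong) auto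
    then show ?thesis by simp
  qed
  also have "s h ` OL = OL" using image_s_OL[OF h] .
  finally show ?thesis by (simp add: ext_def)
qed

text \<open>An ideal of K whose extension is O_L lies in O_L \<inter> K = O_K. This holds for A and
  for its inverse A', and A' inside O_K gives O_K = A A' inside A.\<close>

lemma ext_eq_OL_imp:
  assumes "A \<in> carrier K.FI" "A' \<in> carrier K.FI" "A \<odot> A' = K.OL" "ext A = OL"
  shows "A = K.OL"
proof -
  have le: "B \<subseteq> K.OL" if "B \<in> carrier K.FI" "ext B = OL" for B
  proof
    fix x assume x: "x \<in> B"
    then have "x \<in> OL" using cprodI[OF x OL_1] that(2) by (simp add: ext_def)
    moreover have "x \<in> K" using K.FI_D(1)[OF that(1)] x by blast
    ultimately show "x \<in> K.OL" using OL_Int_K by blast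
  qed
  have "ext A' = ext A \<odot> ext A'" using assms(4) OL_cprod(1)[OF ext_FI[OF assms(2)]] by simp
  also have "\<dots> = ext K.OL" by (simp add: ext_mult[symmetric] assms(3))
  also have "\<dots> = OL" using ext_principal[of 1] by simp
  finally have "A' \<subseteq> K.OL" using le[OF assms(2)] by blast
  then have "K.OL \<subseteq> A \<odot> K.OL" using cprod_mono[OF order_refl[of A]] assms(3) by metis
  then show ?thesis using le[OF assms(1,4)] K.OL_cprod(2)[OF assms(1)] by blast
qed

text \<open>The extension of I is stable under H, so its norm is its |H|-th power, generated by x.
  Taking norms once more doubles the exponent |H| multiplicatively and replaces x by its norm y,
  which lies in K.\<close>

lemma pow_card_principal:
  assumes I: "I \<in> carrier K.FI" "I' \<in> carrier K.FI" "I \<odot> I' = K.OL"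
    and norm: "x \<in> L" "x \<noteq> 0" "ideal_norm H (ext I) = principal x"
  obtains y where "y \<in> K" "y \<noteq> 0" "I [^]\<^bsub>K.FI\<^esub> (card H * card H) = K.principal y"
proof -
  define y where "y = norm_over H x"
  have y: "y \<in> K" "y \<noteq> 0"
    unfolding y_def using norm H_subset s_norm_over[OF subgroup_H]
    by (auto intro!: fixed_K norm_over_closed simp: norm_over_nonzero)
  have IH: "I [^]\<^bsub>K.FI\<^esub> card H \<in> carrier K.FI" using I(1) by (rule K.FI.nat_pow_closed)
  have "ext (I [^]\<^bsub>K.FI\<^esub> card H) = principal x"
    using ideal_norm_fixed[OF H_subset ext_FI[OF I(1)] image_s_ext[OF I(1)]] norm(3) ext_pow[OF I(1)] by simp
  then have "ext (I [^]\<^bsub>K.FI\<^esub> card H) [^]\<^bsub>FI\<^esub> card H = principal y"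
    using ideal_norm_fixed[OF H_subset ext_FI[OF IH] image_s_ext[OF IH]]
      ideal_norm_principal[OF H_subset norm(1,2)] by (simp add: y_def)
  then have ext: "ext (I [^]\<^bsub>K.FI\<^esub> (card H * card H)) = principal y"
    using ext_pow[OF IH] K.FI.nat_pow_pow[OF I(1)] by metis
  define J where "J = I [^]\<^bsub>K.FI\<^esub> (card H * card H)"
  define J' where "J' = I' [^]\<^bsub>K.FI\<^esub> (card H * card H)"
  have J: "J \<in> carrier K.FI" "J' \<in> carrier K.FI"
    using K.FI.nat_pow_closed I(1,2) by (auto simp: J_def J'_def)
  have JJ': "J \<odot> J' = K.OL"
    using K.FI.nat_pow_distrib[OF I(1,2), of "card H * card H"] I(3) K.FI.nat_pow_one
    by (simp add: J_def J'_def)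
  have iy: "inverse y \<in> K" "inverse y \<noteq> 0" using y by auto
  have Py: "K.principal y \<in> carrier K.FI" "K.principal (inverse y) \<in> carrier K.FI"
    using y iy by auto
  have yy: "K.principal y \<odot> K.principal (inverse y) = K.OL"
    using y iy by (simp add: K.principal_mult)
  \<comment> \<open>Descent to K: this ideal extends to O_L and has the explicit inverse J' (y), so
    \<open>ext_eq_OL_imp\<close> applies.\<close>
  have "J \<odot> K.principal (inverse y) = K.OL"
  proof (rule ext_eq_OL_imp)
    show "J \<odot> K.principal (inverse y) \<in> carrier K.FI" "J' \<odot> K.principal y \<in> carrier K.FI"
      using J Py by auto
    have "(J \<odot> K.principal (inverse y)) \<odot> (J' \<odot> K.principal y) =
        (J \<odot> J') \<odot> (K.principal y \<odot> K.principal (inverse y))"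
      using cprod_assoc cprod_commute by metis
    then show "(J \<odot> K.principal (inverse y)) \<odot> (J' \<odot> K.principal y) = K.OL"
      using JJ' yy K.OL_cprod(1)[OF K.OL_FI] by simp
    have "ext (J \<odot> K.principal (inverse y)) = principal y \<odot> principal (inverse y)"
      using ext iy by (simp add: ext_mult J_def ext_principal)
    also have "\<dots> = OL" using y iy K_subset by (subst principal_mult) auto
    finally show "ext (J \<odot> K.principal (inverse y)) = OL" .
  qed
  then have "(J \<odot> K.principal (inverse y)) \<odot> K.principal y = K.principal y"
    using K.OL_cprod(1)[OF Py(1)] by simp
  then have "J \<odot> (K.principal y \<odot> K.principal (inverse y)) = K.principal y"
    using cprod_assoc cprod_commute by metis
  then have "J = K.principal y" using yy K.OL_cprod(2)[OF J(1)] by simp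
  then show ?thesis using that y by (simp add: J_def)
qed

lemma q_part_class_group_trivial:
  assumes q: "Factorial_Ring.prime q" "\<not> q dvd card H"
    and norm: "\<And>I. I \<in> carrier FI \<Longrightarrow> \<exists>x\<in>L. x \<noteq> 0 \<and> ideal_norm H I = principal x"
  shows "q_part q (class_group K) = {\<one>\<^bsub>class_group K\<^esub>}"
proof -
  interpret C: comm_monoid "class_group K"
    unfolding class_group_def by (rule K.cl.comm_monoid_Mod)
  let ?cl = "\<lambda>I. principal_fractional_ideals K #>\<^bsub>K.FI\<^esub> I"
  have pow: "?cl I [^]\<^bsub>class_group K\<^esub> (k :: nat) = ?cl (I [^]\<^bsub>K.FI\<^esub> k)"
    if "I \<in> carrier K.FI" for I k
    unfolding class_group_def by (rule K.cl.pow_Mod[OF that])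
  have one: "\<one>\<^bsub>class_group K\<^esub> = ?cl K.OL"
    unfolding class_group_def K.cl.one_Mod by simp
  have one_iff: "?cl I = \<one>\<^bsub>class_group K\<^esub> \<longleftrightarrow> (\<exists>x\<in>K. x \<noteq> 0 \<and> I = K.principal x)"
    if I: "I \<in> carrier K.FI" for I
  proof -
    have "?cl I = \<one>\<^bsub>class_group K\<^esub> \<longleftrightarrow> (\<exists>h\<in>principal_fractional_ideals K. I = h \<otimes>\<^bsub>K.FI\<^esub> K.OL)"
      unfolding one by (rule K.cl.coset_eq_iff[OF I K.OL_FI])
    then show ?thesis
      using K.OL_cprod(2)[OF K.principal_FI] by (auto simp: K.principal_fractional_ideals_eq)
  qed
  have "c = \<one>\<^bsub>class_group K\<^esub>" if c: "c \<in> q_part q (class_group K)" for c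
  proof -
    obtain k :: nat where cC: "c \<in> carrier (class_group K)"
      and k: "c [^]\<^bsub>class_group K\<^esub> (q ^ k) = \<one>\<^bsub>class_group K\<^esub>"
      using c unfolding q_part_def by blast
    obtain I where I: "I \<in> carrier K.FI" "c = ?cl I"
      using cC unfolding class_group_def K.cl.carrier_Mod by blast
    have "?cl (I [^]\<^bsub>K.FI\<^esub> (q ^ k)) = \<one>\<^bsub>class_group K\<^esub>" using k pow[OF I(1)] I(2) by simp
    then obtain y where y: "y \<in> K" "y \<noteq> 0" "I [^]\<^bsub>K.FI\<^esub> (q ^ k) = K.principal y"
      using one_iff[OF K.FI.nat_pow_closed[OF I(1)]] by blast
    have "q ^ k > 0" using q(1) prime_gt_0_nat by simp
    then obtain j where j: "q ^ k = Suc j" by (cases "q ^ k") auto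
    \<comment> \<open>I is invertible because its power q^k is generated by y: the inverse is I^(q^k
      - 1) divided by y, with j = q^k - 1.\<close>
    define I' where "I' = I [^]\<^bsub>K.FI\<^esub> j \<odot> K.principal (inverse y)"
    have I': "I' \<in> carrier K.FI"
      unfolding I'_def using y K.FI.nat_pow_closed[OF I(1)] by (intro K.cprod_FI K.principal_FI) auto
    have "I \<odot> I' = I [^]\<^bsub>K.FI\<^esub> (q ^ k) \<odot> K.principal (inverse y)"
      unfolding I'_def j by (simp add: cprod_assoc) (metis cprod_assoc cprod_commute)
    also have "\<dots> = K.OL" unfolding y(3) using y by (subst K.principal_mult) auto
    finally have II': "I \<odot> I' = K.OL" .
    obtain x where x: "x \<in> L" "x \<noteq> 0" "ideal_norm H (ext I) = principal x"
      using norm[OF ext_FI[OF I(1)]] by blast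
    obtain z where "z \<in> K" "z \<noteq> 0" "I [^]\<^bsub>K.FI\<^esub> (card H * card H) = K.principal z"
      by (rule pow_card_principal[OF I(1) I' II' x])
    then have m: "c [^]\<^bsub>class_group K\<^esub> (card H * card H) = \<one>\<^bsub>class_group K\<^esub>"
      using pow[OF I(1)] I(2) one_iff[OF K.FI.nat_pow_closed[OF I(1)]] by metis
    have "coprime (q ^ k) (card H * card H)"
      using prime_imp_coprime[OF q] by simp
    then show ?thesis using C.coprime_pow_eq_one[OF cC k m] by (simp add: coprime_iff_gcd_eq_1)
  qed
  moreover have "\<one>\<^bsub>class_group K\<^esub> \<in> q_part q (class_group K)"
    unfolding q_part_def using C.nat_pow_one by auto
  ultimately show ?thesis by blast
qed

end


theorem theorem1p6:
  fixes n f q :: nat and \<zeta> :: complex and K :: "complex set"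
  assumes "n > 0"
    and "cyclic_group (units_of (ZFact (int n)))"
    and "primitive_root_of_unity n \<zeta>"
    and "f dvd totient n"
    and "coprime f (totient n div f)"
    and "subfield K \<C>" and "K \<subseteq> adjoin_rat \<zeta>" and "field_degree K \<rat> = f"
    and "f \<in> R_set (adjoin_rat \<zeta>) \<rat>"
    and "Factorial_Ring.prime q" and "\<not> q dvd totient n div f"
  shows "q_part q (class_group K) = {\<one>\<^bsub>class_group K\<^esub>}"
proof -
  interpret Z: intermediate_field n \<zeta> K
    by (intro intermediate_field.intro root_of_unity.intro intermediate_field_axioms.intro assms)
  interpret L: galois_extension Z.L Z.galois_group Z.act by (rule Z.galois_extension_L)
  define H where "H = Z.fixing_exponents"
  interpret S: subextension Z.L Z.galois_group Z.act K H
  proof (intro subextension.intro subextension_axioms.intro L.galois_extension_axioms number_field.intro)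
    show "x \<in> K" if "x \<in> Z.L" "\<And>h. h \<in> H \<Longrightarrow> Z.act h x = x" for x
      using Z.fixed_field that unfolding H_def by blast
  qed (use Z.degree_formula(1) Z.subgroup_fixing_exponents assms in
      \<open>auto simp: H_def Z.fixing_exponents_def\<close>)
  have card: "card (carrier Z.galois_group) = f * card H"
    using Z.degree_formula(2) assms(8) by (simp add: H_def)
  then obtain t where t: "totient n = f * card H * t"
    using Z.card_galois_group_dvd by auto
  have "f > 0" using assms(1,4) by (auto intro: Nat.gr0I)
  \<comment> \<open>Since |H| divides \<open>totient n div f\<close>, with quotient t, both
    coprimality to f and non-divisibility by q pass to |H|.\<close>
  then have quot: "totient n div f = card H * t" using t by (simp add: mult.assoc)
  have coprime: "coprime f (card H)" using assms(5) unfolding quot by simp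
  define Ps where "Ps = {P. prime_of Z.L P \<and> unramified Z.L \<rat> P \<and> residue_degree Z.L \<rat> P = f}"
  have "Ps \<subseteq> L.norm_principal H"
    using L.unramified_prime_norm_principal[OF S.subgroup_H card coprime] unfolding Ps_def by blast
  note norm = L.ideal_norm_principal_if_generated[OF S.H_subset this]
  have gen: "generate (class_group Z.L) {ideal_class Z.L P | P. P \<in> Ps} = carrier (class_group Z.L)"
    using assms(9) unfolding R_set_def Ps_def by simp
  have norm: "\<exists>x\<in>Z.L. x \<noteq> 0 \<and> L.ideal_norm H I = L.principal x" if I: "I \<in> carrier L.FI" for I
    by (rule norm[OF gen I]) blast
  have "\<not> q dvd card H" using assms(11) unfolding quot by auto
  then show ?thesis using norm by (rule S.q_part_class_group_trivial[OF assms(10)])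
qed

end
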